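(* Let $V$ be an irreducible vertex algebra over $\mathbb{C}$ of countable dimension, and let $H$ be a Hopf algebra over $\mathbb{C}$ such that $V$ is an $H$-module vertex algebra. Let $M$ be a Hopf $V$-module such that $M$ is an irreducible $V$-module. Assume that both $V$ and $M$ are direct sums of finite-dimensional irreducible $H$-modules. Let $\Lambda$ be the set of characters of all finite-dimensional irreducible representations of $H$; for $\lambda\in\Lambda$ let $W_\lambda$ be the corresponding irreducible $H$-module and $M_\lambda=\mathrm{Hom}_H(W_\lambda,M)$, with the $V^H$-module structure $(v_nf)(w)=v_n(f(w))$ for $v\in V^H$, $n\in\mathbb{Z}$, $f\in M_\lambda$, $w\in W_\lambda$. Then the decomposition $$M=\bigoplus_{\lambda\in\Lambda}W_\lambda\otimes M_\lambda$$ (as modules for $H$ and $V^H$, with $w\otimes f$ identified with $f(w)$) gives a dual pair $(H,V^H)$ on $M$ in the following sense: (1) For every $\lambda\in\Lambda$ such that $M_\lambda\neq 0$, $M_\lambda$ is an irreducible $V^H$-module. (2) If $M_\lambda$ and $M_\mu$ are nonzero, then $M_\lambda$ and $M_\mu$ are isomorphic $V^H$-modules if and only if $\lambda=\mu$.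
   Context: All vector spaces and tensor products are over $\mathbb{C}$. A vertex algebra is a vector space $V$ with a vacuum vector $\mathbf{1}\in V$ and a linear map $Y(\cdot,z): V\to \mathrm{End}_{\mathbb{C}}(V)[[z,z^{-1}]]$, $v\mapsto Y(v,z)=\sum_{n\in\mathbb{Z}} v_n z^{-n-1}$, such that: for $u,v\in V$, $u_nv=0$ for $n$ sufficiently large; $Y(\mathbf{1},z)=\mathrm{Id}_V$; $Y(u,z)\mathbf{1}\in u+zV[[z]]$; and the Jacobi identity $$z_0^{-1}\delta\left(\tfrac{z_1-z_2}{z_0}\right)Y(u,z_1)Y(v,z_2)-z_0^{-1}\delta\left(\tfrac{z_2-z_1}{-z_0}\right)Y(v,z_2)Y(u,z_1)=z_2^{-1}\delta\left(\tfrac{z_1-z_0}{z_2}\right)Y(Y(u,z_0)v,z_2)$$ holds, where $\delta(z)=\sum_{n\in\mathbb{Z}}z^n$ and binomials are expanded in nonnegative integral powers of the second variable. No grading is assumed. A $V$-module is a vector space $M$ with a linear map $Y_M(\cdot,z):V\to\mathrm{End}_{\mathbb{C}}(M)[[z,z^{-1}]]$, $v\mapsto\sum_n v_nz^{-n-1}$, with $u_nw=0$ for $n$ large ($u\in V,w\in M$), $Y_M(\mathbf{1},z)=\mathrm{Id}_M$, and the Jacobi identity with $Y$ replaced by $Y_M$ (the right side being $z_2^{-1}\delta(\frac{z_1-z_0}{z_2})Y_M(Y(u,z_0)v,z_2)$). $V$ is irreducible if it is irreducible as a $V$-module. Sweedler notation: $\Delta(h)=\sum h_1\otimes h_2$;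 $\epsilon$ is the counit. $V$ is an $H$-module vertex algebra if $V$ is an $H$-module, $h\mathbf{1}=\epsilon(h)\mathbf{1}$, and $h(Y(u,z)v)=\sum Y(h_1u,z)h_2v$ for all $h\in H$, $u,v\in V$. Then $V^H=\{v\in V\mid hv=\epsilon(h)v\ \text{for all } h\in H\}$ is a vertex subalgebra of $V$. A Hopf $V$-module is a $V$-module $M$ that is also an $H$-module with $h(Y_M(u,z)w)=\sum Y_M(h_1u,z)h_2w$ for all $h\in H$, $u\in V$, $w\in M$; the actions of $H$ and $V^H$ on $M$ then commute. *)

theory Defs
  imports Complex_Main "HOL-Library.Function_Algebras" "HOL-Library.Poly_Mapping"
    "HOL-Library.Countable_Set"
begin

section \<open>Complex vector spaces and algebras\<close>

class complex_vector = ab_group_add +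
  fixes scaleC :: "complex \<Rightarrow> 'a \<Rightarrow> 'a" (infixr \<open>*\<^sub>C\<close> 75)
  assumes scaleC_add_right: "a *\<^sub>C (x + y) = a *\<^sub>C x + a *\<^sub>C y"
    and scaleC_add_left: "(a + b) *\<^sub>C x = a *\<^sub>C x + b *\<^sub>C x"
    and scaleC_scaleC: "a *\<^sub>C b *\<^sub>C x = (a * b) *\<^sub>C x"
    and scaleC_one: "1 *\<^sub>C x = x"

global_interpretation cvec: vector_space "scaleC :: complex \<Rightarrow> 'a \<Rightarrow> 'a::complex_vector"
  by unfold_locales (rule scaleC_add_right scaleC_add_left scaleC_scaleC scaleC_one)+

abbreviation clinear :: "('a::complex_vector \<Rightarrow> 'b::complex_vector) \<Rightarrow> bool"
  where "clinear \<equiv> Vector_Spaces.linear scaleC scaleC"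

class complex_algebra_1 = complex_vector + ring_1 +
  assumes mult_scaleC_left: "(c *\<^sub>C x) * y = c *\<^sub>C (x * y)"
    and mult_scaleC_right: "x * (c *\<^sub>C y) = c *\<^sub>C (x * y)"

instantiation complex :: complex_algebra_1
begin
definition scaleC_complex :: "complex \<Rightarrow> complex \<Rightarrow> complex"
  where "scaleC_complex = (*)"
instance
  by standard (simp_all add: scaleC_complex_def algebra_simps)
end

instantiation "fun" :: (type, complex_vector) complex_vector
begin
definition scaleC_fun :: "complex \<Rightarrow> ('a \<Rightarrow> 'b) \<Rightarrow> 'a \<Rightarrow> 'b"
  where "scaleC_fun c f = (\<lambda>x. c *\<^sub>C f x)"
instance
  by standard (simp_all add: scaleC_fun_def fun_eq_iff algebra_simps)
end

instantiation poly_mapping :: (type, complex_vector) complex_vector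
begin
lift_definition scaleC_poly_mapping :: "complex \<Rightarrow> ('a \<Rightarrow>\<^sub>0 'b) \<Rightarrow> 'a \<Rightarrow>\<^sub>0 'b"
  is "\<lambda>c f x. c *\<^sub>C f x"
  by (erule rev_finite_subset) auto
instance
  by standard (transfer; simp add: fun_eq_iff algebra_simps)+
end

lemma lookup_scaleC [simp]: "Poly_Mapping.lookup (c *\<^sub>C f) x = c *\<^sub>C Poly_Mapping.lookup f x"
  by transfer simp

definition linear_on :: "'a::complex_vector set \<Rightarrow> ('a \<Rightarrow> 'b::complex_vector) \<Rightarrow> bool"
  where "linear_on U f \<longleftrightarrow>
    (\<forall>x\<in>U. \<forall>y\<in>U. f (x + y) = f x + f y) \<and> (\<forall>c. \<forall>x\<in>U. f (c *\<^sub>C x) = c *\<^sub>C f x)"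

definition finite_dim :: "'a::complex_vector set \<Rightarrow> bool"
  where "finite_dim U \<longleftrightarrow> (\<exists>B. finite B \<and> cvec.independent B \<and> cvec.span B = U)"

definition countable_dim :: "'a::complex_vector set \<Rightarrow> bool"
  where "countable_dim U \<longleftrightarrow> (\<exists>B. countable B \<and> cvec.independent B \<and> cvec.span B = U)"

text \<open>Trace of an operator on a finite-dimensional subspace; it does not depend on the basis chosen.\<close>
definition trace_on :: "'a::complex_vector set \<Rightarrow> ('a \<Rightarrow> 'a) \<Rightarrow> complex"
  where "trace_on U T =
    (let B = (SOME B. cvec.independent B \<and> cvec.span B = U)
     in \<Sum>b\<in>B. cvec.representation B (T b) b)"

text \<open>The space \<open>U\<close> is the internal direct sum of the subspaces in \<open>\<U>\<close>. In the uses below the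
  summands are nonzero, so indexing them by themselves is no restriction.\<close>
definition internal_direct_sum :: "'a::complex_vector set \<Rightarrow> 'a set set \<Rightarrow> bool"
  where "internal_direct_sum U \<U> \<longleftrightarrow>
    bij_betw (\<lambda>f. \<Sum>S\<in>Poly_Mapping.keys f. Poly_Mapping.lookup f S)
      {f :: 'a set \<Rightarrow>\<^sub>0 'a. \<forall>S\<in>Poly_Mapping.keys f. S \<in> \<U> \<and> Poly_Mapping.lookup f S \<in> S} U"


section \<open>Tensor products\<close>

text \<open>The tensor product of two spaces is the free vector space on the set of pairs modulo the
  bilinearity relations.\<close>

definition tensor_relations ::
    "(('a::complex_vector \<times> 'b::complex_vector) \<Rightarrow>\<^sub>0 complex) set"
  where "tensor_relations =
    {Poly_Mapping.single (a + a', b) 1 - Poly_Mapping.single (a, b) 1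
       - Poly_Mapping.single (a', b) 1 | a a' b. True}
    \<union> {Poly_Mapping.single (a, b + b') 1 - Poly_Mapping.single (a, b) 1
       - Poly_Mapping.single (a, b') 1 | a b b'. True}
    \<union> {Poly_Mapping.single (c *\<^sub>C a, b) 1 - Poly_Mapping.single (a, b) c | c a b. True}
    \<union> {Poly_Mapping.single (a, c *\<^sub>C b) 1 - Poly_Mapping.single (a, b) c | c a b. True}"

definition tensor_eq :: "(('a::complex_vector \<times> 'b::complex_vector) \<Rightarrow>\<^sub>0 complex)
    \<Rightarrow> (('a \<times> 'b) \<Rightarrow>\<^sub>0 complex) \<Rightarrow> bool"
  where "tensor_eq x y \<longleftrightarrow> x - y \<in> cvec.span tensor_relations"

lemma equivp_tensor_eq: "equivp tensor_eq"
proof (rule equivpI[OF reflpI sympI transpI])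
  show "tensor_eq x x" for x :: "('a \<times> 'b) \<Rightarrow>\<^sub>0 complex"
    by (simp add: tensor_eq_def cvec.span_zero)
  show "tensor_eq y x" if "tensor_eq x y" for x y :: "('a \<times> 'b) \<Rightarrow>\<^sub>0 complex"
    using that cvec.span_neg[of "x - y"] by (simp add: tensor_eq_def)
  show "tensor_eq x z" if "tensor_eq x y" "tensor_eq y z"
    for x y z :: "('a \<times> 'b) \<Rightarrow>\<^sub>0 complex"
    using that cvec.span_add[of "x - y" _ "y - z"] by (simp add: tensor_eq_def)
qed

quotient_type (overloaded) ('a, 'b) tensor =
    "('a::complex_vector \<times> 'b::complex_vector) \<Rightarrow>\<^sub>0 complex" / tensor_eq
  by (rule equivp_tensor_eq)

instantiation tensor :: (complex_vector, complex_vector) complex_vector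
begin
lift_definition zero_tensor :: "('a, 'b) tensor" is 0 .
lift_definition plus_tensor :: "('a, 'b) tensor \<Rightarrow> ('a, 'b) tensor \<Rightarrow> ('a, 'b) tensor" is "(+)"
proof -
  fix x x' y y' :: "('a \<times> 'b) \<Rightarrow>\<^sub>0 complex"
  assume "tensor_eq x x'" "tensor_eq y y'"
  then show "tensor_eq (x + y) (x' + y')"
    unfolding tensor_eq_def using cvec.span_add[of "x - x'" _ "y - y'"]
    by (simp add: algebra_simps)
qed
lift_definition uminus_tensor :: "('a, 'b) tensor \<Rightarrow> ('a, 'b) tensor" is uminus
proof -
  fix x x' :: "('a \<times> 'b) \<Rightarrow>\<^sub>0 complex"
  assume "tensor_eq x x'"
  then show "tensor_eq (- x) (- x')"
    unfolding tensor_eq_def using cvec.span_neg[of "x - x'"] by simp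
qed
lift_definition minus_tensor :: "('a, 'b) tensor \<Rightarrow> ('a, 'b) tensor \<Rightarrow> ('a, 'b) tensor" is "(-)"
proof -
  fix x x' y y' :: "('a \<times> 'b) \<Rightarrow>\<^sub>0 complex"
  assume "tensor_eq x x'" "tensor_eq y y'"
  then show "tensor_eq (x - y) (x' - y')"
    unfolding tensor_eq_def using cvec.span_diff[of "x - x'" _ "y - y'"]
    by (simp add: algebra_simps)
qed
lift_definition scaleC_tensor :: "complex \<Rightarrow> ('a, 'b) tensor \<Rightarrow> ('a, 'b) tensor" is scaleC
proof -
  fix c and x x' :: "('a \<times> 'b) \<Rightarrow>\<^sub>0 complex"
  assume "tensor_eq x x'"
  then show "tensor_eq (c *\<^sub>C x) (c *\<^sub>C x')"
    unfolding tensor_eq_def using cvec.span_scale[of "x - x'" _ c]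
    by (simp add: cvec.scale_right_diff_distrib)
qed
instance
  by standard (transfer; simp add: tensor_eq_def cvec.span_zero algebra_simps)+
end

lift_definition tensor_prod :: "'a::complex_vector \<Rightarrow> 'b::complex_vector \<Rightarrow> ('a, 'b) tensor"
    (infixr \<open>\<otimes>\<close> 72)
  is "\<lambda>a b. Poly_Mapping.single (a, b) 1" .

definition cbilinear ::
    "('a::complex_vector \<Rightarrow> 'b::complex_vector \<Rightarrow> 'c::complex_vector) \<Rightarrow> bool"
  where "cbilinear \<beta> \<longleftrightarrow> (\<forall>b. clinear (\<lambda>a. \<beta> a b)) \<and> (\<forall>a. clinear (\<beta> a))"

definition free_extend :: "('a \<times> 'b \<Rightarrow> 'c::complex_vector) \<Rightarrow> (('a \<times> 'b) \<Rightarrow>\<^sub>0 complex) \<Rightarrow> 'c"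
  where "free_extend g x = (\<Sum>p\<in>Poly_Mapping.keys x. Poly_Mapping.lookup x p *\<^sub>C g p)"

text \<open>The map induced by a bilinear map; meaningful only for bilinear arguments, for which the
  choice of representative does not matter. In Sweedler notation, \<open>tensor_lift \<beta> (\<Delta> h)\<close> is the
  sum of all \<open>\<beta> h\<^sub>1 h\<^sub>2\<close>.\<close>
definition tensor_lift :: "('a::complex_vector \<Rightarrow> 'b::complex_vector \<Rightarrow> 'c::complex_vector)
    \<Rightarrow> ('a, 'b) tensor \<Rightarrow> 'c"
  where "tensor_lift \<beta> t = free_extend (case_prod \<beta>) (rep_tensor t)"

lemma free_extend_superset:
  assumes "finite K" "Poly_Mapping.keys x \<subseteq> K"
  shows "free_extend g x = (\<Sum>p\<in>K. Poly_Mapping.lookup x p *\<^sub>C g p)"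
  unfolding free_extend_def
  by (rule sum.mono_neutral_left) (use assms in \<open>auto simp: in_keys_iff\<close>)

lemma free_extend_add: "free_extend g (x + y) = free_extend g x + free_extend g y"
proof -
  let ?K = "Poly_Mapping.keys x \<union> Poly_Mapping.keys y"
  have "Poly_Mapping.keys (x + y) \<subseteq> ?K" by (rule Poly_Mapping.keys_add)
  then show ?thesis
    by (simp add: free_extend_superset[of ?K] lookup_add scaleC_add_left sum.distrib)
qed

lemma free_extend_scaleC: "free_extend g (c *\<^sub>C x) = c *\<^sub>C free_extend g x"
proof -
  have "Poly_Mapping.keys (c *\<^sub>C x) \<subseteq> Poly_Mapping.keys x" by (auto simp: in_keys_iff)
  then show ?thesis
    by (simp add: free_extend_superset[of "Poly_Mapping.keys x"] cvec.scale_sum_right scaleC_complex_def)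
qed

lemma free_extend_single: "free_extend g (Poly_Mapping.single p c) = c *\<^sub>C g p"
  by (simp add: free_extend_superset[of "{p}"])

lemma linear_free_extend: "clinear (free_extend g)"
  by (intro linear_module_homI module_hom.intro module_hom_axioms.intro)
    (auto simp: free_extend_add free_extend_scaleC cvec.module_axioms)

lemma cbilinear_simps:
  assumes "cbilinear \<beta>"
  shows "\<beta> (a + a') b = \<beta> a b + \<beta> a' b" "\<beta> a (b + b') = \<beta> a b + \<beta> a b'"
    "\<beta> (c *\<^sub>C a) b = c *\<^sub>C \<beta> a b" "\<beta> a (c *\<^sub>C b) = c *\<^sub>C \<beta> a b"
proof -
  interpret L: Vector_Spaces.linear scaleC scaleC "\<lambda>a. \<beta> a b"
    using assms by (simp add: cbilinear_def)
  interpret R: Vector_Spaces.linear scaleC scaleC "\<beta> a"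
    using assms by (simp add: cbilinear_def)
  show "\<beta> (a + a') b = \<beta> a b + \<beta> a' b" "\<beta> a (b + b') = \<beta> a b + \<beta> a b'"
    "\<beta> (c *\<^sub>C a) b = c *\<^sub>C \<beta> a b" "\<beta> a (c *\<^sub>C b) = c *\<^sub>C \<beta> a b"
    by (rule L.add R.add L.scale R.scale)+
qed

lemma free_extend_tensor_eq:
  assumes "cbilinear \<beta>" "tensor_eq x y"
  shows "free_extend (case_prod \<beta>) x = free_extend (case_prod \<beta>) y"
proof -
  let ?F = "free_extend (case_prod \<beta>)"
  interpret F: Vector_Spaces.linear scaleC scaleC ?F by (rule linear_free_extend)
  have zero: "?F r = 0" if "r \<in> tensor_relations" for r
    using that
    by (auto simp: tensor_relations_def F.diff free_extend_single cbilinear_simps[OF assms(1)])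
  have "?F z = 0" if "z \<in> cvec.span tensor_relations" for z
    using that by (induction rule: cvec.span_induct_alt) (auto simp: F.add F.scale F.zero zero)
  then have "?F (x - y) = 0"
    using assms(2) by (simp add: tensor_eq_def)
  then show ?thesis by (simp add: F.diff)
qed

lemma tensor_lift_abs:
  assumes "cbilinear \<beta>"
  shows "tensor_lift \<beta> (abs_tensor x) = free_extend (case_prod \<beta>) x"
  unfolding tensor_lift_def
  by (rule free_extend_tensor_eq[OF assms])
    (rule Quotient3_rep_abs[OF Quotient3_tensor],
     use equivp_tensor_eq equivp_reflp in fastforce)

lemma tensor_lift_prod [simp]: "cbilinear \<beta> \<Longrightarrow> tensor_lift \<beta> (a \<otimes> b) = \<beta> a b"
  by (simp add: tensor_prod.abs_eq tensor_lift_abs free_extend_single)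

lemma linear_tensor_lift:
  assumes "cbilinear \<beta>"
  shows "clinear (tensor_lift \<beta>)"
proof -
  have "tensor_lift \<beta> (s + t) = tensor_lift \<beta> s + tensor_lift \<beta> t" for s t
    by (induction s rule: tensor.abs_induct, induction t rule: tensor.abs_induct)
      (simp add: plus_tensor.abs_eq tensor_lift_abs[OF assms] free_extend_add)
  moreover have "tensor_lift \<beta> (c *\<^sub>C t) = c *\<^sub>C tensor_lift \<beta> t" for c t
    by (induction t rule: tensor.abs_induct)
      (simp add: scaleC_tensor.abs_eq tensor_lift_abs[OF assms] free_extend_scaleC)
  ultimately show ?thesis
    by (intro linear_module_homI module_hom.intro module_hom_axioms.intro)
      (auto simp: cvec.module_axioms)
qed

definition tensor_map :: "('a::complex_vector \<Rightarrow> 'c::complex_vector)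
    \<Rightarrow> ('b::complex_vector \<Rightarrow> 'd::complex_vector) \<Rightarrow> ('a, 'b) tensor \<Rightarrow> ('c, 'd) tensor"
  where "tensor_map f g = tensor_lift (\<lambda>a b. f a \<otimes> g b)"

definition tensor_assoc :: "(('a::complex_vector, 'b::complex_vector) tensor,
    'c::complex_vector) tensor \<Rightarrow> ('a, ('b, 'c) tensor) tensor"
  where "tensor_assoc = tensor_lift (\<lambda>t c. tensor_lift (\<lambda>a b. a \<otimes> (b \<otimes> c)) t)"

definition tensor_mult :: "('a::complex_algebra_1, 'b::complex_algebra_1) tensor
    \<Rightarrow> ('a, 'b) tensor \<Rightarrow> ('a, 'b) tensor"
  where "tensor_mult s t =
    tensor_lift (\<lambda>a b. tensor_lift (\<lambda>c d. (a * c) \<otimes> (b * d)) t) s"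


section \<open>Hopf algebras and their modules\<close>

locale hopf_algebra =
  fixes \<Delta> :: "'h::complex_algebra_1 \<Rightarrow> ('h, 'h) tensor"
    and \<epsilon> :: "'h \<Rightarrow> complex"
    and antipode :: "'h \<Rightarrow> 'h"
  assumes comult_linear: "clinear \<Delta>"
    and counit_linear: "clinear \<epsilon>"
    and antipode_linear: "clinear antipode"
    and coassoc: "tensor_assoc (tensor_map \<Delta> id (\<Delta> h)) = tensor_map id \<Delta> (\<Delta> h)"
    and counit_left: "tensor_lift (\<lambda>a b. \<epsilon> a *\<^sub>C b) (\<Delta> h) = h"
    and counit_right: "tensor_lift (\<lambda>a b. \<epsilon> b *\<^sub>C a) (\<Delta> h) = h"
    and comult_one: "\<Delta> 1 = 1 \<otimes> 1"
    and comult_mult: "\<Delta> (g * h) = tensor_mult (\<Delta> g) (\<Delta> h)"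
    and counit_one: "\<epsilon> 1 = 1"
    and counit_mult: "\<epsilon> (g * h) = \<epsilon> g * \<epsilon> h"
    and antipode_left: "tensor_lift (\<lambda>a b. antipode a * b) (\<Delta> h) = \<epsilon> h *\<^sub>C 1"
    and antipode_right: "tensor_lift (\<lambda>a b. a * antipode b) (\<Delta> h) = \<epsilon> h *\<^sub>C 1"

text \<open>Left module over a complex algebra, carried by a subspace of a type.\<close>
locale alg_module =
  fixes U :: "'a::complex_vector set"
    and act :: "'h::complex_algebra_1 \<Rightarrow> 'a \<Rightarrow> 'a"
  assumes subspace: "cvec.subspace U"
    and closed: "x \<in> U \<Longrightarrow> act h x \<in> U"
    and linear_right: "linear_on U (act h)"
    and linear_left: "x \<in> U \<Longrightarrow> clinear (\<lambda>h. act h x)"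
    and act_one: "x \<in> U \<Longrightarrow> act 1 x = x"
    and act_mult: "x \<in> U \<Longrightarrow> act (g * h) x = act g (act h x)"

definition irreducible_alg_module ::
    "'a::complex_vector set \<Rightarrow> ('h::complex_algebra_1 \<Rightarrow> 'a \<Rightarrow> 'a) \<Rightarrow> bool"
  where "irreducible_alg_module U act \<longleftrightarrow>
    alg_module U act \<and> U \<noteq> {0} \<and>
    (\<forall>S. cvec.subspace S \<longrightarrow> S \<subseteq> U \<longrightarrow> (\<forall>h. \<forall>x\<in>S. act h x \<in> S) \<longrightarrow> S = {0} \<or> S = U)"

definition sum_of_fd_irreducibles ::
    "'a::complex_vector set \<Rightarrow> ('h::complex_algebra_1 \<Rightarrow> 'a \<Rightarrow> 'a) \<Rightarrow> bool"
  where "sum_of_fd_irreducibles U act \<longleftrightarrow>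
    (\<exists>\<U>. internal_direct_sum U \<U> \<and>
      (\<forall>S\<in>\<U>. finite_dim S \<and> irreducible_alg_module S act))"

definition alg_module_iso :: "'a::complex_vector set \<Rightarrow> ('h::complex_algebra_1 \<Rightarrow> 'a \<Rightarrow> 'a)
    \<Rightarrow> 'b::complex_vector set \<Rightarrow> ('h \<Rightarrow> 'b \<Rightarrow> 'b) \<Rightarrow> ('a \<Rightarrow> 'b) \<Rightarrow> bool"
  where "alg_module_iso U act U' act' \<phi> \<longleftrightarrow>
    alg_module U act \<and> alg_module U' act' \<and> linear_on U \<phi> \<and> bij_betw \<phi> U U' \<and>
    (\<forall>h. \<forall>x\<in>U. \<phi> (act h x) = act' h (\<phi> x))"

definition "character" ::
    "'a::complex_vector set \<Rightarrow> ('h::complex_algebra_1 \<Rightarrow> 'a \<Rightarrow> 'a) \<Rightarrow> 'h \<Rightarrow> complex"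
  where "character U act = (\<lambda>h. trace_on U (act h))"

text \<open>Every finite-dimensional space is isomorphic to a subspace of the space of finitely supported
  sequences, so letting \<open>U\<close> range over such subspaces captures all finite-dimensional
  representations.\<close>
definition irreducible_characters :: "('h::complex_algebra_1 \<Rightarrow> complex) set"
  where "irreducible_characters =
    {character U act | (U :: (nat \<Rightarrow>\<^sub>0 complex) set) act.
       finite_dim U \<and> irreducible_alg_module U act}"

lemma irreducible_family_exists:
  "\<exists>(W :: ('h::complex_algebra_1 \<Rightarrow> complex) \<Rightarrow> (nat \<Rightarrow>\<^sub>0 complex) set) \<rho>.
    \<forall>\<mu>\<in>irreducible_characters.
      finite_dim (W \<mu>) \<and> irreducible_alg_module (W \<mu>) (\<rho> \<mu>) \<and> character (W \<mu>) (\<rho> \<mu>) = \<mu>"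
proof -
  have "\<forall>\<mu>\<in>irreducible_characters. \<exists>W \<rho>. finite_dim (W :: (nat \<Rightarrow>\<^sub>0 complex) set) \<and>
      irreducible_alg_module W \<rho> \<and> character W \<rho> = (\<mu> :: 'h \<Rightarrow> complex)"
    by (auto simp: irreducible_characters_def)
  then show ?thesis by (simp only: bchoice_iff)
qed

text \<open>\<open>Hom\<^sub>H(U, N)\<close>: homomorphisms on the carrier \<open>U\<close> are represented by functions that vanish
  outside \<open>U\<close>.\<close>
definition hom_space :: "'a::complex_vector set \<Rightarrow> ('h::complex_algebra_1 \<Rightarrow> 'a \<Rightarrow> 'a)
    \<Rightarrow> 'b::complex_vector set \<Rightarrow> ('h \<Rightarrow> 'b \<Rightarrow> 'b) \<Rightarrow> ('a \<Rightarrow> 'b) set"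
  where "hom_space U act N act' =
    {f. linear_on U f \<and> f ` U \<subseteq> N \<and> (\<forall>h. \<forall>x\<in>U. f (act h x) = act' h (f x)) \<and>
        (\<forall>x. x \<notin> U \<longrightarrow> f x = 0)}"


section \<open>Vertex algebras and their modules\<close>

text \<open>The coefficient of \<open>x\<^sup>a y\<^sup>b z\<^sup>c\<close> in the formal series
  \<open>x\<^sup>-\<^sup>1 \<delta>((y - z) / x) = (\<Sum>k\<in>\<int>. x\<^sup>-\<^sup>k\<^sup>-\<^sup>1 (y - z)\<^sup>k)\<close>, expanded in nonnegative powers of \<open>z\<close>.\<close>
definition delta_coeff :: "int \<Rightarrow> int \<Rightarrow> int \<Rightarrow> complex"
  where "delta_coeff a b c =
    (if c \<ge> 0 \<and> a + b + c = -1
     then (-1) ^ nat c * (of_int (- a - 1) gchoose nat c) else 0)"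

text \<open>Throughout, \<open>Y u n v\<close> is the mode \<open>u\<^sub>n v\<close>, that is, the coefficient of \<open>z\<^sup>-\<^sup>n\<^sup>-\<^sup>1\<close> in
  \<open>Y(u, z) v\<close>. The Jacobi identity, applied to a vector \<open>w\<close>, is read off at each monomial
  \<open>z\<^sub>0\<^sup>a z\<^sub>1\<^sup>b z\<^sub>2\<^sup>c\<close>. On the left, \<open>p\<close> and \<open>q\<close> are the exponents of \<open>z\<^sub>1\<close> and \<open>z\<^sub>2\<close> in the
  vertex operators; on the right, those of \<open>z\<^sub>0\<close> and \<open>z\<^sub>2\<close>. The second delta series is
  \<open>z\<^sub>0\<^sup>-\<^sup>1 \<delta>((z\<^sub>2 - z\<^sub>1) / (- z\<^sub>0))\<close>, whence the extra sign \<open>(-1)\<^sup>k\<close> with \<open>k = - a - 1\<close>. By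
  truncation, all three sums have finite support.\<close>
definition jacobi_identity :: "('v \<Rightarrow> int \<Rightarrow> 'v \<Rightarrow> 'v) \<Rightarrow>
    ('v \<Rightarrow> int \<Rightarrow> 'm::complex_vector \<Rightarrow> 'm) \<Rightarrow> 'v \<Rightarrow> 'v \<Rightarrow> 'm \<Rightarrow> bool"
  where "jacobi_identity Y YM u v w \<longleftrightarrow> (\<forall>a b c.
    Sum_any (\<lambda>(p, q). delta_coeff a (b - p) (c - q) *\<^sub>C
      YM u (- p - 1) (YM v (- q - 1) w))
    - Sum_any (\<lambda>(p, q). ((-1) powi (- a - 1) * delta_coeff a (c - q) (b - p)) *\<^sub>C
      YM v (- q - 1) (YM u (- p - 1) w))
    = Sum_any (\<lambda>(p, q). delta_coeff (c - q) b (a - p) *\<^sub>C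
      YM (Y u (- p - 1) v) (- q - 1) w))"

text \<open>Vertex algebras are carried by a subspace \<open>A\<close> of a type, so that vertex subalgebras of a
  vertex algebra are given by the same operations on a smaller carrier.\<close>
locale vertex_algebra =
  fixes A :: "'v::complex_vector set"
    and vac :: 'v
    and Y :: "'v \<Rightarrow> int \<Rightarrow> 'v \<Rightarrow> 'v"
  assumes alg_subspace: "cvec.subspace A"
    and vac_in: "vac \<in> A"
    and Y_closed: "u \<in> A \<Longrightarrow> v \<in> A \<Longrightarrow> Y u n v \<in> A"
    and Y_linear_left: "v \<in> A \<Longrightarrow> linear_on A (\<lambda>u. Y u n v)"
    and Y_linear_right: "u \<in> A \<Longrightarrow> linear_on A (Y u n)"
    and Y_truncation: "u \<in> A \<Longrightarrow> v \<in> A \<Longrightarrow> \<exists>N. \<forall>n\<ge>N. Y u n v = 0"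
    and Y_vacuum: "v \<in> A \<Longrightarrow> Y vac n v = (if n = -1 then v else 0)"
    and Y_creation: "u \<in> A \<Longrightarrow> Y u (-1) vac = u"
      "u \<in> A \<Longrightarrow> n \<ge> 0 \<Longrightarrow> Y u n vac = 0"
    and Y_jacobi: "u \<in> A \<Longrightarrow> v \<in> A \<Longrightarrow> w \<in> A \<Longrightarrow> jacobi_identity Y Y u v w"

locale va_module = vertex_algebra A vac Y
  for A :: "'v::complex_vector set" and vac :: 'v and Y :: "'v \<Rightarrow> int \<Rightarrow> 'v \<Rightarrow> 'v" +
  fixes N :: "'m::complex_vector set"
    and YM :: "'v \<Rightarrow> int \<Rightarrow> 'm \<Rightarrow> 'm"
  assumes mod_subspace: "cvec.subspace N"
    and YM_closed: "u \<in> A \<Longrightarrow> w \<in> N \<Longrightarrow> YM u n w \<in> N"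
    and YM_linear_left: "w \<in> N \<Longrightarrow> linear_on A (\<lambda>u. YM u n w)"
    and YM_linear_right: "u \<in> A \<Longrightarrow> linear_on N (YM u n)"
    and YM_truncation: "u \<in> A \<Longrightarrow> w \<in> N \<Longrightarrow> \<exists>K. \<forall>n\<ge>K. YM u n w = 0"
    and YM_vacuum: "w \<in> N \<Longrightarrow> YM vac n w = (if n = -1 then w else 0)"
    and YM_jacobi: "u \<in> A \<Longrightarrow> v \<in> A \<Longrightarrow> w \<in> N \<Longrightarrow> jacobi_identity Y YM u v w"

definition irreducible_va_module ::
    "'v::complex_vector set \<Rightarrow> 'v \<Rightarrow> ('v \<Rightarrow> int \<Rightarrow> 'v \<Rightarrow> 'v) \<Rightarrow>
     'm::complex_vector set \<Rightarrow> ('v \<Rightarrow> int \<Rightarrow> 'm \<Rightarrow> 'm) \<Rightarrow> bool"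
  where "irreducible_va_module A vac Y N YM \<longleftrightarrow>
    va_module A vac Y N YM \<and> N \<noteq> {0} \<and>
    (\<forall>S. cvec.subspace S \<longrightarrow> S \<subseteq> N \<longrightarrow> (\<forall>u\<in>A. \<forall>n. \<forall>w\<in>S. YM u n w \<in> S) \<longrightarrow> S = {0} \<or> S = N)"

definition irreducible_vertex_algebra ::
    "'v::complex_vector set \<Rightarrow> 'v \<Rightarrow> ('v \<Rightarrow> int \<Rightarrow> 'v \<Rightarrow> 'v) \<Rightarrow> bool"
  where "irreducible_vertex_algebra A vac Y \<longleftrightarrow>
    vertex_algebra A vac Y \<and> irreducible_va_module A vac Y A Y"

definition va_module_iso :: "'v::complex_vector set \<Rightarrow> 'v \<Rightarrow> ('v \<Rightarrow> int \<Rightarrow> 'v \<Rightarrow> 'v) \<Rightarrow>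
    'm::complex_vector set \<Rightarrow> ('v \<Rightarrow> int \<Rightarrow> 'm \<Rightarrow> 'm) \<Rightarrow>
    'n::complex_vector set \<Rightarrow> ('v \<Rightarrow> int \<Rightarrow> 'n \<Rightarrow> 'n) \<Rightarrow> ('m \<Rightarrow> 'n) \<Rightarrow> bool"
  where "va_module_iso A vac Y N YN P YP \<phi> \<longleftrightarrow>
    va_module A vac Y N YN \<and> va_module A vac Y P YP \<and> linear_on N \<phi> \<and> bij_betw \<phi> N P \<and>
    (\<forall>u\<in>A. \<forall>n. \<forall>w\<in>N. \<phi> (YN u n w) = YP u n (\<phi> w))"


section \<open>Hopf actions on vertex algebras\<close>

locale module_vertex_algebra =
  hopf_algebra \<Delta> \<epsilon> antipode + vertex_algebra UNIV vac Y + H: alg_module UNIV act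
  for \<Delta> :: "'h::complex_algebra_1 \<Rightarrow> ('h, 'h) tensor"
    and \<epsilon> :: "'h \<Rightarrow> complex"
    and antipode :: "'h \<Rightarrow> 'h"
    and vac :: "'v::complex_vector"
    and Y :: "'v \<Rightarrow> int \<Rightarrow> 'v \<Rightarrow> 'v"
    and act :: "'h \<Rightarrow> 'v \<Rightarrow> 'v" +
  assumes act_vac: "act h vac = \<epsilon> h *\<^sub>C vac"
    and act_Y: "act h (Y u n v) = tensor_lift (\<lambda>h1 h2. Y (act h1 u) n (act h2 v)) (\<Delta> h)"

locale hopf_va_module =
  module_vertex_algebra \<Delta> \<epsilon> antipode vac Y act + va_module UNIV vac Y UNIV YM +
  HM: alg_module UNIV actM
  for \<Delta> :: "'h::complex_algebra_1 \<Rightarrow> ('h, 'h) tensor"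
    and \<epsilon> :: "'h \<Rightarrow> complex"
    and antipode :: "'h \<Rightarrow> 'h"
    and vac :: "'v::complex_vector"
    and Y :: "'v \<Rightarrow> int \<Rightarrow> 'v \<Rightarrow> 'v"
    and act :: "'h \<Rightarrow> 'v \<Rightarrow> 'v"
    and YM :: "'v \<Rightarrow> int \<Rightarrow> 'm::complex_vector \<Rightarrow> 'm"
    and actM :: "'h \<Rightarrow> 'm \<Rightarrow> 'm" +
  assumes act_YM: "actM h (YM u n w) = tensor_lift (\<lambda>h1 h2. YM (act h1 u) n (actM h2 w)) (\<Delta> h)"

definition invariants ::
    "('h::complex_algebra_1 \<Rightarrow> complex) \<Rightarrow> ('h \<Rightarrow> 'v::complex_vector \<Rightarrow> 'v) \<Rightarrow> 'v set"
  where "invariants \<epsilon> act = {v. \<forall>h. act h v = \<epsilon> h *\<^sub>C v}"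

text \<open>The action \<open>(v\<^sub>n f)(w) = v\<^sub>n (f(w))\<close> on homomorphisms.\<close>
definition hom_modes :: "('v \<Rightarrow> int \<Rightarrow> 'm \<Rightarrow> 'm) \<Rightarrow> 'v \<Rightarrow> int \<Rightarrow> ('w \<Rightarrow> 'm) \<Rightarrow> 'w \<Rightarrow> 'm"
  where "hom_modes YM v n f = (\<lambda>w. YM v n (f w))"

text \<open>For subspaces \<open>U\<close> and \<open>F\<close>, the space \<open>U \<otimes> F\<close> is identified with the span of the elements
  \<open>w \<otimes> f\<close> in the tensor product of the ambient types.\<close>
definition tensor_space :: "'a::complex_vector set \<Rightarrow> 'b::complex_vector set \<Rightarrow> ('a, 'b) tensor set"
  where "tensor_space U F = cvec.span {w \<otimes> f | w f. w \<in> U \<and> f \<in> F}"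

definition external_direct_sum :: "'i set \<Rightarrow> ('i \<Rightarrow> 'a::complex_vector set) \<Rightarrow> ('i \<Rightarrow>\<^sub>0 'a) set"
  where "external_direct_sum I S = {t. \<forall>i\<in>Poly_Mapping.keys t. i \<in> I \<and> Poly_Mapping.lookup t i \<in> S i}"

text \<open>\<open>N\<close> is the direct sum of the \<open>W \<mu> \<otimes> F \<mu>\<close> over \<open>\<mu> \<in> \<Lambda>\<close> as a module for the algebra acting by
  \<open>actN\<close> and for the vertex algebra \<open>A\<close> acting by \<open>YN\<close>, where \<open>F \<mu>\<close> consists of maps
  \<open>W \<mu> \<rightarrow> N\<close> and \<open>w \<otimes> f\<close> is identified with \<open>f w\<close>. The conditions on the elements \<open>w \<otimes> f\<close>
  determine the actions \<open>actD\<close>, \<open>YD\<close> and the isomorphism \<open>\<Phi>\<close> on the direct sum uniquely.\<close>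
definition decomposes_by_evaluation ::
    "'v::complex_vector set \<Rightarrow> 'v \<Rightarrow> ('v \<Rightarrow> int \<Rightarrow> 'v \<Rightarrow> 'v) \<Rightarrow>
     'm::complex_vector set \<Rightarrow> ('v \<Rightarrow> int \<Rightarrow> 'm \<Rightarrow> 'm) \<Rightarrow> ('h::complex_algebra_1 \<Rightarrow> 'm \<Rightarrow> 'm) \<Rightarrow>
     'i set \<Rightarrow> ('i \<Rightarrow> 'w::complex_vector set) \<Rightarrow> ('i \<Rightarrow> 'h \<Rightarrow> 'w \<Rightarrow> 'w) \<Rightarrow>
     ('i \<Rightarrow> ('w \<Rightarrow> 'm) set) \<Rightarrow> bool"
  where "decomposes_by_evaluation A vac Y N YN actN \<Lambda> W \<rho> F \<longleftrightarrow>
    (let D = external_direct_sum \<Lambda> (\<lambda>\<mu>. tensor_space (W \<mu>) (F \<mu>)) in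
     \<exists>\<Phi> actD YD.
       alg_module_iso D actD N actN \<Phi> \<and>
       va_module_iso A vac Y D YD N YN \<Phi> \<and>
       (\<forall>\<mu>\<in>\<Lambda>. \<forall>w\<in>W \<mu>. \<forall>f\<in>F \<mu>.
          \<Phi> (Poly_Mapping.single \<mu> (w \<otimes> f)) = f w \<and>
          (\<forall>h. actD h (Poly_Mapping.single \<mu> (w \<otimes> f)) =
             Poly_Mapping.single \<mu> (\<rho> \<mu> h w \<otimes> f)) \<and>
          (\<forall>v\<in>A. \<forall>n. YD v n (Poly_Mapping.single \<mu> (w \<otimes> f)) =
             Poly_Mapping.single \<mu> (w \<otimes> hom_modes YN v n f))))"

end

(* The modes of V act densely on the irreducible module M: by Dixmier's lemma, which needs the
   countable dimension of V, only scalars commute with all modes, and by weak associativity a product of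
   modes agrees on any finite set of vectors with a linear combination of single modes. So every
   linear map U -> M on a finite-dimensional subspace U is a combination of modes of V. The identity
   (h u)_n = sum h_1 u_n S(h_2) turns H-invariance of such a combination on an H-submodule U into
   H-invariance of its symbol modulo the combinations vanishing on U, and semisimplicity of V over H
   lets one replace the symbol by an H-invariant one. Hence V^H surjects onto Hom_H(U, M) for every
   finite-dimensional H-submodule U. Taking U = f(W) gives the irreducibility of Hom_H(W, M), and
   taking U = f(W) + g(W') shows that V^H separates f from g when W and W' are not isomorphic. *)

theory Submission
  imports Defs "HOL-Analysis.Continuum_Not_Denumerable"
    "HOL-Computational_Algebra.Fundamental_Theorem_Algebra"
begin

section \<open>Linear maps on subspaces\<close>

text \<open>Two obstacles shape the proof. The combination of modes that expresses u_p v_q depends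
  on the vector it is applied to, so combinations of single modes need not form an algebra, yet only
  they have symbols in V on which H acts. Density is therefore proved for operators that agree with
  such a combination on each finite set. To treat finitely many vectors at once, they are encoded as
  one function with values in a finite-dimensional space, and the Jacobi identity is lifted to such
  functions; the same lift makes Hom_H(W, M) a module for V^H. Secondly, H itself need not be
  semisimple, so no averaging operator projects onto invariants. Instead a symbol is written as a
  finite sum of vectors in simple submodules of V and shortened one summand at a time, using that a
  nonzero vector generates its simple summand. Finally, \<Lambda> consists of characters, so simple
  modules have to be told apart by traces: an element acting as 0 on one module and as the identity
  on the other has trace 0 and the dimension, which differ in characteristic zero.\<close>

lemma clinearI:
  assumes "\<And>x y. f (x + y) = f x + f y" "\<And>c x. f (c *\<^sub>C x) = c *\<^sub>C f x"
  shows "clinear f"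
  by (intro linear_module_homI module_hom.intro module_hom_axioms.intro)
    (use assms in \<open>auto simp: cvec.module_axioms\<close>)

lemma clinear_add: "clinear f \<Longrightarrow> f (x + y) = f x + f y"
  by (simp add: linear_iff_module_hom module_hom.add)

lemma clinear_scale: "clinear f \<Longrightarrow> f (c *\<^sub>C x) = c *\<^sub>C f x"
  by (simp add: linear_iff_module_hom module_hom.scale)

lemma clinear_diff: "clinear f \<Longrightarrow> f (x - y) = f x - f y"
  by (simp add: linear_iff_module_hom module_hom.diff)

lemma clinear_zero: "clinear f \<Longrightarrow> f 0 = 0"
  by (simp add: linear_iff_module_hom module_hom.zero)

lemma clinear_sum: "clinear f \<Longrightarrow> f (sum g A) = (\<Sum>x\<in>A. f (g x))"
  by (simp add: linear_iff_module_hom module_hom.sum)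

lemma linear_on_UNIV_iff: "linear_on UNIV f \<longleftrightarrow> clinear f"
  using clinearI[of f] by (auto simp: linear_on_def clinear_add clinear_scale)

lemma linear_on_add: "linear_on U f \<Longrightarrow> x \<in> U \<Longrightarrow> y \<in> U \<Longrightarrow> f (x + y) = f x + f y"
  by (simp add: linear_on_def)

lemma linear_on_scale: "linear_on U f \<Longrightarrow> x \<in> U \<Longrightarrow> f (c *\<^sub>C x) = c *\<^sub>C f x"
  by (simp add: linear_on_def)

lemma linear_on_zero: "linear_on U f \<Longrightarrow> cvec.subspace U \<Longrightarrow> f 0 = 0"
  using linear_on_scale[of U f 0 0] cvec.subspace_0[of U] by simp

lemma linear_on_diff:
  assumes "linear_on U f" "cvec.subspace U" "x \<in> U" "y \<in> U"
  shows "f (x - y) = f x - f y"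
proof -
  have "f (x + (-1) *\<^sub>C y) = f x + (-1) *\<^sub>C f y"
    using assms by (metis linear_on_add linear_on_scale cvec.subspace_scale)
  then show ?thesis by simp
qed

lemma linear_on_sum:
  assumes "linear_on U f" "cvec.subspace U" "\<And>i. i \<in> I \<Longrightarrow> g i \<in> U"
  shows "f (sum g I) = (\<Sum>i\<in>I. f (g i))"
  using assms(3)
proof (induction I rule: infinite_finite_induct)
  case (insert i I)
  then have "sum g I \<in> U"
    using cvec.subspace_sum[OF assms(2)] by blast
  with insert show ?case by (simp add: linear_on_add[OF assms(1)])
qed (use linear_on_zero[OF assms(1,2)] in auto)

lemma linear_on_subset: "linear_on U f \<Longrightarrow> V \<subseteq> U \<Longrightarrow> linear_on V f"
  unfolding linear_on_def by blast

lemma clinear_linear_on: "clinear f \<Longrightarrow> linear_on U f"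
  by (simp add: linear_on_def clinear_add clinear_scale)

lemma linear_on_eq_span:
  assumes "linear_on U f" "linear_on U g" "cvec.subspace U" "B \<subseteq> U"
    and "\<And>b. b \<in> B \<Longrightarrow> f b = g b" "x \<in> cvec.span B"
  shows "f x = g x"
proof -
  have "x \<in> U \<and> f x = g x"
    using assms(6)
  proof (induction rule: cvec.span_induct_alt)
    case base
    then show ?case
      using linear_on_zero[OF assms(1,3)] linear_on_zero[OF assms(2,3)] cvec.subspace_0[OF assms(3)]
      by simp
  next
    case (step c b y)
    then have "c *\<^sub>C b \<in> U" "b \<in> U" using assms(3,4) cvec.subspace_scale by blast+
    with step assms(5)[of b] show ?case
      by (simp add: cvec.subspace_add[OF assms(3)] linear_on_add[OF assms(1)] linear_on_add[OF assms(2)]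
          linear_on_scale[OF assms(1)] linear_on_scale[OF assms(2)])
  qed
  then show ?thesis by simp
qed

lemma linear_on_subspace_image:
  assumes f: "linear_on U f" and U: "cvec.subspace U"
  shows "cvec.subspace (f ` U)"
proof (rule cvec.subspaceI)
  show "0 \<in> f ` U" using linear_on_zero[OF f U] cvec.subspace_0[OF U] by force
  show "x + y \<in> f ` U" if "x \<in> f ` U" "y \<in> f ` U" for x y
    using that linear_on_add[OF f, symmetric] cvec.subspace_add[OF U] by auto
  show "c *\<^sub>C x \<in> f ` U" if "x \<in> f ` U" for c x
    using that linear_on_scale[OF f, symmetric] cvec.subspace_scale[OF U] by auto
qed

section \<open>Dixmier's lemma and the density theorem\<close>

text \<open>An enumeration of \<open>C\<close> exhausts it by finite sets \<open>D n\<close>. Each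
  vector of \<open>B\<close> lies in the span of one of them, and an independent set in the span of
  finitely many vectors is finite, so \<open>B\<close> is a countable union of finite sets.\<close>

lemma countable_independent:
  fixes C :: "'a::complex_vector set"
  assumes "countable C" "B \<subseteq> cvec.span C" "cvec.independent B"
  shows "countable B"
proof (cases "C = {}")
  case True
  then show ?thesis using assms(2) by (simp add: countable_subset[of B "{0}"])
next
  case False
  define D where "D n = from_nat_into C ` {..<n}" for n :: nat
  have C: "range (from_nat_into C) = C"
    using False assms(1) by (simp add: range_from_nat_into)
  have "B \<subseteq> (\<Union>n. B \<inter> cvec.span (D n))"
  proof
    fix b assume b: "b \<in> B"
    then obtain t r where t: "finite t" "t \<subseteq> C" "b = (\<Sum>a\<in>t. r a *\<^sub>C a)"
      using assms(2) by (auto simp: cvec.span_explicit)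
    then have "t \<subseteq> range (from_nat_into C)" by (simp add: C)
    then obtain T where "finite T" "t = from_nat_into C ` T"
      using finite_subset_image[OF t(1)] by blast
    moreover from this obtain n where "T \<subseteq> {..<n}"
      by (auto simp: finite_nat_iff_bounded)
    ultimately have "t \<subseteq> D n" by (auto simp: D_def)
    then have "b \<in> cvec.span (D n)"
      unfolding t(3) by (intro cvec.span_sum cvec.span_scale cvec.span_base) auto
    with b show "b \<in> (\<Union>n. B \<inter> cvec.span (D n))" by blast
  qed
  moreover have "countable (\<Union>n. B \<inter> cvec.span (D n))"
  proof (rule countable_UN)
    fix n
    have "cvec.independent (B \<inter> cvec.span (D n))"
      using assms(3) cvec.independent_mono by blast
    then have "finite (B \<inter> cvec.span (D n))"
      using cvec.independent_span_bound[of "D n" "B \<inter> cvec.span (D n)"] by (auto simp: D_def)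
    then show "countable (B \<inter> cvec.span (D n))" by (rule countable_finite)
  qed simp
  ultimately show ?thesis by (rule countable_subset)
qed

text \<open>For an operator \<open>T\<close> and a vector \<open>u\<close>, this is \<open>p(T) u\<close>.\<close>
definition poly_op :: "('a::complex_vector \<Rightarrow> 'a) \<Rightarrow> 'a \<Rightarrow> complex poly \<Rightarrow> 'a"
  where "poly_op T u p = fold_coeffs (\<lambda>a y. a *\<^sub>C u + T y) p 0"

section \<open>Polynomials in one operator and the independence of its resolvents\<close>

lemma poly_op_0 [simp]: "poly_op T u 0 = 0"
  by (simp add: poly_op_def)

text \<open>\<open>T 0 = 0\<close> covers the degenerate case \<open>pCons 0 0 = 0\<close>, in which
  the fold performs no step while the right-hand side is \<open>T 0\<close>.\<close>

lemma poly_op_pCons: "T 0 = 0 \<Longrightarrow> poly_op T u (pCons a p) = a *\<^sub>C u + T (poly_op T u p)"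
  by (cases "a = 0"; cases "p = 0") (auto simp: poly_op_def)

text \<open>The carrier is a subspace rather than a type, since the same argument serves for all of
  M and for finite-dimensional H-modules inside a larger type.\<close>

locale operator_on =
  fixes N :: "'a::complex_vector set" and T :: "'a \<Rightarrow> 'a"
  assumes N: "cvec.subspace N" and lin: "linear_on N T" and closed: "x \<in> N \<Longrightarrow> T x \<in> N"
begin

lemma T0: "T 0 = 0"
  using linear_on_zero[OF lin N] .

lemmas poly_op_rec = poly_op_pCons[of T, OF T0]

lemma poly_op_in: "u \<in> N \<Longrightarrow> poly_op T u p \<in> N"
  by (induction p)
    (auto simp: poly_op_rec cvec.subspace_0[OF N] closed
      intro!: cvec.subspace_add[OF N] cvec.subspace_scale[OF N])

lemma poly_op_add: "u \<in> N \<Longrightarrow> poly_op T u (p + q) = poly_op T u p + poly_op T u q"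
  by (induction p q rule: poly_induct2)
    (simp_all add: poly_op_rec linear_on_add[OF lin] poly_op_in cvec.scale_left_distrib)

lemma poly_op_smult: "u \<in> N \<Longrightarrow> poly_op T u (smult c p) = c *\<^sub>C poly_op T u p"
  by (induction p)
    (simp_all add: poly_op_rec linear_on_scale[OF lin] poly_op_in cvec.scale_right_distrib)

lemma poly_op_sum:
  "u \<in> N \<Longrightarrow> poly_op T u (\<Sum>i\<in>I. p i) = (\<Sum>i\<in>I. poly_op T u (p i))"
  by (induction I rule: infinite_finite_induct) (auto simp: poly_op_add)

lemma poly_op_linear_factor:
  "u \<in> N \<Longrightarrow> poly_op T u ([:- c, 1:] * p) = T (poly_op T u p) - c *\<^sub>C poly_op T u p"
  using poly_op_add[of u "smult (- c) p" "pCons 0 p"] poly_op_smult[of u "- c" p]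
  by (simp add: poly_op_rec)

text \<open>A polynomial in T commutes with T - c, so a factor T - c in front can be traded for a
  change of the vector.\<close>

lemma poly_op_shift:
  assumes "u \<in> N"
  shows "poly_op T (T u - c *\<^sub>C u) p = T (poly_op T u p) - c *\<^sub>C poly_op T u p"
proof (induction p)
  case (pCons a p)
  have "T (poly_op T u p) \<in> N" "T u \<in> N" "poly_op T u p \<in> N" "c *\<^sub>C poly_op T u p \<in> N" "a *\<^sub>C u \<in> N"
    using assms by (auto simp: closed poly_op_in cvec.subspace_scale[OF N])
  with pCons assms show ?case
    by (simp add: poly_op_rec linear_on_add[OF lin] linear_on_diff[OF lin N]
        linear_on_scale[OF lin] cvec.scale_right_distrib cvec.scale_right_diff_distrib mult.commute)
qed (simp add: T0)

text \<open>Over the complex numbers p(T) is a nonzero scalar times a product of operators T - z,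
  each injective on \<open>N\<close> since T has no eigenvector there.\<close>

lemma poly_op_nonzero:
  assumes inj: "\<And>c x. x \<in> N \<Longrightarrow> T x = c *\<^sub>C x \<Longrightarrow> x = 0"
    and "u \<in> N" "u \<noteq> 0" "p \<noteq> 0"
  shows "poly_op T u p \<noteq> 0"
  using assms(4)
proof (induction "degree p" arbitrary: p)
  case 0
  then obtain a where "p = [:a:]" "a \<noteq> 0" by (metis degree_eq_zeroE pCons_0_0)
  then show ?case using assms(3) by (simp add: poly_op_rec T0)
next
  case (Suc n)
  then have "\<not> constant (poly p)" by (simp add: constant_degree)
  then obtain z where "poly p z = 0" using fundamental_theorem_of_algebra by blast
  then obtain q where q: "p = [:- z, 1:] * q" by (auto simp: poly_eq_0_iff_dvd elim!: dvdE)
  then have "q \<noteq> 0" using Suc.prems by auto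
  then have "degree q = n"
    using Suc.hyps(2) unfolding q by (simp add: degree_mult_eq del: mult_pCons_left)
  then have "poly_op T u q \<noteq> 0" using Suc.hyps(1) \<open>q \<noteq> 0\<close> by blast
  then show ?case
    unfolding q poly_op_linear_factor[OF assms(2)] using inj[OF poly_op_in[OF assms(2)]] by auto
qed

text \<open>If every \<open>T - c\<close> is bijective, the vectors \<open>(T - c)\<inverse> w\<close> are linearly independent, because a
  nontrivial relation among them would give a nonzero polynomial \<open>P\<close> and \<open>u \<noteq> 0\<close> with \<open>P(T) u = 0\<close>.\<close>
lemma resolvents_independent:
  assumes inj: "\<And>c x. x \<in> N \<Longrightarrow> T x = c *\<^sub>C x \<Longrightarrow> x = 0"
    and surj: "\<And>c y. y \<in> N \<Longrightarrow> \<exists>x\<in>N. T x - c *\<^sub>C x = y"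
    and w: "w \<in> N" "w \<noteq> 0"
    and r: "\<And>c. r c \<in> N" "\<And>c. T (r c) - c *\<^sub>C r c = w"
  shows "inj r" "cvec.independent (range r)"
proof -
  have rnz: "r c \<noteq> 0" for c using r(2)[of c] w(2) by (auto simp: T0)
  show "inj r"
  proof (rule injI)
    fix c d assume *: "r c = r d"
    have "T (r c) - c *\<^sub>C r c = T (r c) - d *\<^sub>C r c"
      using r(2)[of c] r(2)[of d] unfolding * by simp
    then have "(c - d) *\<^sub>C r c = 0" by (simp add: cvec.scale_left_diff_distrib)
    then show "c = d" using rnz by simp
  qed
  define Q where "Q F = (\<Prod>c\<in>F. [:- c, 1:])" for F :: "complex set"
  \<comment> \<open>By surjectivity \<open>w\<close> can be divided by all factors T - c with c in
    \<open>F\<close>. The vectors \<open>r c\<close> then become polynomials in T applied to one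
    vector \<open>u\<close>.\<close>
  have ex: "\<exists>u\<in>N. poly_op T u (Q F) = w" if "finite F" for F
    using that
  proof induction
    case empty
    then show ?case using w by (auto simp: Q_def poly_op_rec T0 one_pCons)
  next
    case (insert c F)
    then obtain u where u: "u \<in> N" "poly_op T u (Q F) = w" by blast
    obtain x where x: "x \<in> N" "T x - c *\<^sub>C x = u" using surj[OF u(1)] by blast
    have "poly_op T x (Q (insert c F)) = w"
      using poly_op_shift[OF x(1), of c "Q F"] insert u(2) x(2)
      unfolding Q_def by (simp del: mult_pCons_left add: poly_op_linear_factor[OF x(1)])
    then show ?case using x(1) by blast
  qed
  have key: "a c = 0" if F: "finite F" "(\<Sum>c\<in>F. a c *\<^sub>C r c) = 0" "c \<in> F" for F a c
  proof (rule ccontr)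
    assume ac: "a c \<noteq> 0"
    obtain u where u: "u \<in> N" "poly_op T u (Q F) = w" using ex[OF F(1)] by blast
    have unz: "u \<noteq> 0"
    proof
      assume "u = 0"
      moreover have "poly_op T 0 p = 0" for p by (induction p) (auto simp: poly_op_rec T0)
      ultimately show False using u w by simp
    qed
    \<comment> \<open>Both vectors solve (T - d)x = \<open>w\<close>, and T - d is
      injective.\<close>
    have rd: "r d = poly_op T u (Q (F - {d}))" if "d \<in> F" for d
    proof -
      let ?y = "poly_op T u (Q (F - {d}))"
      have "Q F = [:- d, 1:] * Q (F - {d})"
        unfolding Q_def using F(1) that by (simp add: prod.remove del: mult_pCons_left)
      then have Ty: "T ?y - d *\<^sub>C ?y = w" using u poly_op_linear_factor[OF u(1)] by metis
      have "?y \<in> N" using poly_op_in u(1) by blast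
      then have "T (r d - ?y) = (T (r d) - d *\<^sub>C r d) - (T ?y - d *\<^sub>C ?y) + d *\<^sub>C (r d - ?y)"
        using linear_on_diff[OF lin N r(1)[of d]] by (simp add: cvec.scale_right_diff_distrib)
      then have "T (r d - ?y) = d *\<^sub>C (r d - ?y)"
        using r(2)[of d] Ty by simp
      then have "r d - ?y = 0" using inj cvec.subspace_diff[OF N r(1) \<open>?y \<in> N\<close>] by blast
      then show ?thesis by simp
    qed
    \<comment> \<open>The numerator of the linear relation over the common denominator
      \<open>Q F\<close>.\<close>
    define P where "P = (\<Sum>d\<in>F. smult (a d) (Q (F - {d})))"
    have "poly_op T u P = (\<Sum>d\<in>F. a d *\<^sub>C r d)"
      using rd unfolding P_def by (simp add: poly_op_sum[OF u(1)] poly_op_smult[OF u(1)])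
    then have "poly_op T u P = 0" using F(2) by simp
    moreover have "P \<noteq> 0"
    proof -
      \<comment> \<open>Every summand but the one for \<open>c\<close> has the factor X - c, so P(c)
        is \<open>a c\<close> times a product of nonzero differences.\<close>
      have "poly (Q (F - {d})) c = 0" if "d \<in> F - {c}" for d
        using that F(1,3) by (auto simp: Q_def poly_prod)
      then have "poly P c = a c * poly (Q (F - {c})) c"
        unfolding P_def using F(1,3) by (simp add: poly_sum sum.remove[of F c])
      moreover have "poly (Q (F - {c})) c \<noteq> 0" using F(1) by (auto simp: Q_def poly_prod)
      ultimately show ?thesis using ac by auto
    qed
    ultimately show False using poly_op_nonzero[OF _ u(1) unz, of P] inj by blast
  qed
  show "cvec.independent (range r)"
  proof
    assume "cvec.dependent (range r)"
    then obtain S b v where S: "finite S" "S \<subseteq> range r" "(\<Sum>x\<in>S. b x *\<^sub>C x) = 0" "v \<in> S" "b v \<noteq> 0"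
      unfolding cvec.dependent_explicit by blast
    then obtain F where F: "S = r ` F" "finite F"
      using finite_subset_image by metis
    obtain c where c: "c \<in> F" "v = r c" using F S by blast
    have "(\<Sum>c\<in>F. b (r c) *\<^sub>C r c) = 0"
      using S(3) F(1) \<open>inj r\<close> by (simp add: sum.reindex inj_on_def inj_def)
    then show False using key[OF F(2), of "\<lambda>c. b (r c)" c] c S(5) by simp
  qed
qed

end

text \<open>Sums, multiples and products are matched only on \<open>N\<close>, because the functions
  are unconstrained outside the carrier. Transitivity is irreducibility in the form that every
  nonzero vector reaches all of \<open>N\<close> by a single operator.\<close>

locale transitive_operators =
  fixes N :: "'a::complex_vector set" and A :: "('a \<Rightarrow> 'a) set"
  assumes subspace: "cvec.subspace N"
    and op_linear: "a \<in> A \<Longrightarrow> linear_on N a"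
    and op_closed: "a \<in> A \<Longrightarrow> x \<in> N \<Longrightarrow> a x \<in> N"
    and op_add: "a \<in> A \<Longrightarrow> b \<in> A \<Longrightarrow> \<exists>c\<in>A. \<forall>x\<in>N. c x = a x + b x"
    and op_scale: "a \<in> A \<Longrightarrow> \<exists>c\<in>A. \<forall>x\<in>N. c x = r *\<^sub>C a x"
    and op_comp: "a \<in> A \<Longrightarrow> b \<in> A \<Longrightarrow> \<exists>c\<in>A. \<forall>x\<in>N. c x = a (b x)"
    and op_transitive: "s \<in> N \<Longrightarrow> s \<noteq> 0 \<Longrightarrow> m \<in> N \<Longrightarrow> \<exists>a\<in>A. a s = m"
    and op_ex: "A \<noteq> {}"
    and countable_gen: "\<exists>C. countable C \<and> N \<subseteq> cvec.span C"
begin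

text \<open>Dixmier's lemma. If T is not scalar, every T - c is bijective: an eigenvector would
  spread its eigenvalue to all of \<open>N\<close> by transitivity, and from a nonzero value of T -
  c every vector is reached by an operator commuting with T. The preimages of \<open>w\<close> under
  the T - c would then be uncountably many independent vectors in a space of countable
  dimension.\<close>

lemma commuting_scalar:
  assumes lin: "linear_on N T" and closed: "\<And>x. x \<in> N \<Longrightarrow> T x \<in> N"
    and comm: "\<And>a x. a \<in> A \<Longrightarrow> x \<in> N \<Longrightarrow> T (a x) = a (T x)"
  shows "\<exists>c. \<forall>x\<in>N. T x = c *\<^sub>C x"
proof (rule ccontr)
  assume neg: "\<not> ?thesis"
  interpret operator_on N T by standard (use subspace lin closed in auto)
  have inj: "x = 0" if "x \<in> N" "T x = c *\<^sub>C x" for c x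
  proof (rule ccontr)
    assume "x \<noteq> 0"
    have "T m = c *\<^sub>C m" if m: "m \<in> N" for m
    proof -
      obtain a where "a \<in> A" "a x = m" using op_transitive[OF \<open>x \<in> N\<close> \<open>x \<noteq> 0\<close> m] by blast
      then show ?thesis
        using comm[of a x] \<open>T x = c *\<^sub>C x\<close> linear_on_scale[OF op_linear, of a x c] \<open>x \<in> N\<close> by simp
    qed
    with neg show False by blast
  qed
  have "\<exists>w\<in>N. w \<noteq> 0"
  proof (rule ccontr)
    assume "\<not> ?thesis"
    then have "\<forall>x\<in>N. T x = 0 *\<^sub>C x" using T0 by auto
    with neg show False by blast
  qed
  then obtain w where w: "w \<in> N" "w \<noteq> 0" by blast
  have surj: "\<exists>x\<in>N. T x - c *\<^sub>C x = y" if y: "y \<in> N" for c y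
  proof -
    let ?z = "T w - c *\<^sub>C w"
    have z: "?z \<in> N" "T w \<in> N" "c *\<^sub>C w \<in> N"
      using w closed by (auto intro: cvec.subspace_diff[OF N] cvec.subspace_scale[OF N])
    have "?z \<noteq> 0" using inj[OF w(1), of c] w(2) by auto
    then obtain a where a: "a \<in> A" "a ?z = y" using op_transitive z(1) y by blast
    then have "T (a w) - c *\<^sub>C a w = y"
      using linear_on_diff[OF op_linear[OF a(1)] N z(2,3)] comm[OF a(1) w(1)]
        linear_on_scale[OF op_linear[OF a(1)] w(1)] by simp
    then show ?thesis using op_closed[OF a(1) w(1)] by blast
  qed
  have "\<forall>c. \<exists>x. x \<in> N \<and> T x - c *\<^sub>C x = w" using surj w(1) by blast
  then obtain r where r: "\<And>c. r c \<in> N" "\<And>c. T (r c) - c *\<^sub>C r c = w" by metis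
  have R: "inj r" "cvec.independent (range r)"
    by (rule resolvents_independent[of w r]; use inj surj w r in blast)+
  obtain C where C: "countable C" "N \<subseteq> cvec.span C" using countable_gen by blast
  have "countable (range r)"
    by (rule countable_independent[OF C(1) _ R(2)]) (use r(1) C(2) in auto)
  then have "countable (UNIV :: complex set)"
    using R(1) countable_image_inj_on by blast
  then show False using uncountable_UNIV_complex by simp
qed

lemma op_sum:
  assumes "finite I" "\<And>i. i \<in> I \<Longrightarrow> f i \<in> A"
  shows "\<exists>c\<in>A. \<forall>x\<in>N. c x = (\<Sum>i\<in>I. f i x)"
  using assms
proof (induction I)
  case empty
  then show ?case using op_ex op_scale[of _ 0] by force
next
  case (insert i I)
  then obtain c where c: "c \<in> A" "\<And>x. x \<in> N \<Longrightarrow> c x = (\<Sum>i\<in>I. f i x)" by force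
  obtain d where d: "d \<in> A" "\<And>x. x \<in> N \<Longrightarrow> d x = f i x + c x"
    using op_add[of "f i" c] insert.prems c(1) by auto
  show ?case using d c(2) insert.hyps by (intro bexI[of _ d]) auto
qed

lemma op_diff:
  assumes "a \<in> A" "b \<in> A"
  shows "\<exists>c\<in>A. \<forall>x\<in>N. c x = a x - b x"
proof -
  obtain d where d: "d \<in> A" "\<And>x. x \<in> N \<Longrightarrow> d x = (-1) *\<^sub>C b x" using op_scale assms(2) by blast
  obtain c where "c \<in> A" "\<And>x. x \<in> N \<Longrightarrow> c x = a x + d x" using op_add[OF assms(1) d(1)] by blast
  with d show ?thesis by (intro bexI[of _ c]) auto
qed

text \<open>Jacobson density by induction on \<open>B\<close>. The point is to find an operator that
  kills \<open>B\<close> but not the new vector \<open>w\<close>; transitivity then corrects the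
  value at \<open>w\<close> without disturbing those on \<open>B\<close>.\<close>

theorem density:
  assumes "finite B" "B \<subseteq> N" "cvec.independent B" "\<And>b. b \<in> B \<Longrightarrow> g b \<in> N"
  shows "\<exists>a\<in>A. \<forall>b\<in>B. a b = g b"
  using assms
proof (induction B arbitrary: g)
  case empty
  then show ?case using op_ex by blast
next
  case (insert w B)
  have ind: "cvec.independent B" using insert.prems cvec.independent_mono by blast
  have wN: "w \<in> N" and BN: "B \<subseteq> N" using insert.prems by auto
  have IH: "\<exists>a\<in>A. \<forall>b\<in>B. a b = g b" if "\<And>b. b \<in> B \<Longrightarrow> g b \<in> N" for g
    using insert.IH[OF BN ind] that by blast
  have "\<exists>a\<in>A. (\<forall>b\<in>B. a b = 0) \<and> a w \<noteq> 0"
  proof (rule ccontr)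
    assume neg: "\<not> ?thesis"
    \<comment> \<open>The value at \<open>w\<close> is now a function of the values on
      \<open>B\<close>: the difference of two operators agreeing on \<open>B\<close> kills
      \<open>B\<close>, hence \<open>w\<close>.\<close>
    have det: "a w = a' w" if aa': "a \<in> A" "a' \<in> A" "\<And>b. b \<in> B \<Longrightarrow> a b = a' b" for a a'
    proof -
      obtain c where c: "c \<in> A" "\<And>x. x \<in> N \<Longrightarrow> c x = a x - a' x" using op_diff aa' by blast
      then have "c b = 0" if "b \<in> B" for b using aa'(3) BN that by auto
      then have "c w = 0" using neg c(1) by blast
      then show ?thesis using c(2) wN by simp
    qed
    have "\<forall>b m. \<exists>a. m \<in> N \<longrightarrow> a \<in> A \<and> (\<forall>b'\<in>B. a b' = (if b' = b then m else 0))"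
      using IH[of "\<lambda>b'. if b' = _ then _ else 0"] cvec.subspace_0[OF subspace]
      by (metis (mono_tags, lifting))
    then obtain E where E: "\<And>b m. m \<in> N \<Longrightarrow> E b m \<in> A"
      "\<And>b m b'. m \<in> N \<Longrightarrow> b' \<in> B \<Longrightarrow> E b m b' = (if b' = b then m else 0)"
      by metis
    \<comment> \<open>\<open>E b m\<close> sends \<open>b\<close> to \<open>m\<close> and the rest
      of \<open>B\<close> to 0. By \<open>det\<close> its value at \<open>w\<close> is linear in
      \<open>m\<close> and compatible with all operators, so Dixmier's lemma applies.\<close>
    have "\<exists>c. \<forall>m\<in>N. E b m w = c *\<^sub>C m" if b: "b \<in> B" for b
    proof (rule commuting_scalar)
      show "linear_on N (\<lambda>m. E b m w)"
        unfolding linear_on_def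
      proof (intro conjI ballI allI)
        fix x y assume xy: "x \<in> N" "y \<in> N"
        then have s: "x + y \<in> N" using subspace cvec.subspace_add by blast
        obtain c where "c \<in> A" "\<And>z. z \<in> N \<Longrightarrow> c z = E b x z + E b y z" using op_add E(1) xy by metis
        then show "E b (x + y) w = E b x w + E b y w"
          using det[of "E b (x + y)" c] E s xy BN wN by (auto simp: subset_iff)
      next
        fix r x assume x: "x \<in> N"
        then have s: "r *\<^sub>C x \<in> N" using subspace cvec.subspace_scale by blast
        obtain c where "c \<in> A" "\<And>z. z \<in> N \<Longrightarrow> c z = r *\<^sub>C E b x z" using op_scale E(1) x by metis
        then show "E b (r *\<^sub>C x) w = r *\<^sub>C E b x w"
          using det[of "E b (r *\<^sub>C x)" c] E s x BN wN by (auto simp: subset_iff)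
      qed
      show "E b x w \<in> N" if "x \<in> N" for x using op_closed E(1) that wN by blast
      show "E b (a x) w = a (E b x w)" if ax: "a \<in> A" "x \<in> N" for a x
      proof -
        obtain c where "c \<in> A" "\<And>z. z \<in> N \<Longrightarrow> c z = a (E b x z)"
          using op_comp ax E(1) by metis
        then show ?thesis
          using det[of "E b (a x)" c] E ax BN wN op_closed linear_on_zero[OF op_linear subspace]
          by (auto simp: subset_iff)
      qed
    qed
    then obtain c where c: "\<And>b m. b \<in> B \<Longrightarrow> m \<in> N \<Longrightarrow> E b m w = c b *\<^sub>C m" by metis
    \<comment> \<open>By \<open>det\<close>, each operator's value at \<open>w\<close> is the
      combination of its values on \<open>B\<close> with the coefficients \<open>c b\<close>, so it
      kills \<open>v\<close>. Transitivity excludes this for nonzero \<open>v\<close>, and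
      \<open>w\<close> would lie in the span of \<open>B\<close>.\<close>
    define v where "v = w - (\<Sum>b\<in>B. c b *\<^sub>C b)"
    have sN: "(\<Sum>b\<in>B. c b *\<^sub>C b) \<in> N"
      using BN by (intro cvec.subspace_sum[OF subspace] cvec.subspace_scale[OF subspace]) auto
    then have vN: "v \<in> N"
      unfolding v_def using wN cvec.subspace_diff[OF subspace] by blast
    have "a v = 0" if a: "a \<in> A" for a
    proof -
      have aN: "a b \<in> N" if "b \<in> B" for b using op_closed a BN that by blast
      obtain d where d: "d \<in> A" "\<And>x. x \<in> N \<Longrightarrow> d x = (\<Sum>b\<in>B. E b (a b) x)"
        using op_sum[OF insert.hyps(1), of "\<lambda>b. E b (a b)"] E(1) aN by auto
      have "a w = d w"
      proof (rule det[OF a d(1)])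
        fix b assume "b \<in> B"
        then have "(\<Sum>b'\<in>B. E b' (a b') b) = (\<Sum>b'\<in>B. if b' = b then a b else 0)"
          using E(2) aN by (intro sum.cong) auto
        then show "a b = d b" using d(2) \<open>b \<in> B\<close> BN insert.hyps(1) by auto
      qed
      also have "\<dots> = (\<Sum>b\<in>B. c b *\<^sub>C a b)" using d(2) wN c aN by simp
      also have "\<dots> = a (\<Sum>b\<in>B. c b *\<^sub>C b)"
        using linear_on_sum[OF op_linear[OF a] subspace, of B "\<lambda>b. c b *\<^sub>C b"]
          linear_on_scale[OF op_linear[OF a]] BN cvec.subspace_scale[OF subspace]
        by (simp add: subset_iff)
      finally show ?thesis
        unfolding v_def using linear_on_diff[OF op_linear[OF a] subspace wN sN] by simp
    qed
    then have "v = 0" using op_transitive[OF vN _ vN] by force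
    then have "w = (\<Sum>b\<in>B. c b *\<^sub>C b)" by (simp add: v_def)
    moreover have "(\<Sum>b\<in>B. c b *\<^sub>C b) \<in> cvec.span B"
      by (intro cvec.span_sum cvec.span_scale cvec.span_base)
    ultimately have "w \<in> cvec.span B" by (rule ssubst)
    then show False
      using insert.prems(2) insert.hyps(2) cvec.dependent_def by (metis Diff_insert_absorb insertI1)
  qed
  then obtain a where a: "a \<in> A" "\<And>b. b \<in> B \<Longrightarrow> a b = 0" "a w \<noteq> 0" by blast
  obtain a0 where a0: "a0 \<in> A" "\<And>b. b \<in> B \<Longrightarrow> a0 b = g b" using IH[of g] insert.prems by auto
  \<comment> \<open>\<open>a\<close> vanishes on \<open>B\<close>, and \<open>a'\<close> will move
    \<open>a w\<close> to the error of \<open>a0\<close> at \<open>w\<close>; adding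
    \<open>a'\<close> after \<open>a\<close> to \<open>a0\<close> repairs the value at
    \<open>w\<close> alone.\<close>
  have "g w - a0 w \<in> N"
    using insert.prems a0 op_closed wN cvec.subspace_diff[OF subspace] by auto
  then obtain a' where a': "a' \<in> A" "a' (a w) = g w - a0 w"
    using op_transitive[OF op_closed[OF a(1) wN] a(3)] by blast
  obtain a1 where a1: "a1 \<in> A" "\<And>x. x \<in> N \<Longrightarrow> a1 x = a' (a x)" using op_comp a'(1) a(1) by blast
  obtain a2 where a2: "a2 \<in> A" "\<And>x. x \<in> N \<Longrightarrow> a2 x = a0 x + a1 x" using op_add a0(1) a1(1) by blast
  have "a2 b = g b" if "b \<in> insert w B" for b
    using that a2 a1 a0 a a' BN wN linear_on_zero[OF op_linear[OF a'(1)] subspace] by auto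
  then show ?case using a2(1) by blast
qed

end

global_interpretation cpair: vector_space_pair
  "scaleC :: complex \<Rightarrow> 'a \<Rightarrow> 'a::complex_vector" "scaleC :: complex \<Rightarrow> 'b \<Rightarrow> 'b::complex_vector"
  by unfold_locales

section \<open>Bases and traces\<close>

lemma linear_on_extend:
  assumes "linear_on U f" "cvec.subspace U" "cvec.independent B" "cvec.span B = U"
  obtains g where "clinear g" "\<And>x. x \<in> U \<Longrightarrow> g x = f x"
proof -
  obtain g where g: "clinear g" "\<forall>x\<in>B. g x = f x"
    using cpair.linear_independent_extend[OF assms(3)] by blast
  have "g x = f x" if "x \<in> U" for x
    by (rule linear_on_eq_span[OF clinear_linear_on[OF g(1)] assms(1,2), of B])
      (use g(2) assms(4) that cvec.span_base in auto)
  with g(1) that show thesis by blast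
qed

lemma basis_image:
  assumes lin: "linear_on U f" and U: "cvec.subspace U" and inj: "inj_on f U"
    and B: "cvec.independent B" "cvec.span B = U"
  shows "cvec.independent (f ` B)" "cvec.span (f ` B) = f ` U"
    "x \<in> U \<Longrightarrow> b \<in> B \<Longrightarrow> cvec.representation (f ` B) (f x) (f b) = cvec.representation B x b"
proof -
  obtain g where g: "clinear g" "\<And>x. x \<in> U \<Longrightarrow> g x = f x" using linear_on_extend[OF lin U B] by blast
  have BU: "b \<in> U" if "b \<in> B" for b using that B(2) cvec.span_base by blast
  have fB: "f ` B = g ` B" "f ` U = g ` U" and gU: "inj_on g U"
    using g(2) BU inj by (auto simp: inj_on_def)
  show ind: "cvec.independent (f ` B)"
    unfolding fB using cpair.linear_independent_injective_image[OF g(1) B(1)] gU B(2) by simp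
  show sp: "cvec.span (f ` B) = f ` U"
    unfolding fB using cpair.linear_span_image[OF g(1)] B(2) by metis
  show "cvec.representation (f ` B) (f x) (f b) = cvec.representation B x b" if x: "x \<in> U" and b: "b \<in> B"
  proof -
    let ?r = "cvec.representation B x" and ?K = "{b. cvec.representation B x b \<noteq> 0}"
    have K: "finite ?K" "?K \<subseteq> B" using cvec.finite_representation cvec.representation_ne_zero by auto
    have gB: "inj_on g B" using gU BU by (meson inj_on_subset subsetI)
    have rep: "cvec.representation (g ` B) (g x) = (\<lambda>y. if y \<in> g ` B then ?r (inv_into B g y) else 0)"
      (is "_ = ?h")
    proof (rule cvec.representation_eqI)
      show "cvec.independent (g ` B)" using ind fB by simp
      show "g x \<in> cvec.span (g ` B)" using sp fB x by auto
      have hb: "?h (g b) = ?r b" if "b \<in> B" for b using that gB by simp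
      have *: "{y. ?h y \<noteq> 0} = g ` ?K"
      proof (intro set_eqI iffI)
        fix y assume y: "y \<in> {y. ?h y \<noteq> 0}"
        then obtain b where "b \<in> B" "y = g b" by (auto split: if_splits)
        with y hb show "y \<in> g ` ?K" by auto
      next
        fix y assume "y \<in> g ` ?K"
        then obtain b where "?r b \<noteq> 0" "y = g b" "b \<in> B" using K(2) by blast
        with hb show "y \<in> {y. ?h y \<noteq> 0}" by auto
      qed
      then show "finite {y. ?h y \<noteq> 0}" using K(1) by simp
      have "(\<Sum>y | ?h y \<noteq> 0. ?h y *\<^sub>C y) = (\<Sum>b\<in>?K. ?h (g b) *\<^sub>C g b)"
        unfolding * by (rule sum.reindex_cong[of g]) (use gB K(2) inj_on_subset in auto)
      also have "\<dots> = (\<Sum>b\<in>?K. ?r b *\<^sub>C g b)"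
        by (rule sum.cong) (use K(2) gB in \<open>auto simp: inv_into_f_f subset_iff\<close>)
      also have "\<dots> = g (\<Sum>b\<in>?K. ?r b *\<^sub>C b)" by (simp add: clinear_sum[OF g(1)] clinear_scale[OF g(1)])
      also have "(\<Sum>b\<in>?K. ?r b *\<^sub>C b) = x"
        using cvec.sum_nonzero_representation_eq[OF B(1)] x B(2) by blast
      finally show "(\<Sum>y | ?h y \<noteq> 0. ?h y *\<^sub>C y) = g x" .
    qed (auto split: if_splits)
    have "f x = g x" "f b = g b" using g(2) x b BU by auto
    then show ?thesis unfolding fB(1) using rep b gB by simp
  qed
qed

lemma sum_representation:
  "cvec.independent B \<Longrightarrow> x \<in> cvec.span B \<Longrightarrow> finite B \<Longrightarrow> (\<Sum>b\<in>B. cvec.representation B x b *\<^sub>C b) = x"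
  using cvec.sum_representation_eq by blast

lemma representation_sum_scale:
  assumes "cvec.independent B" "\<And>i. i \<in> I \<Longrightarrow> g i \<in> cvec.span B"
  shows "cvec.representation B (\<Sum>i\<in>I. r i *\<^sub>C g i) b = (\<Sum>i\<in>I. r i * cvec.representation B (g i) b)"
  using assms by (simp add: cvec.representation_sum cvec.representation_scale cvec.span_scale)

text \<open>The identity tr(PQ) = tr(QP), with P the coordinates of the \<open>b\<close> in
  \<open>C\<close> and Q those of the \<open>T c\<close> in \<open>B\<close>: both sides are the
  same double sum.\<close>

lemma trace_basis_independent:
  assumes B: "cvec.independent B" "cvec.span B = U" "finite B"
    and C: "cvec.independent C" "cvec.span C = U" "finite C"
    and T: "linear_on U T" "\<And>x. x \<in> U \<Longrightarrow> T x \<in> U"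
  shows "(\<Sum>b\<in>B. cvec.representation B (T b) b) = (\<Sum>c\<in>C. cvec.representation C (T c) c)"
proof -
  have U: "cvec.subspace U" using B(2) by auto
  have BU: "b \<in> U" if "b \<in> B" for b using that B(2) cvec.span_base by blast
  have CU: "c \<in> U" if "c \<in> C" for c using that C(2) cvec.span_base by blast
  have "cvec.representation B (T b) b =
      (\<Sum>c\<in>C. cvec.representation C b c * cvec.representation B (T c) b)" if b: "b \<in> B" for b
  proof -
    have "T b = T (\<Sum>c\<in>C. cvec.representation C b c *\<^sub>C c)"
      using sum_representation[OF C(1) _ C(3)] C(2) BU[OF b] by simp
    also have "\<dots> = (\<Sum>c\<in>C. cvec.representation C b c *\<^sub>C T c)"
      using CU cvec.subspace_scale[OF U] by (simp add: linear_on_sum[OF T(1) U] linear_on_scale[OF T(1)])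
    finally show ?thesis
      using representation_sum_scale[OF B(1), of C T "cvec.representation C b" b] T(2) CU B(2) by simp
  qed
  then have "(\<Sum>b\<in>B. cvec.representation B (T b) b) =
      (\<Sum>b\<in>B. \<Sum>c\<in>C. cvec.representation C b c * cvec.representation B (T c) b)" by simp
  also have "\<dots> = (\<Sum>c\<in>C. \<Sum>b\<in>B. cvec.representation B (T c) b * cvec.representation C b c)"
    by (subst sum.swap) (simp add: mult.commute)
  also have "\<dots> = (\<Sum>c\<in>C. cvec.representation C (T c) c)"
  proof (rule sum.cong[OF refl])
    fix c assume "c \<in> C"
    then have "T c \<in> cvec.span B" using T(2) CU B(2) by simp
    then have "(\<Sum>b\<in>B. cvec.representation B (T c) b *\<^sub>C b) = T c" using sum_representation B by blast
    then show "(\<Sum>b\<in>B. cvec.representation B (T c) b * cvec.representation C b c)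
        = cvec.representation C (T c) c"
      using representation_sum_scale[OF C(1), of B "\<lambda>b. b" "cvec.representation B (T c)" c] BU C(2) by simp
  qed
  finally show ?thesis .
qed

lemma trace_on_eq:
  assumes B: "cvec.independent B" "cvec.span B = U" "finite B"
    and T: "linear_on U T" "\<And>x. x \<in> U \<Longrightarrow> T x \<in> U"
  shows "trace_on U T = (\<Sum>b\<in>B. cvec.representation B (T b) b)"
proof -
  define C where "C = (SOME C. cvec.independent C \<and> cvec.span C = U)"
  have C: "cvec.independent C \<and> cvec.span C = U"
    unfolding C_def by (rule someI[of _ B]) (use B in auto)
  have "finite C"
    using cvec.independent_span_bound[OF B(3), of C] C B(2) cvec.span_superset[of C] by auto
  with C show ?thesis
    using trace_basis_independent[OF B _ _ _ T, of C] by (simp add: trace_on_def C_def[symmetric] Let_def)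
qed

lemma trace_on_transport:
  assumes U: "finite_dim U" and lin: "linear_on U f" and bij: "bij_betw f U V"
    and T: "linear_on U T" "\<And>x. x \<in> U \<Longrightarrow> T x \<in> U"
    and T': "linear_on V T'" "\<And>x. x \<in> V \<Longrightarrow> T' x \<in> V" "\<And>x. x \<in> U \<Longrightarrow> f (T x) = T' (f x)"
  shows "trace_on V T' = trace_on U T"
proof -
  obtain B where B: "cvec.independent B" "cvec.span B = U" "finite B" using U by (auto simp: finite_dim_def)
  have sub: "cvec.subspace U" using B(2) by auto
  have BU: "b \<in> U" if "b \<in> B" for b using that B(2) cvec.span_base by blast
  have inj: "inj_on f U" and V: "V = f ` U" using bij by (auto simp: bij_betw_def)
  note I = basis_image[OF lin sub inj B(1,2)]
  have "trace_on V T' = (\<Sum>y\<in>f ` B. cvec.representation (f ` B) (T' y) y)"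
    by (rule trace_on_eq) (use I(1,2) B(3) T' V in auto)
  also have "\<dots> = (\<Sum>b\<in>B. cvec.representation (f ` B) (T' (f b)) (f b))"
    by (rule sum.reindex_cong[of f]) (use inj BU inj_on_subset in blast)+
  also have "\<dots> = (\<Sum>b\<in>B. cvec.representation B (T b) b)"
    by (rule sum.cong[OF refl]) (use I(3) T'(3) BU T(2) in metis)
  also have "\<dots> = trace_on U T" using trace_on_eq[OF B T] by simp
  finally show ?thesis .
qed

lemma finite_dim_image:
  assumes "finite_dim U" "linear_on U f" "inj_on f U"
  shows "finite_dim (f ` U)"
proof -
  obtain B where B: "cvec.independent B" "cvec.span B = U" "finite B" using assms(1) by (auto simp: finite_dim_def)
  have sub: "cvec.subspace U" using B(2) by auto
  show ?thesis
    unfolding finite_dim_def using basis_image(1,2)[OF assms(2) sub assms(3) B(1,2)] B(3) by blast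
qed

section \<open>Modules over an algebra\<close>

context alg_module
begin

lemma act_0 [simp]: "act h 0 = 0"
  by (rule linear_on_zero[OF linear_right subspace])

lemma act_add_left: "x \<in> U \<Longrightarrow> act (g + h) x = act g x + act h x"
  by (rule clinear_add[OF linear_left])

lemma act_diff_left: "x \<in> U \<Longrightarrow> act (g - h) x = act g x - act h x"
  by (rule clinear_diff[OF linear_left])

lemma act_scale_left: "x \<in> U \<Longrightarrow> act (c *\<^sub>C h) x = c *\<^sub>C act h x"
  by (rule clinear_scale[OF linear_left])

lemma act_sum_left: "x \<in> U \<Longrightarrow> act (sum f I) x = (\<Sum>i\<in>I. act (f i) x)"
  by (rule clinear_sum[OF linear_left])

lemma act_add: "x \<in> U \<Longrightarrow> y \<in> U \<Longrightarrow> act h (x + y) = act h x + act h y"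
  by (rule linear_on_add[OF linear_right])

lemma act_scale: "x \<in> U \<Longrightarrow> act h (c *\<^sub>C x) = c *\<^sub>C act h x"
  by (rule linear_on_scale[OF linear_right])

lemma act_sum: "(\<And>i. i \<in> I \<Longrightarrow> f i \<in> U) \<Longrightarrow> act h (sum f I) = (\<Sum>i\<in>I. act h (f i))"
  by (rule linear_on_sum[OF linear_right subspace])

end

section \<open>Simple modules: orbits, Burnside's theorem, Schur's lemma and separation\<close>

lemma irreducible_subD:
  assumes "irreducible_alg_module U act" "cvec.subspace S" "S \<subseteq> U"
    "\<And>h x. x \<in> S \<Longrightarrow> act h x \<in> S" "x \<in> S" "x \<noteq> 0"
  shows "S = U"
  using assms unfolding irreducible_alg_module_def by blast

lemma irreducible_alg_module_module: "irreducible_alg_module U act \<Longrightarrow> alg_module U act"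
  by (simp add: irreducible_alg_module_def)

lemma irreducible_nonzero:
  assumes "irreducible_alg_module U act"
  shows "\<exists>x\<in>U. x \<noteq> 0"
  using assms cvec.subspace_0[OF alg_module.subspace, of U act]
  unfolding irreducible_alg_module_def by blast

text \<open>Density is needed not only for the whole algebra but also for the annihilator of another
  simple module.\<close>

definition two_sided_ideal :: "'h::complex_algebra_1 set \<Rightarrow> bool"
  where "two_sided_ideal I \<longleftrightarrow> cvec.subspace I \<and> (\<forall>g. \<forall>h\<in>I. g * h \<in> I \<and> h * g \<in> I)"

lemma two_sided_idealD:
  assumes "two_sided_ideal I"
  shows "0 \<in> I" "g \<in> I \<Longrightarrow> h \<in> I \<Longrightarrow> g + h \<in> I" "h \<in> I \<Longrightarrow> c *\<^sub>C h \<in> I"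
    "h \<in> I \<Longrightarrow> g * h \<in> I" "h \<in> I \<Longrightarrow> h * g \<in> I"
  using assms by (auto simp: two_sided_ideal_def cvec.subspace_def)

lemma two_sided_ideal_UNIV: "two_sided_ideal UNIV"
  by (simp add: two_sided_ideal_def)

text \<open>The vector \<open>x\<close> generates \<open>U\<close>, so \<open>y\<close> = hx for
  some h, and gh does not kill \<open>x\<close>. Right multiplication keeps gh in \<open>I\<close>,
  and left multiplication makes the orbit of \<open>x\<close> under \<open>I\<close> a
  submodule.\<close>

lemma irreducible_orbit:
  assumes irr: "irreducible_alg_module U act"
    and I: "two_sided_ideal I"
    and ex: "g \<in> I" "y \<in> U" "act g y \<noteq> 0"
    and x: "x \<in> U" "x \<noteq> 0"
  shows "(\<lambda>h. act h x) ` I = U"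
proof -
  interpret alg_module U act using irr by (rule irreducible_alg_module_module)
  have orbit: "S = {0} \<or> S = U" if "J \<subseteq> UNIV" "0 \<in> J" "\<And>g h. g \<in> J \<Longrightarrow> h \<in> J \<Longrightarrow> g + h \<in> J"
    "\<And>c h. h \<in> J \<Longrightarrow> c *\<^sub>C h \<in> J" "\<And>g h. h \<in> J \<Longrightarrow> g * h \<in> J" "S = (\<lambda>h. act h x) ` J" for J S
  proof -
    have "cvec.subspace S"
    proof (rule cvec.subspaceI)
      show "0 \<in> S" using that(2) act_scale_left[OF x(1), of 0 0] unfolding that(6) by (force simp: image_iff)
      show "a + b \<in> S" if "a \<in> S" "b \<in> S" for a b
        using that \<open>\<And>g h. g \<in> J \<Longrightarrow> h \<in> J \<Longrightarrow> g + h \<in> J\<close> act_add_left[OF x(1), symmetric]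
        unfolding \<open>S = _\<close> by auto
      show "c *\<^sub>C a \<in> S" if "a \<in> S" for c a
        using that \<open>\<And>c h. h \<in> J \<Longrightarrow> c *\<^sub>C h \<in> J\<close> act_scale_left[OF x(1), symmetric]
        unfolding \<open>S = _\<close> by auto
    qed
    moreover have "S \<subseteq> U" using closed x(1) that(6) by auto
    moreover have "act h z \<in> S" if "z \<in> S" for h z
      using that \<open>\<And>g h. h \<in> J \<Longrightarrow> g * h \<in> J\<close> act_mult[OF x(1), symmetric] unfolding \<open>S = _\<close> by auto
    ultimately show ?thesis using irr unfolding irreducible_alg_module_def by blast
  qed
  have "(\<lambda>h. act h x) ` UNIV = U"
    using orbit[of UNIV "(\<lambda>h. act h x) ` UNIV"] x(2) act_one[OF x(1)] by (metis UNIV_I empty_iff insertE rangeI subset_UNIV)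
  then obtain h where h: "y = act h x" using ex(2) by blast
  have "act (g * h) x \<noteq> 0" "g * h \<in> I" using ex h x(1) two_sided_idealD(5)[OF I] by (auto simp: act_mult)
  then show ?thesis using orbit[of I "(\<lambda>h. act h x) ` I"] two_sided_idealD[OF I] by blast
qed

lemma ideal_transitive:
  assumes irr: "irreducible_alg_module U act" and fd: "finite_dim U"
    and I: "two_sided_ideal I"
    and ex: "g \<in> I" "y \<in> U" "act g y \<noteq> 0"
  shows "transitive_operators U (act ` I)"
proof -
  interpret alg_module U act using irr by (rule irreducible_alg_module_module)
  note orb = irreducible_orbit[OF irr I ex]
  show ?thesis
  proof
    show "cvec.subspace U" by (rule subspace)
    show "act ` I \<noteq> {}" using two_sided_idealD(1)[OF I] by blast
    show "\<exists>C. countable C \<and> U \<subseteq> cvec.span C"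
      using fd countable_finite unfolding finite_dim_def by blast
    show "\<exists>a\<in>act ` I. a s = m" if "s \<in> U" "s \<noteq> 0" "m \<in> U" for s m
      using orb[OF that(1,2)] that(3) by auto
    show "\<exists>c\<in>act ` I. \<forall>x\<in>U. c x = a x + b x" if ab: "a \<in> act ` I" "b \<in> act ` I" for a b
    proof -
      obtain g h where "g \<in> I" "h \<in> I" "a = act g" "b = act h" using ab by blast
      then show ?thesis using two_sided_idealD(2)[OF I] by (intro bexI[of _ "act (g + h)"]) (auto simp: act_add_left)
    qed
    show "\<exists>c\<in>act ` I. \<forall>x\<in>U. c x = r *\<^sub>C a x" if ab: "a \<in> act ` I" for a r
    proof -
      obtain g where "g \<in> I" "a = act g" using ab by blast
      then show ?thesis using two_sided_idealD(3)[OF I] by (intro bexI[of _ "act (r *\<^sub>C g)"]) (auto simp: act_scale_left)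
    qed
    show "\<exists>c\<in>act ` I. \<forall>x\<in>U. c x = a (b x)" if ab: "a \<in> act ` I" "b \<in> act ` I" for a b
    proof -
      obtain g h where "g \<in> I" "h \<in> I" "a = act g" "b = act h" using ab by blast
      then show ?thesis using two_sided_idealD(4)[OF I] by (intro bexI[of _ "act (g * h)"]) (auto simp: act_mult)
    qed
  qed (use linear_right closed in auto)
qed

text \<open>Burnside's theorem for an ideal that does not annihilate \<open>U\<close>: density on a
  finite basis realises every endomorphism.\<close>

lemma ideal_density:
  assumes irr: "irreducible_alg_module U act" and fd: "finite_dim U"
    and I: "two_sided_ideal I"
    and ex: "g \<in> I" "y \<in> U" "act g y \<noteq> 0"
    and T: "linear_on U T" "\<And>x. x \<in> U \<Longrightarrow> T x \<in> U"
  shows "\<exists>h\<in>I. \<forall>x\<in>U. act h x = T x"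
proof -
  interpret alg_module U act using irr by (rule irreducible_alg_module_module)
  interpret transitive_operators U "act ` I" by (rule ideal_transitive[OF irr fd I ex])
  obtain B where B: "cvec.independent B" "cvec.span B = U" "finite B" using fd by (auto simp: finite_dim_def)
  have BU: "B \<subseteq> U" using B(2) cvec.span_superset by blast
  obtain h where h: "h \<in> I" "\<And>b. b \<in> B \<Longrightarrow> act h b = T b"
    using density[OF B(3) BU B(1), of T] T(2) BU by blast
  have "act h x = T x" if "x \<in> U" for x
    by (rule linear_on_eq_span[OF linear_right T(1) alg_module.subspace[OF alg_module_axioms] BU h(2)])
      (use B(2) that in auto)
  with h(1) show ?thesis by blast
qed

lemma irreducible_density:
  assumes irr: "irreducible_alg_module U act" and fd: "finite_dim U"
    and T: "linear_on U T" "\<And>x. x \<in> U \<Longrightarrow> T x \<in> U"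
  shows "\<exists>h. \<forall>x\<in>U. act h x = T x"
proof -
  obtain y where y: "y \<in> U" "y \<noteq> 0" using irreducible_nonzero[OF irr] by blast
  then have "act 1 y \<noteq> 0"
    using alg_module.act_one[OF irreducible_alg_module_module[OF irr]] by simp
  then show ?thesis using ideal_density[OF irr fd two_sided_ideal_UNIV UNIV_I y(1) _ T] by blast
qed

lemma irreducible_hom_inj:
  assumes irr: "irreducible_alg_module U act" and V: "alg_module V act'"
    and f: "linear_on U f" "f ` U \<subseteq> V" "\<And>h x. x \<in> U \<Longrightarrow> f (act h x) = act' h (f x)"
    and nz: "z \<in> U" "f z \<noteq> 0"
  shows "inj_on f U"
proof -
  interpret alg_module U act using irr by (rule irreducible_alg_module_module)
  interpret V: alg_module V act' by (rule V)
  let ?K = "{x\<in>U. f x = 0}"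
  have sub: "cvec.subspace ?K"
    by (rule cvec.subspaceI)
      (auto simp: cvec.subspace_0[OF subspace] linear_on_zero[OF f(1) subspace]
        cvec.subspace_add[OF subspace] cvec.subspace_scale[OF subspace] linear_on_add[OF f(1)]
        linear_on_scale[OF f(1)])
  have ker: "x = 0" if x: "x \<in> U" "f x = 0" for x
  proof (rule ccontr)
    assume "x \<noteq> 0"
    have "?K = U"
    proof (rule irreducible_subD[OF irr sub])
      show "act h y \<in> ?K" if "y \<in> ?K" for h y using that f(3) closed by simp
    qed (use x \<open>x \<noteq> 0\<close> in auto)
    then show False using nz by blast
  qed
  show ?thesis
  proof (rule inj_onI)
    fix x y assume xy: "x \<in> U" "y \<in> U" "f x = f y"
    then have "f (x - y) = 0" by (simp add: linear_on_diff[OF f(1) subspace])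
    then have "x - y = 0" using ker cvec.subspace_diff[OF subspace xy(1,2)] by blast
    then show "x = y" by simp
  qed
qed

lemma irreducible_hom_bij:
  assumes irr: "irreducible_alg_module U act" and V: "irreducible_alg_module V act'"
    and f: "linear_on U f" "f ` U \<subseteq> V" "\<And>h x. x \<in> U \<Longrightarrow> f (act h x) = act' h (f x)"
    and nz: "z \<in> U" "f z \<noteq> 0"
  shows "alg_module_iso U act V act' f"
proof -
  interpret alg_module U act using irr by (rule irreducible_alg_module_module)
  interpret V: alg_module V act' using V by (rule irreducible_alg_module_module)
  have inj: "inj_on f U" by (rule irreducible_hom_inj[OF irr V.alg_module_axioms f nz])
  have "cvec.subspace (f ` U)" by (rule linear_on_subspace_image[OF f(1) subspace])
  then have "f ` U = V"
    by (rule irreducible_subD[OF V _ f(2) _ _ nz(2)]) (use nz(1) f(3)[symmetric] closed in auto)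
  with inj show ?thesis
    unfolding alg_module_iso_def bij_betw_def
    using f alg_module_axioms V.alg_module_axioms by auto
qed

text \<open>If the annihilator of \<open>U\<close> kills \<open>V\<close>, pick \<open>e\<^sub>b\<close> acting on \<open>U\<close> as the projection to the line
  of a basis vector \<open>b\<close>. Their sum acts as the identity on \<open>V\<close>, so that \<open>e\<^sub>b v \<noteq> 0\<close> for some \<open>b\<close>
  and \<open>v\<close>, and \<open>h b \<mapsto> h e\<^sub>b v\<close> is an isomorphism.\<close>
lemma iso_if_annihilator_subset:
  assumes U: "irreducible_alg_module U act" "finite_dim U" and V: "irreducible_alg_module V act'"
    and ann: "\<And>h v. (\<And>x. x \<in> U \<Longrightarrow> act h x = 0) \<Longrightarrow> v \<in> V \<Longrightarrow> act' h v = 0"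
  shows "\<exists>\<theta>. alg_module_iso U act V act' \<theta>"
proof -
  interpret U: alg_module U act using U(1) by (rule irreducible_alg_module_module)
  interpret V: alg_module V act' using V by (rule irreducible_alg_module_module)
  obtain B where B: "cvec.independent B" "cvec.span B = U" "finite B" using U(2) by (auto simp: finite_dim_def)
  have BU: "b \<in> U" if "b \<in> B" for b using that B(2) cvec.span_base by blast
  let ?r = "cvec.representation B"
  have "\<exists>h. \<forall>x\<in>U. act h x = ?r x b *\<^sub>C b" if "b \<in> B" for b
  proof (rule irreducible_density[OF U])
    show "linear_on U (\<lambda>x. ?r x b *\<^sub>C b)"
      using B by (simp add: linear_on_def cvec.representation_add cvec.representation_scale
          cvec.scale_left_distrib)
    show "?r x b *\<^sub>C b \<in> U" for x using BU[OF that] cvec.subspace_scale[OF U.subspace] by blast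
  qed
  then obtain e where e: "\<And>b x. b \<in> B \<Longrightarrow> x \<in> U \<Longrightarrow> act (e b) x = ?r x b *\<^sub>C b" by metis
  obtain v where v: "v \<in> V" "v \<noteq> 0" using irreducible_nonzero[OF V] by blast
  have "act (1 - (\<Sum>b\<in>B. e b)) x = 0" if "x \<in> U" for x
    using that e B sum_representation[OF B(1) _ B(3)] by (simp add: U.act_diff_left U.act_sum_left U.act_one)
  then have "act' (1 - (\<Sum>b\<in>B. e b)) v = 0" using ann v(1) by blast
  then have veq: "v = (\<Sum>b\<in>B. act' (e b) v)"
    using v(1) by (simp add: V.act_diff_left V.act_sum_left V.act_one)
  have "\<exists>b\<in>B. act' (e b) v \<noteq> 0"
  proof (rule ccontr)
    assume "\<not> ?thesis"
    then have "(\<Sum>b\<in>B. act' (e b) v) = 0" by (intro sum.neutral) auto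
    then have "v = 0" by (rule trans[OF veq])
    with v(2) show False by contradiction
  qed
  then obtain b where b: "b \<in> B" "act' (e b) v \<noteq> 0" by blast
  have bnz: "b \<noteq> 0" using b(1) B(1) cvec.dependent_zero by blast
  have rb: "?r b b = 1" using b(1) B(1) by (simp add: cvec.representation_basis)
  have "(\<lambda>h. act h b) ` UNIV = U"
    by (rule irreducible_orbit[OF U(1) two_sided_ideal_UNIV, of 1 b]) (use BU[OF b(1)] bnz U.act_one in auto)
  then have "\<forall>x\<in>U. \<exists>h. act h b = x" by blast
  then obtain k where k: "\<And>x. x \<in> U \<Longrightarrow> act (k x) b = x" by metis
  define w where "w = act' (e b) v"
  have w: "w \<in> V" unfolding w_def using v(1) V.closed by blast
  \<comment> \<open>\<open>h * e b\<close> sends x to its \<open>b\<close>-coordinate times h b, so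
    it annihilates \<open>U\<close> and therefore \<open>V\<close>. This makes h b |-> h
    \<open>w\<close> well defined; \<open>k x\<close> merely picks one h with h b = x.\<close>
  have zero: "act' h w = 0" if "act h b = 0" for h
  proof -
    have "act' (h * e b) v = 0"
    proof (rule ann[OF _ v(1)])
      fix x assume "x \<in> U"
      then show "act (h * e b) x = 0"
        using e[OF b(1)] that BU[OF b(1)] by (simp add: U.act_mult U.act_scale)
    qed
    then show ?thesis by (simp add: w_def V.act_mult v(1))
  qed
  have eq: "act' g w = act' h w" if "act g b = act h b" for g h
    using zero[of "g - h"] that BU[OF b(1)] w by (simp add: U.act_diff_left V.act_diff_left)
  have "alg_module_iso U act V act' (\<lambda>x. act' (k x) w)"
  proof (rule irreducible_hom_bij[OF U(1) V])
    show "linear_on U (\<lambda>x. act' (k x) w)"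
      unfolding linear_on_def
    proof (intro conjI ballI allI)
      fix x y assume "x \<in> U" "y \<in> U"
      then have "act' (k (x + y)) w = act' (k x + k y) w"
        using BU[OF b(1)] by (intro eq) (simp add: k U.act_add_left cvec.subspace_add[OF U.subspace])
      then show "act' (k (x + y)) w = act' (k x) w + act' (k y) w" using w by (simp add: V.act_add_left)
    next
      fix c x assume "x \<in> U"
      then have "act' (k (c *\<^sub>C x)) w = act' (c *\<^sub>C k x) w"
        using BU[OF b(1)] by (intro eq) (simp add: k U.act_scale_left cvec.subspace_scale[OF U.subspace])
      then show "act' (k (c *\<^sub>C x)) w = c *\<^sub>C act' (k x) w" using w by (simp add: V.act_scale_left)
    qed
    show "(\<lambda>x. act' (k x) w) ` U \<subseteq> V" using w V.closed by blast
    show "act' (k (act h x)) w = act' h (act' (k x) w)" if "x \<in> U" for h x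
    proof -
      have "act' (k (act h x)) w = act' (h * k x) w"
        using that BU[OF b(1)] by (intro eq) (simp add: k U.act_mult U.closed)
      then show ?thesis using w by (simp add: V.act_mult)
    qed
    show "b \<in> U" by (rule BU[OF b(1)])
    have "act' (k b) w = act' 1 w" using BU[OF b(1)] by (intro eq) (simp add: k U.act_one)
    then show "act' (k b) w \<noteq> 0" using b(2) w by (simp add: V.act_one w_def)
  qed
  then show ?thesis by blast
qed

text \<open>The annihilator of \<open>U\<close> is an ideal that does not kill \<open>V\<close>, for
  otherwise the two modules would be isomorphic. Burnside's theorem inside this ideal gives the
  identity on \<open>V\<close>.\<close>

lemma separating_element:
  assumes U: "irreducible_alg_module U act" "finite_dim U"
    and V: "irreducible_alg_module V act'" "finite_dim V"
    and noniso: "\<nexists>\<theta>. alg_module_iso U act V act' \<theta>"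
  shows "\<exists>h. (\<forall>x\<in>U. act h x = 0) \<and> (\<forall>v\<in>V. act' h v = v)"
proof -
  interpret U: alg_module U act using U(1) by (rule irreducible_alg_module_module)
  let ?I = "{h. \<forall>x\<in>U. act h x = 0}"
  obtain g v where gv: "\<And>x. x \<in> U \<Longrightarrow> act g x = 0" "v \<in> V" "act' g v \<noteq> 0"
    using iso_if_annihilator_subset[OF U V(1)] noniso by blast
  have "\<exists>h\<in>?I. \<forall>v\<in>V. act' h v = v"
  proof (rule ideal_density[OF V, where g = g and y = v])
    show "linear_on V (\<lambda>x. x)" by (simp add: linear_on_def)
    show "two_sided_ideal ?I"
      using U.act_scale_left[of _ 0 0]
      by (auto simp: two_sided_ideal_def cvec.subspace_def U.act_add_left U.act_scale_left U.act_mult U.closed)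
  qed (use gv in auto)
  then show ?thesis by blast
qed

lemma character_iso:
  assumes "alg_module_iso U act V act' \<theta>" "finite_dim U"
  shows "character V act' = character U act"
proof
  interpret U: alg_module U act using assms(1) by (simp add: alg_module_iso_def)
  interpret V: alg_module V act' using assms(1) by (simp add: alg_module_iso_def)
  fix h
  have "trace_on V (act' h) = trace_on U (act h)"
  proof (rule trace_on_transport[OF assms(2)])
    show "linear_on U \<theta>" "bij_betw \<theta> U V" "\<And>x. x \<in> U \<Longrightarrow> \<theta> (act h x) = act' h (\<theta> x)"
      using assms(1) by (simp_all add: alg_module_iso_def)
  qed (rule U.linear_right V.linear_right U.closed V.closed; assumption)+
  then show "character V act' h = character U act h" by (simp add: character_def)
qed

text \<open>A separating element would have trace 0 on \<open>U\<close> and trace dim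
  \<open>V\<close> on \<open>V\<close>, and the latter is nonzero in characteristic zero.\<close>

lemma same_character_iso:
  assumes U: "irreducible_alg_module U act" "finite_dim U"
    and V: "irreducible_alg_module V act'" "finite_dim V"
    and eq: "character U act = character V act'"
  shows "\<exists>\<theta>. alg_module_iso U act V act' \<theta>"
proof (rule ccontr)
  assume noniso: "\<not> ?thesis"
  interpret U: alg_module U act using U(1) by (rule irreducible_alg_module_module)
  interpret V: alg_module V act' using V(1) by (rule irreducible_alg_module_module)
  obtain h where "(\<forall>x\<in>U. act h x = 0) \<and> (\<forall>v\<in>V. act' h v = v)"
    using separating_element[OF U V noniso] ..
  then have h: "\<And>x. x \<in> U \<Longrightarrow> act h x = 0" "\<And>v. v \<in> V \<Longrightarrow> act' h v = v" by auto
  obtain B where B: "cvec.independent B" "cvec.span B = U" "finite B" using U(2) by (auto simp: finite_dim_def)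
  obtain C where C: "cvec.independent C" "cvec.span C = V" "finite C" using V(2) by (auto simp: finite_dim_def)
  have "character U act h = (\<Sum>b\<in>B. cvec.representation B (act h b) b)"
    unfolding character_def by (rule trace_on_eq[OF B U.linear_right U.closed])
  also have "\<dots> = 0"
    by (rule sum.neutral) (use h(1) B(2) cvec.span_base cvec.representation_zero in metis)
  finally have "character V act' h = 0" using eq by simp
  moreover have "character V act' h = (\<Sum>c\<in>C. cvec.representation C (act' h c) c)"
    unfolding character_def by (rule trace_on_eq[OF C V.linear_right V.closed])
  moreover have "\<dots> = (\<Sum>c\<in>C. 1)"
  proof (rule sum.cong[OF refl])
    fix c assume "c \<in> C"
    moreover from this have "act' h c = c" using h(2) C(2) cvec.span_base by blast
    ultimately show "cvec.representation C (act' h c) c = 1" using C(1) by (simp add: cvec.representation_basis)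
  qed
  ultimately have "C = {}" using C(3) by simp
  then show False using C(2) irreducible_nonzero[OF V(1)] by auto
qed

text \<open>A Chinese remainder argument: elements separating U_i from one other module at a time
  are multiplied.\<close>

lemma separating_family:
  assumes fin: "finite J" and i: "i \<notin> J"
    and irr: "\<And>j. j \<in> insert i J \<Longrightarrow> irreducible_alg_module (U j) (act j) \<and> finite_dim (U j)"
    and noniso: "\<And>j \<theta>. j \<in> J \<Longrightarrow> \<not> alg_module_iso (U j) (act j) (U i) (act i) \<theta>"
    and T: "linear_on (U i) T" "\<And>x. x \<in> U i \<Longrightarrow> T x \<in> U i"
  shows "\<exists>h. (\<forall>x\<in>U i. act i h x = T x) \<and> (\<forall>j\<in>J. \<forall>x\<in>U j. act j h x = 0)"
  using fin i irr noniso
proof (induction J)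
  case empty
  then have "irreducible_alg_module (U i) (act i)" "finite_dim (U i)" by auto
  then obtain h where "\<forall>x\<in>U i. act i h x = T x" using irreducible_density[OF _ _ T] by blast
  then show ?case by blast
next
  case (insert j J)
  then obtain h where h: "\<forall>x\<in>U i. act i h x = T x" "\<forall>j\<in>J. \<forall>x\<in>U j. act j h x = 0" by auto
  obtain g where g: "\<forall>x\<in>U j. act j g x = 0" "\<forall>x\<in>U i. act i g x = x"
    using separating_element[of "U j" "act j" "U i" "act i"] insert.prems by blast
  have mod: "alg_module (U k) (act k)" if "k \<in> insert i (insert j J)" for k
    using insert.prems(2) that irreducible_alg_module_module by blast
  have "act k (h * g) x = act k h (act k g x)" if "k \<in> insert i (insert j J)" "x \<in> U k" for k x
    using alg_module.act_mult[OF mod[OF that(1)] that(2)] .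
  \<comment> \<open>\<open>g\<close> acts first. It kills U_j, is the identity on U_i, and maps the
    remaining carriers into themselves, where \<open>h\<close> then kills.\<close>
  then show ?case
    using h g alg_module.act_0[OF mod] alg_module.closed[OF mod] by (intro exI[of _ "h * g"]) auto
qed

section \<open>Transport of module structures\<close>

text \<open>Serves twice: to move a finite-dimensional module into the finitely supported sequences,
  and to put the H-action on the external direct sum.\<close>

lemma alg_module_transport:
  assumes U: "alg_module U act" and f: "linear_on U f" "inj_on f U"
  shows "alg_module_iso U act (f ` U) (\<lambda>h y. f (act h (inv_into U f y))) f"
proof -
  interpret alg_module U act by (rule U)
  have inv: "inv_into U f (f x) = x" if "x \<in> U" for x using f(2) that by simp
  have "alg_module (f ` U) (\<lambda>h y. f (act h (inv_into U f y)))"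
  proof
    show "cvec.subspace (f ` U)" by (rule linear_on_subspace_image[OF f(1) subspace])
    show "linear_on (f ` U) (\<lambda>y. f (act h (inv_into U f y)))" for h
      unfolding linear_on_def
      by (auto simp: linear_on_add[OF f(1), symmetric] linear_on_scale[OF f(1), symmetric] inv
          cvec.subspace_add[OF subspace] cvec.subspace_scale[OF subspace] act_add act_scale closed)
  qed (auto simp: inv closed act_one act_mult act_add_left act_scale_left linear_on_add[OF f(1)] linear_on_scale[OF f(1)])
  then show ?thesis
    unfolding alg_module_iso_def using f U inv by (auto simp: bij_betw_def)
qed

lemma irreducible_iso:
  assumes iso: "alg_module_iso U act V act' f" and irr: "irreducible_alg_module U act"
  shows "irreducible_alg_module V act'"
proof -
  interpret U: alg_module U act using iso by (simp add: alg_module_iso_def)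
  interpret V: alg_module V act' using iso by (simp add: alg_module_iso_def)
  have f: "linear_on U f" "bij_betw f U V" "\<And>h x. x \<in> U \<Longrightarrow> f (act h x) = act' h (f x)"
    using iso by (auto simp: alg_module_iso_def)
  have f0: "f 0 = 0" using linear_on_zero[OF f(1) U.subspace] .
  have fU: "f ` U = V" and inj: "inj_on f U" using f(2) by (auto simp: bij_betw_def)
  obtain z where z: "z \<in> U" "z \<noteq> 0" using irreducible_nonzero[OF irr] by blast
  then have "f z \<noteq> 0" using inj f0 cvec.subspace_0[OF U.subspace] by (metis inj_onD)
  then have "V \<noteq> {0}" using fU z(1) by blast
  moreover have "S = {0} \<or> S = V"
    if S: "cvec.subspace S" "S \<subseteq> V" "\<forall>h. \<forall>x\<in>S. act' h x \<in> S" for S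
  proof -
    let ?R = "{x\<in>U. f x \<in> S}"
    have "cvec.subspace ?R"
      by (rule cvec.subspaceI)
        (auto simp: f0 cvec.subspace_0 cvec.subspace_add cvec.subspace_scale U.subspace S(1)
          linear_on_add[OF f(1)] linear_on_scale[OF f(1)])
    moreover have "\<forall>h. \<forall>x\<in>?R. act h x \<in> ?R" using S(3) f(3) U.closed by auto
    ultimately have "?R = {0} \<or> ?R = U" using irr unfolding irreducible_alg_module_def by blast
    moreover have "S = f ` ?R" using S(2) fU by blast
    ultimately show ?thesis using f0 fU by auto
  qed
  ultimately show ?thesis unfolding irreducible_alg_module_def using V.alg_module_axioms by blast
qed

text \<open>\<open>irreducible_characters\<close> ranges over subspaces of the finitely supported
  sequences, so \<open>U\<close> is embedded there by sending a basis to distinct unit vectors;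
  isomorphic modules have the same character.\<close>

lemma character_in_irreducible_characters:
  fixes act :: "'h::complex_algebra_1 \<Rightarrow> 'a::complex_vector \<Rightarrow> 'a"
  assumes irr: "irreducible_alg_module U act" and fd: "finite_dim U"
  shows "character U act \<in> irreducible_characters"
proof -
  interpret alg_module U act using irr by (rule irreducible_alg_module_module)
  obtain B where B: "cvec.independent B" "cvec.span B = U" "finite B" using fd by (auto simp: finite_dim_def)
  obtain e :: "'a \<Rightarrow> nat" where e: "inj_on e B" using finite_imp_inj_to_nat_seg[OF B(3)] by blast
  obtain g :: "'a \<Rightarrow> nat \<Rightarrow>\<^sub>0 complex" where g: "clinear g" "\<forall>b\<in>B. g b = Poly_Mapping.single (e b) 1"
    using cpair.linear_independent_extend[OF B(1), of "\<lambda>b. Poly_Mapping.single (e b) 1"] by blast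
  have lookup: "Poly_Mapping.lookup (g x) (e b) = cvec.representation B x b" if "x \<in> U" "b \<in> B" for x b
  proof -
    have "g x = g (\<Sum>b\<in>B. cvec.representation B x b *\<^sub>C b)"
      using sum_representation[OF B(1) _ B(3)] B(2) that(1) by simp
    also have "\<dots> = (\<Sum>b\<in>B. cvec.representation B x b *\<^sub>C Poly_Mapping.single (e b) 1)"
      using g(2) by (simp add: clinear_sum[OF g(1)] clinear_scale[OF g(1)])
    finally have "Poly_Mapping.lookup (g x) (e b) =
        (\<Sum>b'\<in>B. cvec.representation B x b' *\<^sub>C (if e b' = e b then 1 else 0))"
      by (simp add: lookup_sum lookup_single when_def)
    also have "\<dots> = (\<Sum>b'\<in>B. if b' = b then cvec.representation B x b' else 0)"
      by (rule sum.cong) (use e that(2) in \<open>auto simp: inj_on_def scaleC_complex_def\<close>)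
    also have "\<dots> = cvec.representation B x b" using that(2) B(3) by simp
    finally show ?thesis .
  qed
  have inj: "inj_on g U"
  proof (rule inj_onI)
    fix x y assume xy: "x \<in> U" "y \<in> U" "g x = g y"
    then have "cvec.representation B x b = cvec.representation B y b" if "b \<in> B" for b
      using lookup that by metis
    then have "(\<Sum>b\<in>B. cvec.representation B x b *\<^sub>C b) = (\<Sum>b\<in>B. cvec.representation B y b *\<^sub>C b)" by simp
    then show "x = y" using sum_representation[OF B(1) _ B(3)] B(2) xy(1,2) by simp
  qed
  have lin: "linear_on U g" by (rule clinear_linear_on[OF g(1)])
  note iso = alg_module_transport[OF alg_module_axioms lin inj]
  show ?thesis
    unfolding irreducible_characters_def
    using irreducible_iso[OF iso irr] finite_dim_image[OF fd lin inj] character_iso[OF iso fd] by force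
qed

section \<open>Tensor products\<close>

lemma cbilinearI:
  assumes "\<And>a a' b. \<beta> (a + a') b = \<beta> a b + \<beta> a' b" "\<And>a b b'. \<beta> a (b + b') = \<beta> a b + \<beta> a b'"
    "\<And>c a b. \<beta> (c *\<^sub>C a) b = c *\<^sub>C \<beta> a b" "\<And>c a b. \<beta> a (c *\<^sub>C b) = c *\<^sub>C \<beta> a b"
  shows "cbilinear \<beta>"
  unfolding cbilinear_def using assms by (auto intro!: clinearI)

lemma cbilinear_tensor_prod: "cbilinear (\<otimes>)"
proof (rule cbilinearI)
  fix a a' :: 'a and b b' :: 'b and c :: complex
  note rel = cvec.span_base[of _ tensor_relations]
  have s: "r *\<^sub>C Poly_Mapping.single p 1 = Poly_Mapping.single p r" for p :: "'a \<times> 'b" and r :: complex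
    by (rule poly_mapping_eqI) (simp add: lookup_single when_def scaleC_complex_def)
  show "(a + a') \<otimes> b = a \<otimes> b + a' \<otimes> b"
    by (transfer, unfold tensor_eq_def diff_diff_eq[symmetric], rule rel)
      (unfold tensor_relations_def, blast)
  show "a \<otimes> (b + b') = a \<otimes> b + a \<otimes> b'"
    by (transfer, unfold tensor_eq_def diff_diff_eq[symmetric], rule rel)
      (unfold tensor_relations_def, blast)
  show "(c *\<^sub>C a) \<otimes> b = c *\<^sub>C (a \<otimes> b)"
    by (transfer, unfold tensor_eq_def s, rule rel) (unfold tensor_relations_def, blast)
  show "a \<otimes> (c *\<^sub>C b) = c *\<^sub>C (a \<otimes> b)"
    by (transfer, unfold tensor_eq_def s, rule rel) (unfold tensor_relations_def, blast)
qed

lemmas tensor_prod_simps = cbilinear_simps[OF cbilinear_tensor_prod]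

lemma tensor_prod_zero: "b \<otimes> 0 = 0"
  using tensor_prod_simps(4)[of b 0 0] by simp

text \<open>Pure tensors span. This replaces computation with representatives: identities between
  maps built from \<open>tensor_lift\<close> are checked on pure tensors.\<close>

lemma tensor_linear_eq:
  assumes F: "clinear F" and G: "clinear G" and eq: "\<And>a b. F (a \<otimes> b) = G (a \<otimes> b)"
  shows "F t = G t"
proof (induction t rule: tensor.abs_induct)
  case (1 x)
  have x: "x = (\<Sum>p\<in>Poly_Mapping.keys x. Poly_Mapping.lookup x p *\<^sub>C Poly_Mapping.single p 1)"
    by (rule poly_mapping_eqI)
      (simp add: lookup_sum lookup_single when_def scaleC_complex_def in_keys_iff if_distrib cong: if_cong)
  have lin: "abs_tensor (\<Sum>p\<in>K. r p *\<^sub>C Poly_Mapping.single p 1) = (\<Sum>p\<in>K. r p *\<^sub>C (fst p \<otimes> snd p))"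
    if "finite K" for K and r :: "'a \<times> 'b \<Rightarrow> complex"
    using that by induction
      (simp_all add: plus_tensor.abs_eq[symmetric] scaleC_tensor.abs_eq[symmetric]
        zero_tensor.abs_eq[symmetric] tensor_prod.abs_eq)
  have "abs_tensor x =
      (\<Sum>p\<in>Poly_Mapping.keys x. Poly_Mapping.lookup x p *\<^sub>C (fst p \<otimes> snd p))"
    by (rule trans[OF arg_cong[OF x, of abs_tensor] lin[OF finite_keys]])
  then show ?case
    by (simp add: clinear_sum[OF F] clinear_sum[OF G] clinear_scale[OF F] clinear_scale[OF G] eq)
qed

text \<open>In Sweedler notation, a linear map is moved inside the sum over h_1 and h_2.\<close>

lemma tensor_lift_compose:
  assumes "clinear L" "cbilinear \<beta>"
  shows "L (tensor_lift \<beta> t) = tensor_lift (\<lambda>a b. L (\<beta> a b)) t"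
proof -
  have bil: "cbilinear (\<lambda>a b. L (\<beta> a b))"
    by (rule cbilinearI)
      (simp_all add: cbilinear_simps[OF assms(2)] clinear_add[OF assms(1)] clinear_scale[OF assms(1)])
  have lin: "clinear (\<lambda>t. L (tensor_lift \<beta> t))"
    by (rule clinearI)
      (simp_all add: clinear_add[OF linear_tensor_lift[OF assms(2)]] clinear_add[OF assms(1)]
        clinear_scale[OF linear_tensor_lift[OF assms(2)]] clinear_scale[OF assms(1)])
  show ?thesis
    using tensor_linear_eq[of "\<lambda>t. L (tensor_lift \<beta> t)" "tensor_lift (\<lambda>a b. L (\<beta> a b))" t]
      lin linear_tensor_lift[OF bil] bil assms(2) by simp
qed

lemma tensor_lift_sum:
  assumes "\<And>i. i \<in> I \<Longrightarrow> cbilinear (\<beta> i)"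
  shows "tensor_lift (\<lambda>a b. \<Sum>i\<in>I. \<beta> i a b) t = (\<Sum>i\<in>I. tensor_lift (\<beta> i) t)"
proof (rule tensor_linear_eq)
  have bil: "cbilinear (\<lambda>a b. \<Sum>i\<in>I. \<beta> i a b)"
    by (rule cbilinearI)
      (simp_all add: cbilinear_simps[OF assms] sum.distrib cvec.scale_sum_right cong: sum.cong)
  show "clinear (tensor_lift (\<lambda>a b. \<Sum>i\<in>I. \<beta> i a b))" by (rule linear_tensor_lift[OF bil])
  show "clinear (\<lambda>t. \<Sum>i\<in>I. tensor_lift (\<beta> i) t)"
    by (rule clinearI)
      (simp_all add: clinear_add[OF linear_tensor_lift[OF assms]] sum.distrib
        clinear_scale[OF linear_tensor_lift[OF assms]] cvec.scale_sum_right cong: sum.cong)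
  show "tensor_lift (\<lambda>a b. \<Sum>i\<in>I. \<beta> i a b) (a \<otimes> b) = (\<Sum>i\<in>I. tensor_lift (\<beta> i) (a \<otimes> b))" for a b
    using assms bil by simp
qed

definition ctrilinear ::
    "('a::complex_vector \<Rightarrow> 'b::complex_vector \<Rightarrow> 'c::complex_vector \<Rightarrow> 'd::complex_vector) \<Rightarrow> bool"
  where "ctrilinear \<tau> \<longleftrightarrow> (\<forall>a. cbilinear (\<tau> a)) \<and> (\<forall>b. cbilinear (\<lambda>a c. \<tau> a b c))"

lemma ctrilinear_simps:
  assumes "ctrilinear \<tau>"
  shows "\<tau> (a + a') b c = \<tau> a b c + \<tau> a' b c" "\<tau> a (b + b') c = \<tau> a b c + \<tau> a b' c"
    "\<tau> a b (c + c') = \<tau> a b c + \<tau> a b c'"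
    "\<tau> (r *\<^sub>C a) b c = r *\<^sub>C \<tau> a b c" "\<tau> a (r *\<^sub>C b) c = r *\<^sub>C \<tau> a b c" "\<tau> a b (r *\<^sub>C c) = r *\<^sub>C \<tau> a b c"
proof -
  have 1: "cbilinear (\<tau> a)" for a using assms by (simp add: ctrilinear_def)
  have 2: "cbilinear (\<lambda>a c. \<tau> a b c)" for b using assms by (simp add: ctrilinear_def)
  show "\<tau> (a + a') b c = \<tau> a b c + \<tau> a' b c" "\<tau> a (b + b') c = \<tau> a b c + \<tau> a b' c"
    "\<tau> a b (c + c') = \<tau> a b c + \<tau> a b c'"
    "\<tau> (r *\<^sub>C a) b c = r *\<^sub>C \<tau> a b c" "\<tau> a (r *\<^sub>C b) c = r *\<^sub>C \<tau> a b c" "\<tau> a b (r *\<^sub>C c) = r *\<^sub>C \<tau> a b c"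
    using cbilinear_simps[OF 1] cbilinear_simps[OF 2] by auto
qed

lemma ctrilinear_lift:
  assumes "ctrilinear \<tau>"
  shows "cbilinear (\<lambda>a t. tensor_lift (\<tau> a) t)"
proof -
  note simps = ctrilinear_simps[OF assms]
  have bil: "cbilinear (\<tau> a)" for a using assms by (simp add: ctrilinear_def)
  note lin = linear_tensor_lift[OF bil]
  show ?thesis
  proof (rule cbilinearI)
    show "tensor_lift (\<tau> (a + a')) t = tensor_lift (\<tau> a) t + tensor_lift (\<tau> a') t" for a a' t
    proof (rule tensor_linear_eq[OF lin])
      show "clinear (\<lambda>t. tensor_lift (\<tau> a) t + tensor_lift (\<tau> a') t)"
        by (rule clinearI) (simp_all add: clinear_add[OF lin] clinear_scale[OF lin] cvec.scale_right_distrib)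
    qed (simp add: bil simps)
    show "tensor_lift (\<tau> (r *\<^sub>C a)) t = r *\<^sub>C tensor_lift (\<tau> a) t" for r a t
    proof (rule tensor_linear_eq[OF lin])
      show "clinear (\<lambda>t. r *\<^sub>C tensor_lift (\<tau> a) t)"
        by (rule clinearI)
          (simp_all add: clinear_add[OF lin] clinear_scale[OF lin] cvec.scale_right_distrib mult.commute)
    qed (simp add: bil simps)
  qed (simp_all add: clinear_add[OF lin] clinear_scale[OF lin])
qed

context hopf_algebra
begin

text \<open>Sweedler sums do not depend on the bracketing. A trilinear map induces a linear map on H
  \<otimes> (H \<otimes> H), and this map is applied to the coassociativity axiom.\<close>

lemma comult_coassociative:
  assumes \<tau>: "ctrilinear \<tau>"
  shows "tensor_lift (\<lambda>a c. tensor_lift (\<lambda>a1 a2. \<tau> a1 a2 c) (\<Delta> a)) (\<Delta> h) =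
    tensor_lift (\<lambda>a b. tensor_lift (\<tau> a) (\<Delta> b)) (\<Delta> h)"
proof -
  note simps = ctrilinear_simps[OF \<tau>]
  define F where "F = tensor_lift (\<lambda>a. tensor_lift (\<tau> a))"
  note bilF = ctrilinear_lift[OF \<tau>]
  have linF: "clinear F" unfolding F_def by (rule linear_tensor_lift[OF bilF])
  have bil1: "cbilinear (\<tau> a)" for a using \<tau> by (simp add: ctrilinear_def)
  have bil3: "cbilinear (\<lambda>a b. a \<otimes> (b \<otimes> c))" for c :: 'h
    by (rule cbilinearI) (simp_all add: tensor_prod_simps)
  have "ctrilinear (\<lambda>c a b :: 'h. a \<otimes> (b \<otimes> c :: ('h, 'h) tensor))"
    unfolding ctrilinear_def by (intro conjI allI cbilinearI) (simp_all add: tensor_prod_simps)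
  then have bilA: "cbilinear (\<lambda>t c. tensor_lift (\<lambda>a b. a \<otimes> (b \<otimes> c)) t :: ('h, ('h, 'h) tensor) tensor)"
    using cbilinear_simps[OF ctrilinear_lift] by (intro cbilinearI) auto
  have "F (tensor_map id \<Delta> (\<Delta> h)) = tensor_lift (\<lambda>a b. tensor_lift (\<tau> a) (\<Delta> b)) (\<Delta> h)"
  proof -
    have "cbilinear (\<lambda>a b. id a \<otimes> \<Delta> b)"
      by (rule cbilinearI) (simp_all add: tensor_prod_simps clinear_add[OF comult_linear] clinear_scale[OF comult_linear])
    then have "F (tensor_map id \<Delta> (\<Delta> h)) = tensor_lift (\<lambda>a b. F (id a \<otimes> \<Delta> b)) (\<Delta> h)"
      unfolding tensor_map_def by (rule tensor_lift_compose[OF linF])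
    then show ?thesis by (simp add: F_def tensor_lift_prod[OF bilF])
  qed
  moreover have "F (tensor_assoc (tensor_map \<Delta> id (\<Delta> h))) =
      tensor_lift (\<lambda>a c. tensor_lift (\<lambda>a1 a2. \<tau> a1 a2 c) (\<Delta> a)) (\<Delta> h)"
  proof -
    have "cbilinear (\<lambda>a b. \<Delta> a \<otimes> id b)"
      by (rule cbilinearI) (simp_all add: tensor_prod_simps clinear_add[OF comult_linear] clinear_scale[OF comult_linear])
    moreover have linA: "clinear (tensor_assoc :: (('h, 'h) tensor, 'h) tensor \<Rightarrow> _)"
      unfolding tensor_assoc_def by (rule linear_tensor_lift[OF bilA])
    moreover have "clinear (\<lambda>t. F (tensor_assoc t :: ('h, ('h, 'h) tensor) tensor))"
      by (rule clinearI)
        (simp_all add: clinear_add[OF linF] clinear_add[OF linA] clinear_scale[OF linF] clinear_scale[OF linA])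
    ultimately have "F (tensor_assoc (tensor_map \<Delta> id (\<Delta> h))) =
        tensor_lift (\<lambda>a c. F (tensor_assoc (\<Delta> a \<otimes> id c))) (\<Delta> h)"
      unfolding tensor_map_def by (intro tensor_lift_compose[of "\<lambda>t. F (tensor_assoc t)"])
    moreover have "F (tensor_assoc (s \<otimes> c)) = tensor_lift (\<lambda>a1 a2. \<tau> a1 a2 c) s" for s c
    proof -
      have "tensor_assoc (s \<otimes> c) = tensor_lift (\<lambda>a b. a \<otimes> (b \<otimes> c)) s"
        unfolding tensor_assoc_def by (rule tensor_lift_prod[OF bilA])
      then have "F (tensor_assoc (s \<otimes> c)) = tensor_lift (\<lambda>a b. F (a \<otimes> (b \<otimes> c))) s"
        using tensor_lift_compose[OF linF bil3] by simp
      then show ?thesis by (simp add: F_def tensor_lift_prod[OF bilF] tensor_lift_prod[OF bil1])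
    qed
    ultimately show ?thesis by simp
  qed
  ultimately show ?thesis using coassoc[of h] by simp
qed

end

section \<open>Modes and the Hopf action\<close>

context va_module
begin

lemma YM_add_left: "u \<in> A \<Longrightarrow> v \<in> A \<Longrightarrow> w \<in> N \<Longrightarrow> YM (u + v) n w = YM u n w + YM v n w"
  using linear_on_add[OF YM_linear_left] by blast

lemma YM_scale_left: "u \<in> A \<Longrightarrow> w \<in> N \<Longrightarrow> YM (c *\<^sub>C u) n w = c *\<^sub>C YM u n w"
  using linear_on_scale[OF YM_linear_left] by blast

lemma YM_diff_left: "u \<in> A \<Longrightarrow> v \<in> A \<Longrightarrow> w \<in> N \<Longrightarrow> YM (u - v) n w = YM u n w - YM v n w"
  using linear_on_diff[OF YM_linear_left alg_subspace] by blast

lemma YM_zero_left: "w \<in> N \<Longrightarrow> YM 0 n w = 0"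
  using linear_on_zero[OF YM_linear_left alg_subspace] by blast

lemma YM_add: "u \<in> A \<Longrightarrow> w \<in> N \<Longrightarrow> w' \<in> N \<Longrightarrow> YM u n (w + w') = YM u n w + YM u n w'"
  using linear_on_add[OF YM_linear_right] by blast

lemma YM_scale: "u \<in> A \<Longrightarrow> w \<in> N \<Longrightarrow> YM u n (c *\<^sub>C w) = c *\<^sub>C YM u n w"
  using linear_on_scale[OF YM_linear_right] by blast

lemma YM_zero: "u \<in> A \<Longrightarrow> YM u n 0 = 0"
  using linear_on_zero[OF YM_linear_right mod_subspace] by blast

end

context hopf_va_module
begin

lemmas YM_simps = YM_add_left[OF UNIV_I UNIV_I UNIV_I] YM_scale_left[OF UNIV_I UNIV_I]
  YM_add[OF UNIV_I UNIV_I UNIV_I] YM_scale[OF UNIV_I UNIV_I]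
  HM.act_add_left[OF UNIV_I] HM.act_scale_left[OF UNIV_I]
  HM.act_add[OF UNIV_I UNIV_I] HM.act_scale[OF UNIV_I]
  H.act_add_left[OF UNIV_I] H.act_scale_left[OF UNIV_I]
  H.act_add[OF UNIV_I UNIV_I] H.act_scale[OF UNIV_I]
  clinear_add[OF antipode_linear] clinear_scale[OF antipode_linear]

text \<open>Moving h_1 past u_n on the right-hand side produces the sum of (h_1 u)_n h_2 S(h_3). The
  antipode axiom contracts h_2 S(h_3) to a counit, and the counit axiom restores h.\<close>

lemma mode_act:
  "YM (act h u) n w = tensor_lift (\<lambda>a b. actM a (YM u n (actM (antipode b) w))) (\<Delta> h)"
proof -
  let ?\<tau> = "\<lambda>a b c. YM (act a u) n (actM b (actM (antipode c) w))"
  have tri: "ctrilinear ?\<tau>"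
    unfolding ctrilinear_def by (intro conjI allI cbilinearI) (simp_all add: YM_simps)
  have inner: "tensor_lift (?\<tau> a) (\<Delta> b) = YM (act (\<epsilon> b *\<^sub>C a) u) n w" for a b
  proof -
    have "tensor_lift (?\<tau> a) (\<Delta> b) =
        tensor_lift (\<lambda>x y. YM (act a u) n (actM (x * antipode y) w)) (\<Delta> b)"
      by (simp add: HM.act_mult)
    also have "\<dots> = YM (act a u) n (actM (tensor_lift (\<lambda>x y. x * antipode y) (\<Delta> b)) w)"
    proof (rule tensor_lift_compose[symmetric])
      show "clinear (\<lambda>x. YM (act a u) n (actM x w))" by (rule clinearI) (simp_all add: YM_simps)
      show "cbilinear (\<lambda>x y. x * antipode y)"
        by (rule cbilinearI) (simp_all add: YM_simps algebra_simps mult_scaleC_left mult_scaleC_right)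
    qed
    also have "\<dots> = YM (act (\<epsilon> b *\<^sub>C a) u) n w"
      by (simp add: antipode_right YM_simps HM.act_one)
    finally show ?thesis .
  qed
  have "tensor_lift (\<lambda>a b. actM a (YM u n (actM (antipode b) w))) (\<Delta> h) =
      tensor_lift (\<lambda>a c. tensor_lift (\<lambda>a1 a2. ?\<tau> a1 a2 c) (\<Delta> a)) (\<Delta> h)"
    by (simp add: act_YM)
  also have "\<dots> = tensor_lift (\<lambda>a b. tensor_lift (?\<tau> a) (\<Delta> b)) (\<Delta> h)"
    by (rule comult_coassociative[OF tri])
  also have "\<dots> = tensor_lift (\<lambda>a b. YM (act (\<epsilon> b *\<^sub>C a) u) n w) (\<Delta> h)"
    by (simp only: inner)
  also have "\<dots> = YM (act (tensor_lift (\<lambda>a b. \<epsilon> b *\<^sub>C a) (\<Delta> h)) u) n w"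
  proof (rule tensor_lift_compose[symmetric])
    show "clinear (\<lambda>x. YM (act x u) n w)" by (rule clinearI) (simp_all add: YM_simps)
    show "cbilinear (\<lambda>a b. \<epsilon> b *\<^sub>C a)"
      by (rule cbilinearI)
        (simp_all add: clinear_add[OF counit_linear] clinear_scale[OF counit_linear] scaleC_complex_def
          cvec.scale_left_distrib cvec.scale_right_distrib mult.commute)
  qed
  also have "\<dots> = YM (act h u) n w" by (simp add: counit_right)
  finally show ?thesis by simp
qed

text \<open>For invariant u the sum of (h_1 u)_n h_2 is the sum of \<epsilon>(h_1) u_n h_2, which is
  u_n h.\<close>

lemma invariant_mode_commute:
  assumes "u \<in> invariants \<epsilon> act"
  shows "actM h (YM u n w) = YM u n (actM h w)"
proof -
  have "actM h (YM u n w) = tensor_lift (\<lambda>a b. YM u n (actM (\<epsilon> a *\<^sub>C b) w)) (\<Delta> h)"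
    using assms by (simp add: act_YM invariants_def YM_simps)
  also have "\<dots> = YM u n (actM (tensor_lift (\<lambda>a b. \<epsilon> a *\<^sub>C b) (\<Delta> h)) w)"
  proof (rule tensor_lift_compose[symmetric])
    show "clinear (\<lambda>x. YM u n (actM x w))" by (rule clinearI) (simp_all add: YM_simps)
    show "cbilinear (\<lambda>a b. \<epsilon> a *\<^sub>C b)"
      by (rule cbilinearI)
        (simp_all add: clinear_add[OF counit_linear] clinear_scale[OF counit_linear] scaleC_complex_def
          cvec.scale_left_distrib cvec.scale_right_distrib mult.commute)
  qed
  finally show ?thesis by (simp add: counit_left)
qed

text \<open>For T commuting with H, the sum of h_1 T S(h_2) equals the sum of h_1 S(h_2) T, which is
  \<epsilon>(h) T. Commutation is asked at one vector only, so that the lemma can be used on an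
  H-stable set.\<close>

lemma act_sum_modes:
  assumes comm: "\<And>g. (\<Sum>j\<in>J. YM (s j) (n j) (actM g w)) = actM g (\<Sum>j\<in>J. YM (s j) (n j) w)"
  shows "(\<Sum>j\<in>J. YM (act h (s j)) (n j) w) = \<epsilon> h *\<^sub>C (\<Sum>j\<in>J. YM (s j) (n j) w)"
proof -
  let ?T = "\<lambda>w. \<Sum>j\<in>J. YM (s j) (n j) w"
  have "(\<Sum>j\<in>J. YM (act h (s j)) (n j) w) =
      tensor_lift (\<lambda>a b. \<Sum>j\<in>J. actM a (YM (s j) (n j) (actM (antipode b) w))) (\<Delta> h)"
    unfolding mode_act
    by (rule tensor_lift_sum[symmetric]) (rule cbilinearI; simp add: YM_simps)
  also have "\<dots> = tensor_lift (\<lambda>a b. actM (a * antipode b) (?T w)) (\<Delta> h)"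
    by (simp add: HM.act_sum[symmetric] comm HM.act_mult)
  also have "\<dots> = actM (tensor_lift (\<lambda>a b. a * antipode b) (\<Delta> h)) (?T w)"
  proof (rule tensor_lift_compose[symmetric])
    show "clinear (\<lambda>x. actM x (?T w))" by (rule HM.linear_left) simp
    show "cbilinear (\<lambda>x y. x * antipode y)"
      by (rule cbilinearI) (simp_all add: YM_simps algebra_simps mult_scaleC_left mult_scaleC_right)
  qed
  also have "\<dots> = \<epsilon> h *\<^sub>C ?T w"
    by (simp add: antipode_right YM_simps HM.act_one)
  finally show ?thesis .
qed

text \<open>Induction on the number of summands: if
  \<open>r = h s\<^sub>i - \<epsilon>(h) s\<^sub>i\<close> is nonzero and \<open>g r = s\<^sub>i\<close>, subtracting the vanishing combination
  \<open>\<Sum>\<^sub>j (g (h s\<^sub>j - \<epsilon>(h) s\<^sub>j))\<^sub>n\<^sub>j\<close> removes the index \<open>i\<close>.\<close>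
lemma invariant_modes:
  assumes "finite J"
    and "\<And>j. j \<in> J \<Longrightarrow> irreducible_alg_module (S j) act \<and> s j \<in> S j"
    and "\<And>w h. w \<in> U \<Longrightarrow> (\<Sum>j\<in>J. YM (s j) (n j) (actM h w)) = actM h (\<Sum>j\<in>J. YM (s j) (n j) w)"
    and U: "\<And>w h. w \<in> U \<Longrightarrow> actM h w \<in> U"
  shows "\<exists>x\<in>cvec.span {YM v m | v m. v \<in> invariants \<epsilon> act}. \<forall>w\<in>U. x w = (\<Sum>j\<in>J. YM (s j) (n j) w)"
  using assms(1-3)
proof (induction "card J" arbitrary: J s)
  case 0
  then have "J = {}" by simp
  then show ?case using cvec.span_zero by (intro bexI[of _ 0]) auto
next
  case (Suc k)
  let ?T = "\<lambda>w. \<Sum>j\<in>J. YM (s j) (n j) w"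
  show ?case
  proof (cases "\<forall>j\<in>J. s j \<in> invariants \<epsilon> act")
    case True
    have "(\<Sum>j\<in>J. YM (s j) (n j)) \<in> cvec.span {YM v m | v m. v \<in> invariants \<epsilon> act}"
      by (rule cvec.span_sum, rule cvec.span_base) (use True in blast)
    moreover have "(\<Sum>j\<in>J. YM (s j) (n j)) w = ?T w" for w
      by (induction J rule: infinite_finite_induct) auto
    ultimately show ?thesis by blast
  next
    case False
    then obtain i h where i: "i \<in> J" "act h (s i) \<noteq> \<epsilon> h *\<^sub>C s i" by (auto simp: invariants_def)
    interpret S: alg_module "S i" act
      using Suc.prems(2)[OF i(1)] irreducible_alg_module_module by blast
    define r where "r j = act h (s j) - \<epsilon> h *\<^sub>C s j" for j
    have rS: "r j \<in> S j" if "j \<in> J" for j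
    proof -
      interpret Sj: alg_module "S j" act using Suc.prems(2)[OF that] irreducible_alg_module_module by blast
      show ?thesis
        unfolding r_def using Suc.prems(2)[OF that]
        by (intro cvec.subspace_diff[OF Sj.subspace] cvec.subspace_scale[OF Sj.subspace] Sj.closed) auto
    qed
    have ri: "r i \<noteq> 0" using i(2) by (simp add: r_def)
    have "(\<lambda>g. act g (r i)) ` UNIV = S i"
      by (rule irreducible_orbit[OF _ two_sided_ideal_UNIV, of _ _ 1 "r i"])
        (use Suc.prems(2)[OF i(1)] rS[OF i(1)] ri in \<open>auto simp: S.act_one\<close>)
    then obtain g where g: "act g (r i) = s i" using Suc.prems(2)[OF i(1)] by (metis imageE)
    \<comment> \<open>Acting by \<open>h\<close> on the symbols multiplies the operator by
      \<epsilon>(h) on \<open>U\<close>, and this is exactly what \<open>r\<close>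
      subtracts.\<close>
    have rz: "(\<Sum>j\<in>J. YM (r j) (n j) w) = 0" if "w \<in> U" for w
      using act_sum_modes[where J = J and s = s and n = n and w = w and h = h] Suc.prems(3)[OF that]
      by (simp add: r_def YM_diff_left YM_simps sum_subtractf cvec.scale_sum_right)
    \<comment> \<open>The zero operator commutes with H, so acting by \<open>g\<close> on the
      symbols \<open>r j\<close> again gives zero on \<open>U\<close>.\<close>
    have grz: "(\<Sum>j\<in>J. YM (act g (r j)) (n j) w) = 0" if "w \<in> U" for w
      using act_sum_modes[where J = J and s = r and n = n and w = w and h = g] rz[OF that] rz[OF U[OF that]] by simp
    \<comment> \<open>\<open>s' i = 0\<close>, and every other \<open>s' j\<close> stays in its
      simple module, so the induction hypothesis applies to the remaining indices.\<close>
    define s' where "s' j = s j - act g (r j)" for j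
    have T: "(\<Sum>j\<in>J - {i}. YM (s' j) (n j) w) = ?T w" if "w \<in> U" for w
    proof -
      have "(\<Sum>j\<in>J. YM (s' j) (n j) w) = ?T w"
        using grz[OF that] by (simp add: s'_def YM_diff_left sum_subtractf)
      then show ?thesis
        using i(1) Suc.prems(1) g by (simp add: sum.remove[of J i] s'_def YM_zero_left)
    qed
    have "\<exists>x\<in>cvec.span {YM v m | v m. v \<in> invariants \<epsilon> act}.
        \<forall>w\<in>U. x w = (\<Sum>j\<in>J - {i}. YM (s' j) (n j) w)"
    proof (rule Suc.hyps(1))
      show "k = card (J - {i})" "finite (J - {i})" using Suc i(1) by auto
      show "irreducible_alg_module (S j) act \<and> s' j \<in> S j" if "j \<in> J - {i}" for j
      proof -
        interpret Sj: alg_module "S j" act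
          using Suc.prems(2)[of j] that irreducible_alg_module_module by blast
        show ?thesis
          using Suc.prems(2)[of j] that rS[of j] unfolding s'_def
          by (auto intro!: cvec.subspace_diff[OF Sj.subspace] Sj.closed)
      qed
      show "(\<Sum>j\<in>J - {i}. YM (s' j) (n j) (actM g w)) = actM g (\<Sum>j\<in>J - {i}. YM (s' j) (n j) w)"
        if "w \<in> U" for w g
        using T[OF that] T[OF U[OF that]] Suc.prems(3)[OF that] by simp
    qed
    then show ?thesis using T by simp
  qed
qed

end

section \<open>Operator-valued Jacobi identity and weak associativity\<close>

lemma sum_fun_apply: "(\<Sum>i\<in>I. f i) x = (\<Sum>i\<in>I. f i x)"
  by (induction I rule: infinite_finite_induct) auto

text \<open>\<open>Sum_any\<close> is 0 on infinite support, so finiteness at each point is not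
  enough to exchange it with evaluation; the family has to be finitely supported as a family of
  functions.\<close>

lemma Sum_any_fun_apply:
  fixes F :: "'p \<Rightarrow> 'x \<Rightarrow> 'm::comm_monoid_add"
  assumes "finite {p. F p \<noteq> 0}"
  shows "Sum_any F x = Sum_any (\<lambda>p. F p x)"
proof -
  have "{p. F p x \<noteq> 0} \<subseteq> {p. F p \<noteq> 0}" by auto
  then have "Sum_any (\<lambda>p. F p x) = (\<Sum>p | F p \<noteq> 0. F p x)"
    using assms by (rule Sum_any.expand_superset[rotated])
  then show ?thesis by (simp add: Sum_any.expand_set sum_fun_apply)
qed

lemma Sum_any_in_span:
  assumes "\<And>p. g p \<in> cvec.span X"
  shows "Sum_any g \<in> cvec.span X"
  unfolding Sum_any.expand_set by (rule cvec.span_sum) (rule assms)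

lemma delta_coeff_nonzero: "delta_coeff a b c \<noteq> 0 \<Longrightarrow> c \<ge> 0 \<and> a + b + c = -1"
  by (auto simp: delta_coeff_def split: if_splits)

text \<open>The delta coefficient forces p + q = a + b + c + 1 and q \<le> c, and truncation gives q
  \<ge> -K. This count and the next two are stated for bare operations so that they also apply to
  function spaces.\<close>

lemma jacobi_support_left:
  assumes "\<And>n. n \<ge> K \<Longrightarrow> YM v n w = 0" "\<And>n. YM u n 0 = 0"
  shows "finite {x. (case x of (p, q) \<Rightarrow> delta_coeff a (b - p) (c - q) *\<^sub>C YM u (- p - 1) (YM v (- q - 1) w)) \<noteq> 0}"
proof (rule finite_subset)
  show "{x. (case x of (p, q) \<Rightarrow> delta_coeff a (b - p) (c - q) *\<^sub>C YM u (- p - 1) (YM v (- q - 1) w)) \<noteq> 0}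
      \<subseteq> (\<lambda>q. (a + b + c + 1 - q, q)) ` {- K..c}"
  proof
    fix x assume x: "x \<in> {x. (case x of (p, q) \<Rightarrow> delta_coeff a (b - p) (c - q) *\<^sub>C YM u (- p - 1) (YM v (- q - 1) w)) \<noteq> 0}"
    obtain p q where pq: "x = (p, q)" by (cases x)
    have *: "delta_coeff a (b - p) (c - q) \<noteq> 0" "YM u (- p - 1) (YM v (- q - 1) w) \<noteq> 0"
      using x pq by auto
    then have "\<not> - q - 1 \<ge> K" using assms by auto
    then show "x \<in> (\<lambda>q. (a + b + c + 1 - q, q)) ` {- K..c}"
      using delta_coeff_nonzero[OF *(1)] unfolding pq by (intro image_eqI[of _ _ q]) auto
  qed
qed simp

lemma jacobi_support_swapped:
  assumes "\<And>n. n \<ge> K \<Longrightarrow> YM u n w = 0" "\<And>n. YM v n 0 = 0"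
  shows "finite {x. (case x of (p, q) \<Rightarrow> ((-1) powi (- a - 1) * delta_coeff a (c - q) (b - p)) *\<^sub>C
    YM v (- q - 1) (YM u (- p - 1) w)) \<noteq> 0}"
proof (rule finite_subset)
  show "{x. (case x of (p, q) \<Rightarrow> ((-1) powi (- a - 1) * delta_coeff a (c - q) (b - p)) *\<^sub>C
      YM v (- q - 1) (YM u (- p - 1) w)) \<noteq> 0} \<subseteq> (\<lambda>p. (p, a + b + c + 1 - p)) ` {- K..b}"
  proof
    fix x assume x: "x \<in> {x. (case x of (p, q) \<Rightarrow> ((-1) powi (- a - 1) * delta_coeff a (c - q) (b - p)) *\<^sub>C
      YM v (- q - 1) (YM u (- p - 1) w)) \<noteq> 0}"
    obtain p q where pq: "x = (p, q)" by (cases x)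
    have *: "delta_coeff a (c - q) (b - p) \<noteq> 0" "YM v (- q - 1) (YM u (- p - 1) w) \<noteq> 0"
      using x pq by auto
    then have "\<not> - p - 1 \<ge> K" using assms by auto
    then show "x \<in> (\<lambda>p. (p, a + b + c + 1 - p)) ` {- K..b}"
      using delta_coeff_nonzero[OF *(1)] unfolding pq by (intro image_eqI[of _ _ p]) auto
  qed
qed simp

lemma jacobi_support_right:
  assumes "\<And>n. n \<ge> K \<Longrightarrow> Y u n v = 0" "\<And>n. YM 0 n w = 0"
  shows "finite {x. (case x of (p, q) \<Rightarrow> delta_coeff (c - q) b (a - p) *\<^sub>C
    YM (Y u (- p - 1) v) (- q - 1) w) \<noteq> 0}"
proof (rule finite_subset)
  show "{x. (case x of (p, q) \<Rightarrow> delta_coeff (c - q) b (a - p) *\<^sub>C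
      YM (Y u (- p - 1) v) (- q - 1) w) \<noteq> 0} \<subseteq> (\<lambda>p. (p, a + b + c + 1 - p)) ` {- K..a}"
  proof
    fix x assume x: "x \<in> {x. (case x of (p, q) \<Rightarrow> delta_coeff (c - q) b (a - p) *\<^sub>C
      YM (Y u (- p - 1) v) (- q - 1) w) \<noteq> 0}"
    obtain p q where pq: "x = (p, q)" by (cases x)
    have *: "delta_coeff (c - q) b (a - p) \<noteq> 0" "YM (Y u (- p - 1) v) (- q - 1) w \<noteq> 0"
      using x pq by auto
    then have "\<not> - p - 1 \<ge> K" using assms by auto
    then show "x \<in> (\<lambda>p. (p, a + b + c + 1 - p)) ` {- K..a}"
      using delta_coeff_nonzero[OF *(1)] unfolding pq by (intro image_eqI[of _ _ p]) auto
  qed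
qed simp

text \<open>Downward induction on \<open>q\<close>: once \<open>b\<close> is so negative that the second sum vanishes, the Jacobi
  identity expresses \<open>u\<^sub>p v\<^sub>q w\<close> through modes of the \<open>u\<^sub>m v\<close> and terms \<open>u\<^sub>p\<^sub>-\<^sub>i v\<^sub>q\<^sub>+\<^sub>i w\<close> with \<open>i > 0\<close>.\<close>
lemma weak_associativity:
  assumes jac: "jacobi_identity Y YM u v w"
    and u: "\<And>n. n \<ge> Ku \<Longrightarrow> YM u n w = 0" "\<And>n. YM u n 0 = 0"
    and v: "\<And>n. n \<ge> Kv \<Longrightarrow> YM v n w = 0" "\<And>n. YM v n 0 = 0"
  shows "YM u p (YM v q w) \<in> cvec.span {YM (Y u m v) n w | m n. True}"
proof -
  let ?X = "{YM (Y u m v) n w | m n. True}"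
  have "q \<ge> Kv - int d \<Longrightarrow> YM u p (YM v q w) \<in> cvec.span ?X" for d p q
  proof (induction d arbitrary: p q)
    case 0
    then show ?case using u(2) v(1) by (simp add: cvec.span_zero)
  next
    case (Suc d)
    \<comment> \<open>With this \<open>c\<close> the wanted term has z_2-exponent 0 in the delta
      series, hence coefficient 1. The choice of \<open>b\<close> lets the second sum meet only
      modes of \<open>u\<close> that kill \<open>w\<close>. The total degree -1 then forces
      \<open>a\<close>.\<close>
    define a b c where "a = Ku - 1 - p" and "b = - Ku - 1" and "c = - q - 1"
    define g where "g = (\<lambda>(p, q). delta_coeff a (b - p) (c - q) *\<^sub>C YM u (- p - 1) (YM v (- q - 1) w))"
    let ?x = "(- p - 1, - q - 1)"
    have gx: "g ?x = YM u p (YM v q w)"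
      by (simp add: g_def a_def b_def c_def delta_coeff_def)
    have fin: "finite {x. g x \<noteq> 0}" unfolding g_def by (rule jacobi_support_left[of Kv YM v w u, OF v(1) u(2)])
    have swapped: "((-1) powi (- a - 1) * delta_coeff a (c - q') (b - p')) *\<^sub>C
        YM v (- q' - 1) (YM u (- p' - 1) w) = 0" for p' q'
    proof (cases "delta_coeff a (c - q') (b - p') = 0")
      case False
      then have "- p' - 1 \<ge> Ku" using delta_coeff_nonzero b_def by fastforce
      then show ?thesis using u(1) v(2) by simp
    qed simp
    have "Sum_any g - 0 = Sum_any (\<lambda>(p, q). delta_coeff (c - q) b (a - p) *\<^sub>C YM (Y u (- p - 1) v) (- q - 1) w)"
      using jac[unfolded jacobi_identity_def, rule_format, of a b c] unfolding g_def swapped by simp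
    moreover have "\<dots> \<in> cvec.span ?X"
      by (rule Sum_any_in_span, unfold case_prod_beta', rule cvec.span_scale, rule cvec.span_base) blast
    ultimately have "Sum_any g \<in> cvec.span ?X" by simp
    moreover have "Sum_any g = (\<Sum>x\<in>insert ?x {x. g x \<noteq> 0}. g x)"
      using fin by (intro Sum_any.expand_superset) auto
    then have "Sum_any g = g ?x + (\<Sum>x\<in>{x. g x \<noteq> 0} - {?x}. g x)"
      using fin by (simp add: sum.insert_remove)
    moreover have "(\<Sum>x\<in>{x. g x \<noteq> 0} - {?x}. g x) \<in> cvec.span ?X"
    proof (rule cvec.span_sum)
      fix x assume x: "x \<in> {x. g x \<noteq> 0} - {?x}"
      obtain p' q' where x': "x = (p', q')" by (cases x)
      have nz: "delta_coeff a (b - p') (c - q') \<noteq> 0" using x x' by (auto simp: g_def)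
      have "c - q' \<noteq> 0"
      proof
        assume "c - q' = 0"
        then have "x = ?x" using delta_coeff_nonzero[OF nz] x' by (simp add: a_def b_def c_def)
        with x show False by blast
      qed
      \<comment> \<open>A positive exponent means that the mode of \<open>v\<close> has an index
        above q, within reach of the induction hypothesis.\<close>
      then have "- q' - 1 \<ge> Kv - int d"
        using delta_coeff_nonzero[OF nz] Suc.prems unfolding c_def by linarith
      then show "g x \<in> cvec.span ?X"
        using Suc.IH unfolding x' g_def by (auto intro: cvec.span_scale)
    qed
    ultimately have "g ?x \<in> cvec.span ?X"
      using cvec.span_diff[of "Sum_any g" ?X "\<Sum>x\<in>{x. g x \<noteq> 0} - {?x}. g x"] by simp
    then show ?case by (simp add: gx)
  qed
  from this[of "nat (Kv - q)"] show ?thesis by simp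
qed

context va_module
begin

text \<open>On a finite spanning set of the values one truncation bound serves for all vectors; for
  arbitrary functions a uniform bound need not exist.\<close>

lemma hom_modes_truncation:
  assumes u: "u \<in> A" and F: "finite F" "F \<subseteq> N" "\<And>t. f t \<in> cvec.span F"
  shows "\<exists>K. \<forall>n\<ge>K. hom_modes YM u n f = 0"
proof -
  have "\<exists>K. \<forall>n\<ge>K. \<forall>w\<in>F. YM u n w = 0"
    using F(1,2)
  proof induction
    case (insert w F)
    then obtain K K' where "\<forall>n\<ge>K. \<forall>w\<in>F. YM u n w = 0" "\<forall>n\<ge>K'. YM u n w = 0"
      using YM_truncation[OF u, of w] by auto
    then show ?case by (intro exI[of _ "max K K'"]) auto
  qed simp
  then obtain K where K: "\<And>n w. n \<ge> K \<Longrightarrow> w \<in> F \<Longrightarrow> YM u n w = 0" by blast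
  have "YM u n (f t) = 0" if "n \<ge> K" for n t
    by (rule linear_on_eq_span[OF YM_linear_right[OF u] _ mod_subspace F(2) K[OF that] F(3)])
      (simp_all add: linear_on_def)
  then show ?thesis by (intro exI[of _ K]) (auto simp: hom_modes_def fun_eq_iff)
qed

text \<open>The identity holds at each point, and uniform truncation makes the three families
  finitely supported as families of functions, so the pointwise sums assemble.\<close>

lemma hom_modes_jacobi:
  fixes f :: "'x \<Rightarrow> 'm"
  assumes u: "u \<in> A" and v: "v \<in> A" and F: "finite F" "F \<subseteq> N" "\<And>t. f t \<in> cvec.span F"
  shows "jacobi_identity Y (hom_modes YM) u v f"
proof -
  have fN: "f t \<in> N" for t using cvec.span_minimal[OF F(2) mod_subspace] F(3) by blast
  obtain Ku where "\<forall>n\<ge>Ku. hom_modes YM u n f = 0" using hom_modes_truncation[OF u F] ..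
  then have Ku: "\<And>n. n \<ge> Ku \<Longrightarrow> hom_modes YM u n f = 0" by simp
  obtain Kv where "\<forall>n\<ge>Kv. hom_modes YM v n f = 0" using hom_modes_truncation[OF v F] ..
  then have Kv: "\<And>n. n \<ge> Kv \<Longrightarrow> hom_modes YM v n f = 0" by simp
  obtain K where K: "\<And>n. n \<ge> K \<Longrightarrow> Y u n v = 0" using Y_truncation[OF u v] by blast
  have zu: "hom_modes YM u n (0 :: 'x \<Rightarrow> 'm) = 0" for n using YM_zero[OF u] by (auto simp: hom_modes_def fun_eq_iff)
  have zv: "hom_modes YM v n (0 :: 'x \<Rightarrow> 'm) = 0" for n using YM_zero[OF v] by (auto simp: hom_modes_def fun_eq_iff)
  have z: "hom_modes YM 0 n f = 0" for n using YM_zero_left[OF fN] by (auto simp: hom_modes_def fun_eq_iff)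
  note S1 = jacobi_support_left[of Kv "hom_modes YM" v f u, OF Kv zu]
  note S2 = jacobi_support_swapped[of Ku "hom_modes YM" u f v, OF Ku zv]
  note S3 = jacobi_support_right[of K Y u v "hom_modes YM" f, OF K z]
  note J = YM_jacobi[OF u v fN, unfolded jacobi_identity_def, rule_format]
  show ?thesis
    unfolding jacobi_identity_def
  proof (intro allI ext)
    fix a b c t
    define G1 where "G1 = (\<lambda>(p, q). delta_coeff a (b - p) (c - q) *\<^sub>C
      hom_modes YM u (- p - 1) (hom_modes YM v (- q - 1) f))"
    define G2 where "G2 = (\<lambda>(p, q). ((-1) powi (- a - 1) * delta_coeff a (c - q) (b - p)) *\<^sub>C
      hom_modes YM v (- q - 1) (hom_modes YM u (- p - 1) f))"
    define G3 where "G3 = (\<lambda>(p, q). delta_coeff (c - q) b (a - p) *\<^sub>C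
      hom_modes YM (Y u (- p - 1) v) (- q - 1) f)"
    have fin1: "finite {x. G1 x \<noteq> 0}" unfolding G1_def by (rule S1)
    have fin2: "finite {x. G2 x \<noteq> 0}" unfolding G2_def by (rule S2)
    have fin3: "finite {x. G3 x \<noteq> 0}" unfolding G3_def by (rule S3)
    have "Sum_any (\<lambda>x. G1 x t) - Sum_any (\<lambda>x. G2 x t) = Sum_any (\<lambda>x. G3 x t)"
      using J[where t = t and a = a and b = b and c = c]
      by (simp add: G1_def G2_def G3_def case_prod_beta' hom_modes_def scaleC_fun_def)
    then have "(Sum_any G1 - Sum_any G2) t = Sum_any G3 t"
      by (simp add: Sum_any_fun_apply fin1 fin2 fin3)
    then show "(Sum_any (\<lambda>(p, q). delta_coeff a (b - p) (c - q) *\<^sub>C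
          hom_modes YM u (- p - 1) (hom_modes YM v (- q - 1) f))
        - Sum_any (\<lambda>(p, q). ((-1) powi (- a - 1) * delta_coeff a (c - q) (b - p)) *\<^sub>C
          hom_modes YM v (- q - 1) (hom_modes YM u (- p - 1) f))) t
        = Sum_any (\<lambda>(p, q). delta_coeff (c - q) b (a - p) *\<^sub>C
          hom_modes YM (Y u (- p - 1) v) (- q - 1) f) t"
      unfolding G1_def G2_def G3_def .
  qed
qed

end

section \<open>Density of the modes\<close>

text \<open>Single modes only, no products: every element then comes from a symbol, a finite sum of
  vectors of \<open>A\<close> tagged with integers.\<close>

definition mode_span :: "'v set \<Rightarrow> ('v \<Rightarrow> int \<Rightarrow> 'm::complex_vector \<Rightarrow> 'm) \<Rightarrow> ('m \<Rightarrow> 'm) set"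
  where "mode_span A YM = cvec.span {YM v n | v n. v \<in> A}"

lemma mode_span_base: "v \<in> A \<Longrightarrow> YM v n \<in> mode_span A YM"
  unfolding mode_span_def by (rule cvec.span_base) blast

lemma mode_span_add: "x \<in> mode_span A YM \<Longrightarrow> y \<in> mode_span A YM \<Longrightarrow> x + y \<in> mode_span A YM"
  unfolding mode_span_def by (rule cvec.span_add)

lemma mode_span_scale: "x \<in> mode_span A YM \<Longrightarrow> c *\<^sub>C x \<in> mode_span A YM"
  unfolding mode_span_def by (rule cvec.span_scale)

lemma mode_span_zero: "0 \<in> mode_span A YM"
  unfolding mode_span_def by (rule cvec.span_zero)

lemma mode_span_induct [consumes 1, case_names zero step]:
  assumes "x \<in> mode_span A YM" "P 0"
    "\<And>c v n y. v \<in> A \<Longrightarrow> y \<in> mode_span A YM \<Longrightarrow> P y \<Longrightarrow> P (c *\<^sub>C YM v n + y)"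
  shows "P x"
proof -
  have "x \<in> mode_span A YM \<and> P x"
    using assms(1) unfolding mode_span_def
  proof (induction rule: cvec.span_induct_alt)
    case base
    then show ?case using assms(2) cvec.span_zero by blast
  next
    case (step c b y)
    then obtain v n where "b = YM v n" "v \<in> A" by blast
    moreover have "y \<in> mode_span A YM" "P y" using step(2) by (auto simp: mode_span_def)
    moreover have "c *\<^sub>C YM v n + y \<in> mode_span A YM"
      using calculation mode_span_add mode_span_scale mode_span_base by metis
    ultimately show ?case
      using assms(3)[of v y c n] unfolding mode_span_def by blast
  qed
  then show ?thesis by simp
qed

locale full_va_module = va_module UNIV vac Y UNIV YM
  for vac :: "'v::complex_vector" and Y :: "'v \<Rightarrow> int \<Rightarrow> 'v \<Rightarrow> 'v"
    and YM :: "'v \<Rightarrow> int \<Rightarrow> 'm::complex_vector \<Rightarrow> 'm"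
begin

lemma mode_clinear: "clinear (YM v n)"
  using YM_linear_right[of v n] by (simp add: linear_on_UNIV_iff)

lemma mode_span_clinear: "x \<in> mode_span UNIV YM \<Longrightarrow> clinear x"
proof (induction rule: mode_span_induct)
  case zero
  show ?case by (rule clinearI) auto
next
  case (step c v n y)
  then show ?case
    by (intro clinearI) (simp_all add: scaleC_fun_def clinear_add[OF mode_clinear]
        clinear_scale[OF mode_clinear] clinear_add clinear_scale cvec.scale_right_distrib mult.commute)
qed

text \<open>The set \<open>F\<close> becomes the single vector \<open>f\<close>, the identity on
  \<open>F\<close> and 0 elsewhere. Weak associativity for \<open>f\<close> in the function space
  gives one combination valid at all points of \<open>F\<close>.\<close>

lemma mode_mode_in_mode_span:
  assumes F: "finite F"
  shows "\<exists>z\<in>mode_span UNIV YM. \<forall>w\<in>F. YM u p (YM v q w) = z w"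
proof -
  define f where "f w = (if w \<in> F then w else 0)" for w
  have f: "f w \<in> cvec.span F" for w by (simp add: f_def cvec.span_base cvec.span_zero)
  obtain Ku where "\<forall>n\<ge>Ku. hom_modes YM u n f = 0"
    using hom_modes_truncation[OF UNIV_I F subset_UNIV f] ..
  then have Ku: "\<And>n. n \<ge> Ku \<Longrightarrow> hom_modes YM u n f = 0" by simp
  obtain Kv where "\<forall>n\<ge>Kv. hom_modes YM v n f = 0"
    using hom_modes_truncation[OF UNIV_I F subset_UNIV f] ..
  then have Kv: "\<And>n. n \<ge> Kv \<Longrightarrow> hom_modes YM v n f = 0" by simp
  have z: "hom_modes YM x n (0 :: 'm \<Rightarrow> 'm) = 0" for x n
    using clinear_zero[OF mode_clinear] by (auto simp: hom_modes_def fun_eq_iff)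
  have "jacobi_identity Y (hom_modes YM) u v f"
    using hom_modes_jacobi[of u v F f] F f by simp
  then have "hom_modes YM u p (hom_modes YM v q f) \<in> cvec.span {hom_modes YM (Y u m v) n f | m n. True}"
    using Ku z Kv z by (rule weak_associativity)
  moreover have "\<exists>z\<in>mode_span UNIV YM. \<forall>w. g w = z (f w)"
    if "g \<in> cvec.span {hom_modes YM (Y u m v) n f | m n. True}" for g
    using that
  proof (induction rule: cvec.span_induct_alt)
    case base
    show ?case by (rule bexI[OF _ mode_span_zero]) simp
  next
    case (step c b y)
    obtain m n where b: "b = hom_modes YM (Y u m v) n f" using step(1) by blast
    obtain z where z: "z \<in> mode_span UNIV YM" "\<forall>w. y w = z (f w)" using step(2) by blast
    have "c *\<^sub>C YM (Y u m v) n + z \<in> mode_span UNIV YM"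
      by (intro mode_span_add mode_span_scale mode_span_base z(1)) simp
    then show ?case by (rule bexI[rotated]) (simp add: b z(2) hom_modes_def scaleC_fun_def)
  qed
  ultimately obtain z where z: "z \<in> mode_span UNIV YM"
    "\<And>w. hom_modes YM u p (hom_modes YM v q f) w = z (f w)" by blast
  have "YM u p (YM v q w) = z w" if "w \<in> F" for w
    using z(2)[of w] that by (simp add: hom_modes_def f_def)
  with z(1) show ?thesis by blast
qed

lemma mode_span_comp:
  assumes x: "x \<in> mode_span UNIV YM" and y: "y \<in> mode_span UNIV YM" and F: "finite F"
  shows "\<exists>z\<in>mode_span UNIV YM. \<forall>w\<in>F. x (y w) = z w"
  using x
proof (induction rule: mode_span_induct)
  case zero
  show ?case by (rule bexI[OF _ mode_span_zero]) simp
next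
  case (step c u p x)
  obtain z where z: "z \<in> mode_span UNIV YM" "\<forall>w\<in>F. x (y w) = z w" using step by blast
  have "\<exists>z\<in>mode_span UNIV YM. \<forall>w\<in>F. YM u p (y w) = z w"
    using y
  proof (induction rule: mode_span_induct)
    case zero
    show ?case by (rule bexI[OF _ mode_span_zero]) (simp add: clinear_zero[OF mode_clinear])
  next
    case (step c v q y)
    obtain z where z: "z \<in> mode_span UNIV YM" "\<forall>w\<in>F. YM u p (y w) = z w" using step by blast
    obtain z' where z': "z' \<in> mode_span UNIV YM" "\<forall>w\<in>F. YM u p (YM v q w) = z' w"
      using mode_mode_in_mode_span[OF F] by blast
    have "c *\<^sub>C z' + z \<in> mode_span UNIV YM"
      by (intro mode_span_add mode_span_scale z(1) z'(1))
    then show ?case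
      by (rule bexI[rotated])
        (simp add: z(2) z'(2) scaleC_fun_def clinear_add[OF mode_clinear] clinear_scale[OF mode_clinear])
  qed
  then obtain z' where z': "z' \<in> mode_span UNIV YM" "\<forall>w\<in>F. YM u p (y w) = z' w" by blast
  have "c *\<^sub>C z' + z \<in> mode_span UNIV YM"
    by (intro mode_span_add mode_span_scale z(1) z'(1))
  then show ?case by (rule bexI[rotated]) (simp add: z(2) z'(2) scaleC_fun_def)
qed

text \<open>By composition on the set \<open>{s}\<close>, the values at \<open>s\<close> form a
  V-submodule, and it contains \<open>s\<close> because the mode -1 of the vacuum is the
  identity.\<close>

lemma mode_span_transitive:
  assumes irr: "irreducible_va_module UNIV vac Y UNIV YM" and "s \<noteq> 0"
  shows "\<exists>z\<in>mode_span UNIV YM. z s = m"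
proof -
  let ?S = "(\<lambda>z. z s) ` mode_span UNIV YM"
  have "cvec.subspace ?S"
  proof (rule cvec.subspaceI)
    show "0 \<in> ?S" by (rule image_eqI[OF _ mode_span_zero]) simp
    show "a + b \<in> ?S" if ab: "a \<in> ?S" "b \<in> ?S" for a b
    proof -
      obtain x y where "x \<in> mode_span UNIV YM" "y \<in> mode_span UNIV YM" "a = x s" "b = y s" using ab by blast
      then show ?thesis by (intro image_eqI[of _ _ "x + y"] mode_span_add) auto
    qed
    show "c *\<^sub>C a \<in> ?S" if a: "a \<in> ?S" for c a
    proof -
      obtain x where "x \<in> mode_span UNIV YM" "a = x s" using a by blast
      then show ?thesis by (intro image_eqI[of _ _ "c *\<^sub>C x"] mode_span_scale) (auto simp: scaleC_fun_def)
    qed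
  qed
  moreover have "YM u n w \<in> ?S" if w: "w \<in> ?S" for u n w
  proof -
    obtain x where x: "x \<in> mode_span UNIV YM" "w = x s" using w by blast
    obtain z where "z \<in> mode_span UNIV YM" "YM u n (x s) = z s"
      using mode_span_comp[OF mode_span_base[of u UNIV YM n] x(1), of "{s}"] by auto
    then show ?thesis using x(2) by blast
  qed
  ultimately have "?S = {0} \<or> ?S = UNIV" using irr unfolding irreducible_va_module_def by blast
  moreover have "s \<in> ?S"
    using mode_span_base[of vac UNIV YM "-1"] by (intro image_eqI[of _ _ "YM vac (-1)"]) (simp_all add: YM_vacuum)
  ultimately have "?S = UNIV" using \<open>s \<noteq> 0\<close> by blast
  then show ?thesis by (metis (mono_tags, lifting) UNIV_I imageE)
qed

text \<open>A nonzero \<open>s\<close> reaches every vector by a combination of modes, so the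
  countably many b_n s, with b in a basis of V and n an integer, span M.\<close>

lemma countably_generated:
  assumes irr: "irreducible_va_module UNIV vac Y UNIV YM" and V: "countable_dim (UNIV :: 'v set)"
  shows "\<exists>C. countable C \<and> (UNIV :: 'm set) \<subseteq> cvec.span C"
proof -
  obtain B :: "'v set" where B: "countable B" "cvec.span B = UNIV" using V by (auto simp: countable_dim_def)
  obtain s :: 'm where s: "s \<noteq> 0" using irr unfolding irreducible_va_module_def by blast
  let ?C = "(\<lambda>(b, n). YM b n s) ` (B \<times> UNIV)"
  have base: "YM u n s \<in> cvec.span ?C" for u n
  proof -
    have "u \<in> cvec.span B" using B(2) by simp
    then show ?thesis
    proof (induction rule: cvec.span_induct_alt)
      case base
      then show ?case by (simp add: YM_zero_left cvec.span_zero)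
    next
      case (step c b y)
      then have "YM b n s \<in> cvec.span ?C" by (intro cvec.span_base) auto
      with step show ?case
        by (simp add: YM_add_left YM_scale_left cvec.span_add cvec.span_scale)
    qed
  qed
  have "z s \<in> cvec.span ?C" if "z \<in> mode_span UNIV YM" for z
    using that by (induction rule: mode_span_induct)
      (auto simp: scaleC_fun_def base cvec.span_zero intro!: cvec.span_add cvec.span_scale)
  then have "UNIV \<subseteq> cvec.span ?C"
    using mode_span_transitive[OF irr s] by (metis subsetI)
  moreover have "countable ?C" using B(1) by simp
  ultimately show ?thesis by blast
qed

text \<open>The density theorem applies to the operators that agree with elements of \<open>mode_span\<close> on every
  finite set; unlike \<open>mode_span\<close> itself, they are closed under composition.\<close>
lemma mode_density:
  assumes irr: "irreducible_va_module UNIV vac Y UNIV YM" and V: "countable_dim (UNIV :: 'v set)"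
    and B: "finite B" "cvec.independent B"
  shows "\<exists>x\<in>mode_span UNIV YM. \<forall>b\<in>B. x b = g b"
proof -
  let ?A = "{a. clinear a \<and> (\<forall>F. finite F \<longrightarrow> (\<exists>x\<in>mode_span UNIV YM. \<forall>w\<in>F. a w = x w))}"
  have sub: "mode_span UNIV YM \<subseteq> ?A" using mode_span_clinear by auto
  have loc: "\<exists>x\<in>mode_span UNIV YM. \<forall>w\<in>F. a w = x w" if "a \<in> ?A" "finite F" for a F
    using that by simp
  interpret transitive_operators UNIV ?A
  proof
    show "\<exists>c\<in>?A. \<forall>x\<in>UNIV. c x = a x + b x" if ab: "a \<in> ?A" "b \<in> ?A" for a b
    proof (rule bexI[of _ "\<lambda>w. a w + b w"], simp, intro CollectI conjI allI impI)
      show "clinear (\<lambda>w. a w + b w)"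
        using ab by (intro clinearI) (simp_all add: clinear_add clinear_scale cvec.scale_right_distrib)
      fix F :: "'m set" assume F: "finite F"
      obtain x where x: "x \<in> mode_span UNIV YM" "\<forall>w\<in>F. a w = x w" using loc[OF ab(1) F] by (rule bexE)
      obtain y where y: "y \<in> mode_span UNIV YM" "\<forall>w\<in>F. b w = y w" using loc[OF ab(2) F] by (rule bexE)
      show "\<exists>z\<in>mode_span UNIV YM. \<forall>w\<in>F. a w + b w = z w"
        by (rule bexI[OF _ mode_span_add[OF x(1) y(1)]]) (simp add: x(2) y(2))
    qed
    show "\<exists>c\<in>?A. \<forall>x\<in>UNIV. c x = r *\<^sub>C a x" if a: "a \<in> ?A" for a r
    proof (rule bexI[of _ "\<lambda>w. r *\<^sub>C a w"], simp, intro CollectI conjI allI impI)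
      show "clinear (\<lambda>w. r *\<^sub>C a w)"
        using a by (intro clinearI) (simp_all add: clinear_add clinear_scale cvec.scale_right_distrib mult.commute)
      fix F :: "'m set" assume F: "finite F"
      obtain x where x: "x \<in> mode_span UNIV YM" "\<forall>w\<in>F. a w = x w" using loc[OF a F] by (rule bexE)
      show "\<exists>z\<in>mode_span UNIV YM. \<forall>w\<in>F. r *\<^sub>C a w = z w"
        by (rule bexI[OF _ mode_span_scale[where c = r, OF x(1)]]) (simp add: x(2) scaleC_fun_def)
    qed
    show "\<exists>c\<in>?A. \<forall>x\<in>UNIV. c x = a (b x)" if ab: "a \<in> ?A" "b \<in> ?A" for a b
    proof (rule bexI[of _ "\<lambda>w. a (b w)"], simp, intro CollectI conjI allI impI)
      show "clinear (\<lambda>w. a (b w))"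
        using ab by (intro clinearI) (simp_all add: clinear_add clinear_scale)
      fix F :: "'m set" assume F: "finite F"
      then obtain y where y: "y \<in> mode_span UNIV YM" "\<forall>w\<in>F. b w = y w" using ab(2) by blast
      \<comment> \<open>\<open>a\<close> has to be approximated on the image of \<open>F\<close>
        under \<open>b\<close>; the product of the two combinations is then reduced to one on
        \<open>F\<close>.\<close>
      obtain x where x: "x \<in> mode_span UNIV YM" "\<forall>w\<in>b ` F. a w = x w"
        using ab(1) F finite_imageI by blast
      obtain z where "z \<in> mode_span UNIV YM" "\<forall>w\<in>F. x (y w) = z w" using mode_span_comp[OF x(1) y(1) F] by blast
      then show "\<exists>z\<in>mode_span UNIV YM. \<forall>w\<in>F. a (b w) = z w"
        using x(2) y(2) by (intro bexI[of _ z]) auto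
    qed
    show "\<exists>a\<in>?A. a s = m" if "s \<noteq> 0" for s m
      using mode_span_transitive[OF irr that] sub by blast
    show "?A \<noteq> {}" using mode_span_zero sub by blast
    show "\<exists>C. countable C \<and> (UNIV :: 'm set) \<subseteq> cvec.span C" by (rule countably_generated[OF irr V])
    show "linear_on UNIV a" if "a \<in> ?A" for a using that by (simp add: linear_on_UNIV_iff)
  qed auto
  obtain a where a: "a \<in> ?A" "\<forall>b\<in>B. a b = g b" using density[OF B(1) _ B(2), of g] by auto
  obtain x where x: "x \<in> mode_span UNIV YM" "\<forall>b\<in>B. a b = x b" using loc[OF a(1) B(1)] by (rule bexE)
  have "\<forall>b\<in>B. x b = g b" using a(2) x(2) by simp
  then show ?thesis by (rule bexI[OF _ x(1)])
qed

end

lemma internal_direct_sum_decompose: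
  assumes "internal_direct_sum U \<U>" "u \<in> U"
  obtains f where "\<And>S. S \<in> Poly_Mapping.keys f \<Longrightarrow> S \<in> \<U>"
    "\<And>S. S \<in> Poly_Mapping.keys f \<Longrightarrow> Poly_Mapping.lookup f S \<in> S"
    "u = (\<Sum>S\<in>Poly_Mapping.keys f. Poly_Mapping.lookup f S)"
proof -
  have "u \<in> (\<lambda>f. \<Sum>S\<in>Poly_Mapping.keys f. Poly_Mapping.lookup f S) `
      {f. \<forall>S\<in>Poly_Mapping.keys f. S \<in> \<U> \<and> Poly_Mapping.lookup f S \<in> S}"
    using assms by (simp add: internal_direct_sum_def bij_betw_def)
  then show thesis using that by blast
qed

sublocale hopf_va_module \<subseteq> full_va_module vac Y YM
  by unfold_locales

context hopf_va_module
begin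

lemma mode_span_irreducible_modes:
  assumes ss: "internal_direct_sum UNIV \<U>" and x: "x \<in> mode_span UNIV YM"
  shows "x \<in> mode_span (\<Union>\<U>) YM"
  using x
proof (induction rule: mode_span_induct)
  case zero
  show ?case by (rule mode_span_zero)
next
  case (step c v n y)
  obtain f where f: "\<And>S. S \<in> Poly_Mapping.keys f \<Longrightarrow> S \<in> \<U>"
    "\<And>S. S \<in> Poly_Mapping.keys f \<Longrightarrow> Poly_Mapping.lookup f S \<in> S"
    "v = (\<Sum>S\<in>Poly_Mapping.keys f. Poly_Mapping.lookup f S)"
    using internal_direct_sum_decompose[OF ss UNIV_I] by blast
  have "YM v n = (\<Sum>S\<in>Poly_Mapping.keys f. YM (Poly_Mapping.lookup f S) n)"
  proof
    fix w
    have "clinear (\<lambda>v. YM v n w)" using YM_linear_left[of w n] by (simp add: linear_on_UNIV_iff)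
    then show "YM v n w = (\<Sum>S\<in>Poly_Mapping.keys f. YM (Poly_Mapping.lookup f S) n) w"
      unfolding f(3) sum_fun_apply by (rule clinear_sum)
  qed
  moreover have "(\<Sum>S\<in>Poly_Mapping.keys f. YM (Poly_Mapping.lookup f S) n) \<in> mode_span (\<Union>\<U>) YM"
    unfolding mode_span_def by (rule cvec.span_sum, rule cvec.span_base) (use f(1,2) in blast)
  ultimately have "YM v n \<in> mode_span (\<Union>\<U>) YM" by simp
  then show ?case by (intro mode_span_add mode_span_scale step(3))
qed

text \<open>Symbols are first moved into the simple summands of V, with scalars absorbed, which is
  the form that \<open>invariant_modes\<close> requires.\<close>

lemma invariant_mode_span:
  assumes ss: "sum_of_fd_irreducibles UNIV act" and x: "x \<in> mode_span UNIV YM"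
    and comm: "\<And>w h. w \<in> U \<Longrightarrow> x (actM h w) = actM h (x w)"
    and U: "\<And>w h. w \<in> U \<Longrightarrow> actM h w \<in> U"
  shows "\<exists>y\<in>mode_span (invariants \<epsilon> act) YM. \<forall>w\<in>U. y w = x w"
proof -
  obtain \<U> where \<U>: "internal_direct_sum UNIV \<U>" "\<And>S. S \<in> \<U> \<Longrightarrow> irreducible_alg_module S act"
    using ss unfolding sum_of_fd_irreducibles_def by blast
  obtain J r where J: "finite J" "J \<subseteq> {YM v n | v n. v \<in> \<Union>\<U>}" "x = (\<Sum>a\<in>J. r a *\<^sub>C a)"
    using mode_span_irreducible_modes[OF \<U>(1) x] unfolding mode_span_def cvec.span_explicit by blast
  have "\<forall>a\<in>J. \<exists>v n S. a = YM v n \<and> S \<in> \<U> \<and> v \<in> S" using J(2) by blast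
  then obtain v n S where vnS: "\<And>a. a \<in> J \<Longrightarrow> a = YM (v a) (n a) \<and> S a \<in> \<U> \<and> v a \<in> S a" by metis
  define s where "s a = r a *\<^sub>C v a" for a
  have xs: "x w = (\<Sum>a\<in>J. YM (s a) (n a) w)" for w
  proof -
    have "x w = (\<Sum>a\<in>J. r a *\<^sub>C a w)" by (simp add: J(3) sum_fun_apply scaleC_fun_def)
    also have "\<dots> = (\<Sum>a\<in>J. YM (s a) (n a) w)"
      by (rule sum.cong[OF refl]) (use vnS in \<open>metis YM_simps(2) s_def\<close>)
    finally show ?thesis .
  qed
  have "irreducible_alg_module (S a) act \<and> s a \<in> S a" if "a \<in> J" for a
    using vnS[OF that] \<U>(2)[of "S a"] unfolding s_def
    by (metis alg_module.subspace cvec.subspace_scale irreducible_alg_module_module)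
  moreover have "(\<Sum>a\<in>J. YM (s a) (n a) (actM h w)) = actM h (\<Sum>a\<in>J. YM (s a) (n a) w)"
    if "w \<in> U" for w h using comm[OF that] by (simp add: xs)
  ultimately show ?thesis
    unfolding mode_span_def xs using U by (intro invariant_modes[OF J(1)]) auto
qed

end

section \<open>Invariants and multiplicity spaces\<close>

lemma va_module_restrict:
  assumes "va_module UNIV vac Y UNIV YM" "vertex_algebra A vac Y"
  shows "va_module A vac Y UNIV YM"
proof -
  interpret M: va_module UNIV vac Y UNIV YM by (rule assms(1))
  interpret A: vertex_algebra A vac Y by (rule assms(2))
  show ?thesis
  proof
    show "linear_on A (\<lambda>u. YM u n w)" for w n
      by (rule linear_on_subset[OF M.YM_linear_left]) auto
  qed (auto simp: M.YM_linear_right M.YM_truncation M.YM_vacuum M.YM_jacobi)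
qed

context module_vertex_algebra
begin

text \<open>With V as a Hopf module over itself, commutation of invariant modes with H also shows
  that u_n v is invariant when u and v are.\<close>

lemma self_module: "hopf_va_module \<Delta> \<epsilon> antipode vac Y act Y act"
  by unfold_locales
    (simp_all add: Y_linear_left Y_linear_right Y_truncation Y_vacuum Y_jacobi act_Y)

lemma invariants_vertex_algebra: "vertex_algebra (invariants \<epsilon> act) vac Y"
proof
  interpret self: hopf_va_module \<Delta> \<epsilon> antipode vac Y act Y act by (rule self_module)
  show "cvec.subspace (invariants \<epsilon> act)"
    by (rule cvec.subspaceI)
      (auto simp: invariants_def H.act_add H.act_scale cvec.scale_right_distrib mult.commute)
  show "vac \<in> invariants \<epsilon> act" by (simp add: invariants_def act_vac)
  show "Y u n v \<in> invariants \<epsilon> act" if "u \<in> invariants \<epsilon> act" "v \<in> invariants \<epsilon> act" for u n v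
  proof -
    have "act h v = \<epsilon> h *\<^sub>C v" for h using that(2) by (simp add: invariants_def)
    then show ?thesis
      using self.invariant_mode_commute[OF that(1)] self.YM_scale by (simp add: invariants_def)
  qed
  show "linear_on (invariants \<epsilon> act) (\<lambda>u. Y u n v)" for n v
    by (rule linear_on_subset[OF Y_linear_left]) auto
  show "linear_on (invariants \<epsilon> act) (Y u n)" for u n
    by (rule linear_on_subset[OF Y_linear_right]) auto
qed (auto simp: Y_truncation Y_vacuum Y_creation Y_jacobi)

end

lemma hom_spaceD:
  assumes "f \<in> hom_space U \<rho> N actN"
  shows "linear_on U f" "x \<in> U \<Longrightarrow> f x \<in> N" "x \<in> U \<Longrightarrow> f (\<rho> h x) = actN h (f x)" "x \<notin> U \<Longrightarrow> f x = 0"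
  using assms by (auto simp: hom_space_def)

lemma linear_on_span_image:
  assumes "linear_on U f" "cvec.independent B" "cvec.span B = U" "x \<in> U"
  shows "f x \<in> cvec.span (f ` B)"
proof -
  have sub: "cvec.subspace U" using assms(3) by auto
  obtain g where g: "clinear g" "\<And>x. x \<in> U \<Longrightarrow> g x = f x" using linear_on_extend[OF assms(1) sub assms(2,3)] by blast
  have "g x = f x" if "x \<in> B" for x using g(2) assms(3) cvec.span_base[OF that] by blast
  then have "f ` B = g ` B" by simp
  then show ?thesis using cpair.linear_span_image[OF g(1), of B] assms(3,4) g(2) by (metis imageI)
qed

context hopf_va_module
begin

abbreviation "multiplicity_space U \<rho> \<equiv> hom_space U \<rho> UNIV actM"

lemma subspace_multiplicity_space:
  assumes "alg_module U \<rho>"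
  shows "cvec.subspace (multiplicity_space U \<rho>)"
proof (rule cvec.subspaceI)
  show "0 \<in> multiplicity_space U \<rho>"
    by (auto simp: hom_space_def linear_on_def)
  show "f + g \<in> multiplicity_space U \<rho>" if "f \<in> multiplicity_space U \<rho>" "g \<in> multiplicity_space U \<rho>" for f g
    using that by (auto simp: hom_space_def linear_on_def HM.act_add cvec.scale_right_distrib)
  show "c *\<^sub>C f \<in> multiplicity_space U \<rho>" if "f \<in> multiplicity_space U \<rho>" for c f
    using that by (auto simp: hom_space_def linear_on_def scaleC_fun_def HM.act_scale cvec.scale_right_distrib mult.commute)
qed

text \<open>Here the finite dimension of \<open>U\<close> enters: an H-map has its values in the
  span of the images of a finite basis, so uniform truncation and the lifted Jacobi identity
  apply.\<close>

lemma multiplicity_space_module: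
  assumes U: "alg_module U \<rho>" "finite_dim U"
  shows "va_module (invariants \<epsilon> act) vac Y (multiplicity_space U \<rho>) (hom_modes YM)"
proof -
  interpret I: vertex_algebra "invariants \<epsilon> act" vac Y by (rule invariants_vertex_algebra)
  obtain B where B: "cvec.independent B" "cvec.span B = U" "finite B" using U(2) by (auto simp: finite_dim_def)
  have range: "f t \<in> cvec.span (f ` B)" if "f \<in> multiplicity_space U \<rho>" for f t
    using linear_on_span_image[OF hom_spaceD(1)[OF that] B(1,2), of t] hom_spaceD(4)[OF that, of t]
    by (cases "t \<in> U") (auto simp: cvec.span_zero)
  show ?thesis
  proof
    show "cvec.subspace (multiplicity_space U \<rho>)" by (rule subspace_multiplicity_space[OF U(1)])
    show "hom_modes YM u n f \<in> multiplicity_space U \<rho>"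
      if "u \<in> invariants \<epsilon> act" "f \<in> multiplicity_space U \<rho>" for u n f
      using hom_spaceD[OF that(2)] invariant_mode_commute[OF that(1)]
      by (auto simp: hom_space_def hom_modes_def linear_on_def YM_add YM_scale YM_zero)
    show "linear_on (invariants \<epsilon> act) (\<lambda>u. hom_modes YM u n f)" for n and f :: "'a \<Rightarrow> 'm"
      by (auto simp: linear_on_def hom_modes_def fun_eq_iff scaleC_fun_def YM_add_left YM_scale_left)
    show "linear_on (multiplicity_space U \<rho>) (hom_modes YM u n)" for u n
      by (auto simp: linear_on_def hom_modes_def fun_eq_iff scaleC_fun_def YM_add YM_scale)
    show "\<exists>K. \<forall>n\<ge>K. hom_modes YM u n f = 0" if "f \<in> multiplicity_space U \<rho>" for u f
      by (rule hom_modes_truncation[OF UNIV_I finite_imageI[OF B(3)] subset_UNIV range[OF that]])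
    show "hom_modes YM vac n f = (if n = - 1 then f else 0)" for n and f :: "'a \<Rightarrow> 'm"
      by (auto simp: hom_modes_def fun_eq_iff YM_vacuum)
    show "jacobi_identity Y (hom_modes YM) u v f" if "f \<in> multiplicity_space U \<rho>" for u v f
      by (rule hom_modes_jacobi[OF UNIV_I UNIV_I finite_imageI[OF B(3)] subset_UNIV range[OF that]])
  qed
qed

text \<open>Density realises \<open>T\<close> on the span of \<open>B\<close>, and commutation with
  H on \<open>U\<close> allows the symbol to be made invariant. The set \<open>U\<close> is kept
  apart from the span because it will also be a union of two submodules.\<close>

lemma invariant_mode_density:
  assumes irr: "irreducible_va_module UNIV vac Y UNIV YM" and V: "countable_dim (UNIV :: 'v set)"
    and ss: "sum_of_fd_irreducibles UNIV act"
    and B: "finite B" "cvec.independent B" and U: "\<And>w h. w \<in> U \<Longrightarrow> actM h w \<in> U" "U \<subseteq> cvec.span B"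
    and T: "linear_on (cvec.span B) T" "\<And>w h. w \<in> U \<Longrightarrow> T (actM h w) = actM h (T w)"
  shows "\<exists>y\<in>mode_span (invariants \<epsilon> act) YM. \<forall>w\<in>U. y w = T w"
proof -
  obtain x where x: "x \<in> mode_span UNIV YM" "\<forall>b\<in>B. x b = T b" using mode_density[OF irr V B, of T] by (rule bexE)
  have xT: "x w = T w" if "w \<in> cvec.span B" for w
    by (rule linear_on_eq_span[OF clinear_linear_on[OF mode_span_clinear[OF x(1)]] T(1) cvec.subspace_span
          cvec.span_superset _ that]) (use x(2) in auto)
  have "\<exists>y\<in>mode_span (invariants \<epsilon> act) YM. \<forall>w\<in>U. y w = x w"
    by (rule invariant_mode_span[OF ss x(1) _ U(1)]) (use xT U T(2) in \<open>auto simp: subset_iff\<close>)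
  then obtain y where y: "y \<in> mode_span (invariants \<epsilon> act) YM" "\<forall>w\<in>U. y w = x w" by (rule bexE)
  have "\<forall>w\<in>U. y w = T w" using y(2) xT U(2) by auto
  then show ?thesis by (rule bexI[OF _ y(1)])
qed

lemma multiplicity_space_inj:
  assumes U: "irreducible_alg_module U \<rho>" and f: "f \<in> multiplicity_space U \<rho>" "f \<noteq> 0"
  shows "inj_on f U"
proof -
  obtain z where z: "f z \<noteq> 0" using f(2) by (auto simp: fun_eq_iff)
  then have "z \<in> U" using hom_spaceD(4)[OF f(1)] by blast
  then show ?thesis
    using irreducible_hom_inj[OF U HM.alg_module_axioms hom_spaceD(1)[OF f(1)] _ hom_spaceD(3)[OF f(1)] _ z]
    by simp
qed

text \<open>As \<open>f\<close> is injective by Schur's lemma, \<open>g\<close> after the inverse of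
  \<open>f\<close> is an H-map on the finite-dimensional submodule f(U).\<close>

lemma multiplicity_space_transitive:
  assumes irr: "irreducible_va_module UNIV vac Y UNIV YM" and V: "countable_dim (UNIV :: 'v set)"
    and ss: "sum_of_fd_irreducibles UNIV act"
    and U: "irreducible_alg_module U \<rho>" "finite_dim U"
    and f: "f \<in> multiplicity_space U \<rho>" "f \<noteq> 0" and g: "g \<in> multiplicity_space U \<rho>"
  shows "\<exists>y\<in>mode_span (invariants \<epsilon> act) YM. \<forall>x\<in>U. y (f x) = g x"
proof -
  interpret U: alg_module U \<rho> by (rule irreducible_alg_module_module[OF U(1)])
  obtain B where B: "cvec.independent B" "cvec.span B = U" "finite B" using U(2) by (auto simp: finite_dim_def)
  note inj = multiplicity_space_inj[OF U(1) f]
  note fD = hom_spaceD[OF f(1)] and gD = hom_spaceD[OF g]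
  note fB = basis_image[OF fD(1) U.subspace inj B(1,2)]
  define T where "T y = g (inv_into U f y)" for y
  have T: "T (f x) = g x" if "x \<in> U" for x using inj that by (simp add: T_def)
  have "\<exists>y\<in>mode_span (invariants \<epsilon> act) YM. \<forall>w\<in>f ` U. y w = T w"
  proof (rule invariant_mode_density[OF irr V ss _ fB(1)])
    show "finite (f ` B)" using B(3) by simp
    show "actM h w \<in> f ` U" if "w \<in> f ` U" for w h using that fD(3)[symmetric] U.closed by auto
    show "f ` U \<subseteq> cvec.span (f ` B)" using fB(2) by simp
    show "linear_on (cvec.span (f ` B)) T"
      unfolding fB(2) linear_on_def
      by (auto simp: T linear_on_add[OF fD(1), symmetric] linear_on_scale[OF fD(1), symmetric]
          linear_on_add[OF gD(1)] linear_on_scale[OF gD(1)]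
          cvec.subspace_add[OF U.subspace] cvec.subspace_scale[OF U.subspace])
    show "T (actM h w) = actM h (T w)" if "w \<in> f ` U" for w h
      using that by (auto simp: T fD(3)[symmetric] gD(3)[symmetric] U.closed)
  qed
  then obtain y where "y \<in> mode_span (invariants \<epsilon> act) YM" "\<forall>w\<in>f ` U. y w = T w" by (rule bexE)
  then show ?thesis using T by (intro bexI[of _ y]) auto
qed

lemma multiplicity_space_irreducible:
  assumes irr: "irreducible_va_module UNIV vac Y UNIV YM" and V: "countable_dim (UNIV :: 'v set)"
    and ss: "sum_of_fd_irreducibles UNIV act"
    and U: "irreducible_alg_module U \<rho>" "finite_dim U" and nz: "multiplicity_space U \<rho> \<noteq> {0}"
  shows "irreducible_va_module (invariants \<epsilon> act) vac Y (multiplicity_space U \<rho>) (hom_modes YM)"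
  unfolding irreducible_va_module_def
proof (intro conjI allI impI)
  show "va_module (invariants \<epsilon> act) vac Y (multiplicity_space U \<rho>) (hom_modes YM)"
    by (rule multiplicity_space_module[OF irreducible_alg_module_module[OF U(1)] U(2)])
  show "multiplicity_space U \<rho> \<noteq> {0}" by (rule nz)
  fix S assume S: "cvec.subspace S" "S \<subseteq> multiplicity_space U \<rho>"
    "\<forall>u\<in>invariants \<epsilon> act. \<forall>n. \<forall>w\<in>S. hom_modes YM u n w \<in> S"
  show "S = {0} \<or> S = multiplicity_space U \<rho>"
  proof (rule disjCI)
    assume "S \<noteq> multiplicity_space U \<rho>"
    then obtain g where g: "g \<in> multiplicity_space U \<rho>" "g \<notin> S" using S(2) by blast
    have "f = 0" if f: "f \<in> S" for f
    proof (rule ccontr)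
      assume "f \<noteq> 0"
      have fU: "f \<in> multiplicity_space U \<rho>" using f S(2) by blast
      obtain y where y: "y \<in> mode_span (invariants \<epsilon> act) YM" "\<forall>x\<in>U. y (f x) = g x"
        using multiplicity_space_transitive[OF irr V ss U fU \<open>f \<noteq> 0\<close> g(1)] by (rule bexE)
      \<comment> \<open>\<open>y 0 = 0\<close> is carried along because \<open>f\<close> and
        \<open>g\<close> vanish outside \<open>U\<close>, where y f = \<open>g\<close> has to hold
        as well.\<close>
      have "(\<lambda>x. y (f x)) \<in> S \<and> y 0 = 0"
        using y(1)
      proof (induction rule: mode_span_induct)
        case zero
        then show ?case using cvec.subspace_0[OF S(1)] by (simp add: zero_fun_def)
      next
        case (step c v n y)
        have "hom_modes YM v n f \<in> S" using S(3) step(1) f by blast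
        then have "c *\<^sub>C hom_modes YM v n f + (\<lambda>x. y (f x)) \<in> S"
          using step(3) S(1) cvec.subspace_add cvec.subspace_scale by blast
        then show ?case using step(3) by (simp add: hom_modes_def scaleC_fun_def plus_fun_def YM_zero)
      qed
      moreover have "(\<lambda>x. y (f x)) = g"
        using y(2) hom_spaceD(4)[OF fU] hom_spaceD(4)[OF g(1)] calculation by (metis ext)
      ultimately show False using g(2) by simp
    qed
    then show "S = {0}" using cvec.subspace_0[OF S(1)] by blast
  qed
qed

text \<open>An element of H separating U from U' is realised by a combination y of invariant modes
  that is the identity on f(U) and 0 on g(U'), where g = \<phi>(f). Then g = \<phi>(y f) = y g = 0,
  a contradiction.\<close>

lemma multiplicity_spaces_not_iso:
  assumes irr: "irreducible_va_module UNIV vac Y UNIV YM" and V: "countable_dim (UNIV :: 'v set)"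
    and ss: "sum_of_fd_irreducibles UNIV act"
    and U: "irreducible_alg_module U \<rho>" "finite_dim U" and U': "irreducible_alg_module U' \<rho>'" "finite_dim U'"
    and noniso: "\<nexists>\<theta>. alg_module_iso U' \<rho>' U \<rho> \<theta>"
    and nz: "multiplicity_space U \<rho> \<noteq> {0}"
  shows "\<not> va_module_iso (invariants \<epsilon> act) vac Y (multiplicity_space U \<rho>) (hom_modes YM)
    (multiplicity_space U' \<rho>') (hom_modes YM) \<phi>"
proof
  assume "va_module_iso (invariants \<epsilon> act) vac Y (multiplicity_space U \<rho>) (hom_modes YM)
    (multiplicity_space U' \<rho>') (hom_modes YM) \<phi>"
  then have \<phi>: "linear_on (multiplicity_space U \<rho>) \<phi>"
    "bij_betw \<phi> (multiplicity_space U \<rho>) (multiplicity_space U' \<rho>')"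
    "\<And>u n w. u \<in> invariants \<epsilon> act \<Longrightarrow> w \<in> multiplicity_space U \<rho> \<Longrightarrow>
      \<phi> (hom_modes YM u n w) = hom_modes YM u n (\<phi> w)"
    by (auto simp: va_module_iso_def)
  interpret U: alg_module U \<rho> by (rule irreducible_alg_module_module[OF U(1)])
  interpret U': alg_module U' \<rho>' by (rule irreducible_alg_module_module[OF U'(1)])
  interpret F: va_module "invariants \<epsilon> act" vac Y "multiplicity_space U \<rho>" "hom_modes YM"
    by (rule multiplicity_space_module[OF U.alg_module_axioms U(2)])
  have \<phi>0: "\<phi> 0 = 0" by (rule linear_on_zero[OF \<phi>(1) F.mod_subspace])
  obtain f where f: "f \<in> multiplicity_space U \<rho>" "f \<noteq> 0"
    using nz cvec.subspace_0[OF F.mod_subspace] by blast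
  define g where "g = \<phi> f"
  have g: "g \<in> multiplicity_space U' \<rho>'" using \<phi>(2) f(1) by (auto simp: g_def bij_betw_def)
  have gnz: "g \<noteq> 0"
    using \<phi>(2) \<phi>0 f cvec.subspace_0[OF F.mod_subspace] unfolding g_def bij_betw_def inj_on_def by metis
  obtain B where B: "cvec.independent B" "cvec.span B = U" "finite B" using U(2) by (auto simp: finite_dim_def)
  obtain C where C: "cvec.independent C" "cvec.span C = U'" "finite C" using U'(2) by (auto simp: finite_dim_def)
  note finj = multiplicity_space_inj[OF U(1) f] and ginj = multiplicity_space_inj[OF U'(1) g gnz]
  note fD = hom_spaceD[OF f(1)] and gD = hom_spaceD[OF g]
  obtain h where h: "(\<forall>x\<in>U'. \<rho>' h x = 0) \<and> (\<forall>x\<in>U. \<rho> h x = x)"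
    using separating_element[OF U' U noniso] ..
  have hf: "actM h (f x) = f x" if "x \<in> U" for x using fD(3)[OF that, of h, symmetric] h that by simp
  have g0: "g 0 = 0" by (rule linear_on_zero[OF gD(1) U'.subspace])
  have hg: "actM h (g x) = 0" if "x \<in> U'" for x using gD(3)[OF that, of h, symmetric] h that g0 by simp
  have fB: "cvec.independent (f ` B)" "cvec.span (f ` B) = f ` U"
    by (rule basis_image[OF fD(1) U.subspace finj B(1,2)])+
  have gC: "cvec.independent (g ` C)" "cvec.span (g ` C) = g ` U'"
    by (rule basis_image[OF gD(1) U'.subspace ginj C(1,2)])+
  have T: "clinear (actM h)" using HM.linear_right[of h] by (simp add: linear_on_UNIV_iff)
  have BU: "b \<in> U" if "b \<in> B" for b using that B(2) cvec.span_base by blast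
  have CU: "c \<in> U'" if "c \<in> C" for c using that C(2) cvec.span_base by blast
  \<comment> \<open>A basis of the sum of f(U) and g(U') is extracted from a spanning set, which
    avoids showing that the sum is direct.\<close>
  obtain D where D: "D \<subseteq> f ` B \<union> g ` C" "cvec.independent D" "f ` B \<union> g ` C \<subseteq> cvec.span D"
    using cvec.maximal_independent_subset by blast
  have sub: "f ` U \<union> g ` U' \<subseteq> cvec.span D"
  proof -
    have "cvec.span (f ` B) \<subseteq> cvec.span D" "cvec.span (g ` C) \<subseteq> cvec.span D"
      using D(3) cvec.span_mono[of _ "cvec.span D"] cvec.span_span by (metis le_sup_iff)+
    then show ?thesis using fB(2) gC(2) by auto
  qed
  have "\<exists>y\<in>mode_span (invariants \<epsilon> act) YM. \<forall>w\<in>f ` U \<union> g ` U'. y w = actM h w"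
  proof (rule invariant_mode_density[OF irr V ss _ D(2)])
    show "finite D" using D(1) B(3) C(3) finite_subset by blast
    show "actM k w \<in> f ` U \<union> g ` U'" if "w \<in> f ` U \<union> g ` U'" for w k
      using that fD(3)[symmetric] gD(3)[symmetric] U.closed U'.closed by auto
    show "f ` U \<union> g ` U' \<subseteq> cvec.span D" by (rule sub)
    show "linear_on (cvec.span D) (actM h)" by (rule clinear_linear_on[OF T])
    \<comment> \<open>\<open>h\<close> need not be central: it acts as a scalar on each of the two
      H-stable pieces, so it commutes there with every \<open>k\<close>.\<close>
    show "actM h (actM k w) = actM k (actM h w)" if w: "w \<in> f ` U \<union> g ` U'" for w k
      using w
    proof
      assume "w \<in> f ` U"
      then obtain x where x: "x \<in> U" "w = f x" by blast
      then show ?thesis using hf[of "\<rho> k x"] hf[of x] fD(3)[of x k] U.closed by simp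
    next
      assume "w \<in> g ` U'"
      then obtain x where x: "x \<in> U'" "w = g x" by blast
      then show ?thesis using hg[of "\<rho>' k x"] hg[of x] gD(3)[of x k] U'.closed by simp
    qed
  qed
  then obtain y where y: "y \<in> mode_span (invariants \<epsilon> act) YM" "\<forall>w\<in>f ` U \<union> g ` U'. y w = actM h w"
    by (rule bexE)
  have "y 0 = 0 \<and> (\<lambda>x. y (f x)) \<in> multiplicity_space U \<rho> \<and> \<phi> (\<lambda>x. y (f x)) = (\<lambda>x. y (g x))"
    using y(1)
  proof (induction rule: mode_span_induct)
    case zero
    have "0 \<in> multiplicity_space U \<rho>" by (rule cvec.subspace_0[OF F.mod_subspace])
    then show ?case using \<phi>0 by (simp add: zero_fun_def)
  next
    case (step c v n y)
    let ?m = "hom_modes YM v n f" and ?y = "\<lambda>x. y (f x)"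
    have m: "?m \<in> multiplicity_space U \<rho>" by (rule F.YM_closed[OF step(1) f(1)])
    then have cm: "c *\<^sub>C ?m \<in> multiplicity_space U \<rho>" using F.mod_subspace cvec.subspace_scale by blast
    have "\<phi> (c *\<^sub>C ?m + ?y) = c *\<^sub>C hom_modes YM v n g + (\<lambda>x. y (g x))"
      using step(3) \<phi>(3)[OF step(1) f(1)] linear_on_add[OF \<phi>(1) cm] linear_on_scale[OF \<phi>(1) m]
      by (simp add: g_def)
    moreover have "c *\<^sub>C ?m + ?y \<in> multiplicity_space U \<rho>"
      using cm step(3) F.mod_subspace cvec.subspace_add by blast
    ultimately show ?case
      using step(3) by (simp add: hom_modes_def scaleC_fun_def plus_fun_def YM_zero)
  qed
  moreover have "y (f x) = f x" for x
    using y(2) hf calculation fD(4)[of x] by (cases "x \<in> U") auto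
  moreover have "y (g x) = 0" for x
    using y(2) hg calculation gD(4)[of x] by (cases "x \<in> U'") auto
  ultimately have "\<phi> f = 0" by (simp add: zero_fun_def)
  then show False using gnz by (simp add: g_def)
qed

end

section \<open>The decomposition\<close>

text \<open>Injectivity preserves the support, so both sides sum over the same index set; if it is
  infinite, both are 0.\<close>

lemma Sum_any_linear_inj:
  assumes "linear_on N f" "cvec.subspace N" "inj_on f N" "\<And>p. g p \<in> N"
  shows "Sum_any (\<lambda>p. f (g p)) = f (Sum_any g)"
proof -
  have "f (g p) = 0 \<longleftrightarrow> g p = 0" for p
    using assms linear_on_zero[OF assms(1,2)] cvec.subspace_0[OF assms(2)] by (metis inj_onD)
  then show ?thesis by (simp add: Sum_any.expand_set linear_on_sum[OF assms(1,2,4)])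
qed

lemma va_module_transport:
  assumes M: "va_module A vac Y N YM" and f: "linear_on N f" "inj_on f N"
  shows "va_module A vac Y (f ` N) (\<lambda>v n y. f (YM v n (inv_into N f y)))"
proof -
  interpret va_module A vac Y N YM by (rule M)
  have inv: "inv_into N f (f x) = x" if "x \<in> N" for x using f(2) that by simp
  note fs = linear_on_add[OF f(1), symmetric] linear_on_scale[OF f(1), symmetric]
    cvec.subspace_add[OF mod_subspace] cvec.subspace_scale[OF mod_subspace]
  have f0: "f 0 = 0" by (rule linear_on_zero[OF f(1) mod_subspace])
  show ?thesis
  proof
    show "cvec.subspace (f ` N)"
      by (rule linear_on_subspace_image[OF f(1) mod_subspace])
    show "f (YM u n (inv_into N f y)) \<in> f ` N" if "u \<in> A" "y \<in> f ` N" for u n y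
      using that by (auto simp: inv YM_closed)
    show "linear_on A (\<lambda>u. f (YM u n (inv_into N f y)))" if "y \<in> f ` N" for n y
      using that unfolding linear_on_def by (auto simp: inv YM_add_left YM_scale_left YM_closed fs)
    show "linear_on (f ` N) (\<lambda>y. f (YM u n (inv_into N f y)))" if "u \<in> A" for u n
      using that unfolding linear_on_def by (auto simp: inv fs YM_add YM_scale YM_closed)
    show "\<exists>K. \<forall>n\<ge>K. f (YM u n (inv_into N f y)) = 0" if uy: "u \<in> A" "y \<in> f ` N" for u y
    proof -
      obtain x where x: "x \<in> N" "y = f x" using uy(2) by blast
      obtain K where "\<forall>n\<ge>K. YM u n x = 0" using YM_truncation[OF uy(1) x(1)] ..
      then show ?thesis using x f0 by (intro exI[of _ K]) (auto simp: inv)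
    qed
    show "f (YM vac n (inv_into N f y)) = (if n = - 1 then y else 0)" if "y \<in> f ` N" for n y
      using that by (auto simp: inv YM_vacuum f0)
    show "jacobi_identity Y (\<lambda>v n y. f (YM v n (inv_into N f y))) u v y"
      if uv: "u \<in> A" "v \<in> A" and y: "y \<in> f ` N" for u v y
    proof -
      obtain w where w: "w \<in> N" "y = f w" using y by blast
      note S = Sum_any_linear_inj[OF f(1) mod_subspace f(2)]
      show ?thesis
        unfolding jacobi_identity_def
      proof (intro allI)
        fix a b c
        define G1 where "G1 x = delta_coeff a (b - fst x) (c - snd x) *\<^sub>C
          YM u (- fst x - 1) (YM v (- snd x - 1) w)" for x
        define G2 where "G2 x = ((-1) powi (- a - 1) * delta_coeff a (c - snd x) (b - fst x)) *\<^sub>C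
          YM v (- snd x - 1) (YM u (- fst x - 1) w)" for x
        define G3 where "G3 x = delta_coeff (c - snd x) b (a - fst x) *\<^sub>C
          YM (Y u (- fst x - 1) v) (- snd x - 1) w" for x
        have G: "G1 x \<in> N" "G2 x \<in> N" "G3 x \<in> N" for x
          unfolding G1_def G2_def G3_def
          by (intro cvec.subspace_scale[OF mod_subspace] YM_closed Y_closed uv w(1))+
        have "Sum_any G1 - Sum_any G2 = Sum_any G3"
          using YM_jacobi[OF uv w(1), unfolded jacobi_identity_def, rule_format, of a b c]
          unfolding G1_def G2_def G3_def case_prod_beta' .
        moreover have "Sum_any G1 \<in> N" "Sum_any G2 \<in> N"
          unfolding Sum_any.expand_set using G by (auto intro!: cvec.subspace_sum[OF mod_subspace])
        ultimately have "f (Sum_any G1) - f (Sum_any G2) = f (Sum_any G3)"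
          using linear_on_diff[OF f(1) mod_subspace] by metis
        then have eq: "Sum_any (\<lambda>x. f (G1 x)) - Sum_any (\<lambda>x. f (G2 x)) = Sum_any (\<lambda>x. f (G3 x))"
          using S[where g = G1, OF G(1)] S[where g = G2, OF G(2)] S[where g = G3, OF G(3)] by simp
        show "Sum_any (\<lambda>(p, q). delta_coeff a (b - p) (c - q) *\<^sub>C
            f (YM u (- p - 1) (inv_into N f (f (YM v (- q - 1) (inv_into N f y))))))
          - Sum_any (\<lambda>(p, q). ((-1) powi (- a - 1) * delta_coeff a (c - q) (b - p)) *\<^sub>C
            f (YM v (- q - 1) (inv_into N f (f (YM u (- p - 1) (inv_into N f y))))))
          = Sum_any (\<lambda>(p, q). delta_coeff (c - q) b (a - p) *\<^sub>C
            f (YM (Y u (- p - 1) v) (- q - 1) (inv_into N f y)))"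
          using eq uv w unfolding G1_def G2_def G3_def case_prod_beta'
          by (simp add: inv YM_closed Y_closed linear_on_scale[OF f(1)])
      qed
    qed
  qed
qed

text \<open>Evaluation (w, f) |-> f w is not bilinear on the full types, since f ranges over all
  functions. Pairing the coordinates of w in a basis with the values of f there is bilinear, and it
  gives f w when f is linear on \<open>W\<close>.\<close>

lemma evaluation_map_exists:
  assumes "finite_dim W"
  shows "\<exists>\<beta> :: 'w::complex_vector \<Rightarrow> ('w \<Rightarrow> 'm::complex_vector) \<Rightarrow> 'm.
    cbilinear \<beta> \<and> (\<forall>w\<in>W. \<forall>f. linear_on W f \<longrightarrow> \<beta> w f = f w)"
proof -
  obtain B where B: "cvec.independent B" "cvec.span B = W" "finite B" using assms by (auto simp: finite_dim_def)
  have sub: "cvec.subspace W" using B(2) by auto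
  have BW: "b \<in> W" if "b \<in> B" for b using that B(2) cvec.span_base by blast
  have "\<exists>c. clinear c \<and> (\<forall>x\<in>W. c x = cvec.representation B x b)" for b
  proof -
    have "linear_on W (\<lambda>x. cvec.representation B x b)"
      using B by (simp add: linear_on_def cvec.representation_add cvec.representation_scale scaleC_complex_def)
    then show ?thesis using linear_on_extend[OF _ sub B(1,2)] by metis
  qed
  then obtain c where c: "\<And>b. clinear (c b)" "\<And>b x. x \<in> W \<Longrightarrow> c b x = cvec.representation B x b" by metis
  let ?\<beta> = "\<lambda>w (f :: 'w \<Rightarrow> 'm). \<Sum>b\<in>B. c b w *\<^sub>C f b"
  have "cbilinear ?\<beta>"
    by (rule cbilinearI)
      (simp_all add: clinear_add[OF c(1)] clinear_scale[OF c(1)] sum.distrib cvec.scale_left_distrib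
        cvec.scale_right_distrib cvec.scale_sum_right scaleC_fun_def scaleC_complex_def mult.commute)
  moreover have "?\<beta> w f = f w" if w: "w \<in> W" and f: "linear_on W f" for w and f :: "'w \<Rightarrow> 'm"
  proof -
    have "f w = f (\<Sum>b\<in>B. cvec.representation B w b *\<^sub>C b)"
      using sum_representation[OF B(1) _ B(3)] B(2) w by simp
    also have "\<dots> = (\<Sum>b\<in>B. cvec.representation B w b *\<^sub>C f b)"
      using BW cvec.subspace_scale[OF sub] by (simp add: linear_on_sum[OF f sub] linear_on_scale[OF f])
    finally show ?thesis using c(2)[OF w] by simp
  qed
  ultimately show ?thesis by blast
qed

text \<open>Coordinates of the first factor are moved to the second. One tensor per basis vector is
  the form in which the kernel of evaluation is computed.\<close>

lemma tensor_space_expand: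
  assumes B: "cvec.independent B" "cvec.span B = W" "finite B" and F: "cvec.subspace F"
    and t: "t \<in> tensor_space W F"
  shows "\<exists>f. (\<forall>b\<in>B. f b \<in> F) \<and> t = (\<Sum>b\<in>B. b \<otimes> f b)"
  using t unfolding tensor_space_def
proof (induction rule: cvec.span_induct_alt)
  case base
  show ?case using cvec.subspace_0[OF F] by (intro exI[of _ "\<lambda>_. 0"]) (simp add: tensor_prod_zero)
next
  case (step c x t)
  obtain w g where x: "x = w \<otimes> g" "w \<in> W" "g \<in> F" using step(1) by blast
  obtain f where f: "\<forall>b\<in>B. f b \<in> F" "t = (\<Sum>b\<in>B. b \<otimes> f b)" using step(2) by blast
  let ?r = "cvec.representation B w"
  have lin: "clinear (\<lambda>a. a \<otimes> g)" by (rule clinearI) (simp_all add: tensor_prod_simps)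
  have "x = (\<Sum>b\<in>B. ?r b *\<^sub>C b) \<otimes> g" using sum_representation[OF B(1) _ B(3)] B(2) x by simp
  also have "\<dots> = (\<Sum>b\<in>B. (?r b *\<^sub>C b) \<otimes> g)" by (rule clinear_sum[OF lin])
  also have "\<dots> = (\<Sum>b\<in>B. b \<otimes> (?r b *\<^sub>C g))" by (simp add: tensor_prod_simps)
  finally have "c *\<^sub>C x + t = (\<Sum>b\<in>B. b \<otimes> (c *\<^sub>C ?r b *\<^sub>C g + f b))"
    by (simp add: f(2) cvec.scale_sum_right sum.distrib tensor_prod_simps del: cvec.scale_scale)
  moreover have "\<forall>b\<in>B. c *\<^sub>C ?r b *\<^sub>C g + f b \<in> F"
    using f(1) x(3) F by (auto intro!: cvec.subspace_add cvec.subspace_scale)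
  ultimately show ?case by (intro exI[of _ "\<lambda>b. c *\<^sub>C ?r b *\<^sub>C g + f b"]) blast
qed

section \<open>External direct sums and linear maps out of them\<close>

lemma subspace_external_direct_sum:
  assumes "\<And>i. i \<in> I \<Longrightarrow> cvec.subspace (S i)"
  shows "cvec.subspace (external_direct_sum I S)"
proof (rule cvec.subspaceI)
  have mem: "t \<in> external_direct_sum I S \<longleftrightarrow>
      (\<forall>i. if i \<in> I then Poly_Mapping.lookup t i \<in> S i else Poly_Mapping.lookup t i = 0)" for t
    using assms cvec.subspace_0 by (auto simp: external_direct_sum_def in_keys_iff)
  show "0 \<in> external_direct_sum I S" by (simp add: external_direct_sum_def)
  show "s + t \<in> external_direct_sum I S" if "s \<in> external_direct_sum I S" "t \<in> external_direct_sum I S" for s t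
    using that cvec.subspace_add[OF assms] unfolding mem by (auto simp: lookup_add split: if_splits)
  show "c *\<^sub>C t \<in> external_direct_sum I S" if "t \<in> external_direct_sum I S" for c t
    using that cvec.subspace_scale[OF assms] unfolding mem by (auto split: if_splits)
qed

definition sum_components :: "('i \<Rightarrow> 'a::complex_vector \<Rightarrow> 'b::complex_vector) \<Rightarrow> ('i \<Rightarrow>\<^sub>0 'a) \<Rightarrow> 'b"
  where "sum_components L t = (\<Sum>i\<in>Poly_Mapping.keys t. L i (Poly_Mapping.lookup t i))"

lemma sum_components_superset:
  assumes "\<And>i. clinear (L i)" "finite K" "Poly_Mapping.keys t \<subseteq> K"
  shows "sum_components L t = (\<Sum>i\<in>K. L i (Poly_Mapping.lookup t i))"
  unfolding sum_components_def
  by (rule sum.mono_neutral_left) (use assms clinear_zero[OF assms(1)] in \<open>auto simp: in_keys_iff\<close>)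

lemma clinear_sum_components:
  fixes L :: "'i \<Rightarrow> 'a::complex_vector \<Rightarrow> 'b::complex_vector"
  assumes "\<And>i. clinear (L i)"
  shows "clinear (sum_components L)"
proof (rule clinearI)
  note sup = sum_components_superset[of L, OF assms]
  fix s t :: "'i \<Rightarrow>\<^sub>0 'a" and c :: complex
  let ?K = "Poly_Mapping.keys s \<union> Poly_Mapping.keys t"
  have "sum_components L (s + t) = (\<Sum>i\<in>?K. L i (Poly_Mapping.lookup (s + t) i))"
    by (rule sup) (use Poly_Mapping.keys_add[of s t] in auto)
  moreover have "sum_components L s = (\<Sum>i\<in>?K. L i (Poly_Mapping.lookup s i))" by (rule sup) auto
  moreover have "sum_components L t = (\<Sum>i\<in>?K. L i (Poly_Mapping.lookup t i))" by (rule sup) auto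
  ultimately show "sum_components L (s + t) = sum_components L s + sum_components L t"
    by (simp add: lookup_add clinear_add[OF assms] sum.distrib)
  have "sum_components L (c *\<^sub>C t) = (\<Sum>i\<in>Poly_Mapping.keys t. L i (Poly_Mapping.lookup (c *\<^sub>C t) i))"
    by (rule sup) (auto simp: in_keys_iff)
  then show "sum_components L (c *\<^sub>C t) = c *\<^sub>C sum_components L t"
    by (simp add: sum_components_def clinear_scale[OF assms] cvec.scale_sum_right)
qed

lemma sum_components_single:
  "(\<And>i. clinear (L i)) \<Longrightarrow> sum_components L (Poly_Mapping.single i x) = L i x"
  using sum_components_superset[of L "{i}" "Poly_Mapping.single i x"] by simp

context hopf_va_module
begin

text \<open>Evaluation on the external direct sum is injective by elements of H acting as a matrix
  unit on one W_\<mu> and as 0 on finitely many others, and surjective because each simple summand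
  of M is isomorphic to some W_\<mu>. The actions on the direct sum are then pulled back from
  M.\<close>

lemma decomposition:
  fixes W :: "('h \<Rightarrow> complex) \<Rightarrow> 'w::complex_vector set"
    and \<rho> :: "('h \<Rightarrow> complex) \<Rightarrow> 'h \<Rightarrow> 'w \<Rightarrow> 'w"
  assumes ss: "sum_of_fd_irreducibles UNIV actM"
    and W: "\<And>\<mu>. \<mu> \<in> irreducible_characters \<Longrightarrow> finite_dim (W \<mu>) \<and> irreducible_alg_module (W \<mu>) (\<rho> \<mu>)
      \<and> character (W \<mu>) (\<rho> \<mu>) = \<mu>"
  shows "decomposes_by_evaluation (invariants \<epsilon> act) vac Y UNIV YM actM irreducible_characters W \<rho>
    (\<lambda>\<mu>. multiplicity_space (W \<mu>) (\<rho> \<mu>))"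
proof -
  let ?\<Lambda> = "irreducible_characters :: ('h \<Rightarrow> complex) set"
  define F where "F \<mu> = multiplicity_space (W \<mu>) (\<rho> \<mu>)" for \<mu>
  have Wmod: "alg_module (W \<mu>) (\<rho> \<mu>)" if "\<mu> \<in> ?\<Lambda>" for \<mu>
    using W[OF that] irreducible_alg_module_module by blast
  have Fsub: "cvec.subspace (F \<mu>)" if "\<mu> \<in> ?\<Lambda>" for \<mu>
    unfolding F_def by (rule subspace_multiplicity_space[OF Wmod[OF that]])
  have FD: "linear_on (W \<mu>) f" "\<And>h x. x \<in> W \<mu> \<Longrightarrow> f (\<rho> \<mu> h x) = actM h (f x)"
    "\<And>x. x \<notin> W \<mu> \<Longrightarrow> f x = 0" if "f \<in> F \<mu>" for f \<mu>
    using hom_spaceD[OF that[unfolded F_def]] by auto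
  have "\<exists>\<beta> :: 'w \<Rightarrow> ('w \<Rightarrow> 'm) \<Rightarrow> 'm. cbilinear \<beta> \<and>
      (\<mu> \<in> ?\<Lambda> \<longrightarrow> (\<forall>w\<in>W \<mu>. \<forall>f. linear_on (W \<mu>) f \<longrightarrow> \<beta> w f = f w))" for \<mu>
  proof (cases "\<mu> \<in> ?\<Lambda>")
    case True
    then show ?thesis using evaluation_map_exists[of "W \<mu>"] W[OF True] by blast
  next
    case False
    \<comment> \<open>The default outside \<Lambda> makes \<beta> bilinear for every index, so that
      \<Phi> is linear on the whole type.\<close>
    have "cbilinear (\<lambda>(w :: 'w) (f :: 'w \<Rightarrow> 'm). 0 :: 'm)" by (rule cbilinearI) auto
    with False show ?thesis by blast
  qed
  then obtain \<beta> :: "('h \<Rightarrow> complex) \<Rightarrow> 'w \<Rightarrow> ('w \<Rightarrow> 'm) \<Rightarrow> 'm" where bil: "\<And>\<mu>. cbilinear (\<beta> \<mu>)"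
    and \<beta>: "\<And>\<mu> w f. \<mu> \<in> ?\<Lambda> \<Longrightarrow> w \<in> W \<mu> \<Longrightarrow> linear_on (W \<mu>) f \<Longrightarrow> \<beta> \<mu> w f = f w" by metis
  define L where "L \<mu> = tensor_lift (\<beta> \<mu>)" for \<mu>
  have linL: "clinear (L \<mu>)" for \<mu> unfolding L_def by (rule linear_tensor_lift[OF bil])
  have L: "L \<mu> (w \<otimes> f) = f w" if "\<mu> \<in> ?\<Lambda>" "w \<in> W \<mu>" "f \<in> F \<mu>" for \<mu> w f
    unfolding L_def using that by (simp add: bil \<beta> FD(1))
  define \<Phi> where "\<Phi> = sum_components L"
  have lin\<Phi>: "clinear \<Phi>" unfolding \<Phi>_def by (rule clinear_sum_components[OF linL])
  define D where "D = external_direct_sum ?\<Lambda> (\<lambda>\<mu>. tensor_space (W \<mu>) (F \<mu>))"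
  have Dsub: "cvec.subspace D"
    unfolding D_def by (rule subspace_external_direct_sum) (simp add: tensor_space_def)
  have single: "Poly_Mapping.single \<mu> (w \<otimes> f) \<in> D" "\<Phi> (Poly_Mapping.single \<mu> (w \<otimes> f)) = f w"
    if "\<mu> \<in> ?\<Lambda>" "w \<in> W \<mu>" "f \<in> F \<mu>" for \<mu> w f
  proof -
    have "w \<otimes> f \<in> tensor_space (W \<mu>) (F \<mu>)"
      unfolding tensor_space_def by (rule cvec.span_base) (use that in blast)
    then show "Poly_Mapping.single \<mu> (w \<otimes> f) \<in> D" using that(1) by (simp add: D_def external_direct_sum_def)
    show "\<Phi> (Poly_Mapping.single \<mu> (w \<otimes> f)) = f w"
      unfolding \<Phi>_def using sum_components_single[of L, OF linL] L[OF that] by simp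
  qed
  have ker: "t = 0" if t: "t \<in> D" "\<Phi> t = 0" for t
  proof (rule ccontr)
    assume "t \<noteq> 0"
    let ?K = "Poly_Mapping.keys t"
    have "?K \<noteq> {}" using \<open>t \<noteq> 0\<close> by simp
    then obtain \<mu> where \<mu>: "\<mu> \<in> ?K" by blast
    have K\<Lambda>: "\<nu> \<in> ?\<Lambda>" if "\<nu> \<in> ?K" for \<nu> using t(1) that by (simp add: D_def external_direct_sum_def)
    have "\<exists>p. cvec.independent (fst p) \<and> cvec.span (fst p) = W \<nu> \<and> finite (fst p) \<and>
        (\<forall>b\<in>fst p. snd p b \<in> F \<nu>) \<and> Poly_Mapping.lookup t \<nu> = (\<Sum>b\<in>fst p. b \<otimes> snd p b)"
      if \<nu>: "\<nu> \<in> ?K" for \<nu>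
    proof -
      obtain B where B: "cvec.independent B" "cvec.span B = W \<nu>" "finite B"
        using W[OF K\<Lambda>[OF \<nu>]] by (auto simp: finite_dim_def)
      have "Poly_Mapping.lookup t \<nu> \<in> tensor_space (W \<nu>) (F \<nu>)"
        using t(1) \<nu> by (simp add: D_def external_direct_sum_def)
      then obtain f where "(\<forall>b\<in>B. f b \<in> F \<nu>) \<and> Poly_Mapping.lookup t \<nu> = (\<Sum>b\<in>B. b \<otimes> f b)"
        using tensor_space_expand[OF B Fsub[OF K\<Lambda>[OF \<nu>]]] by blast
      with B show ?thesis by (intro exI[of _ "(B, f)"]) simp
    qed
    then have "\<forall>\<nu>\<in>?K. \<exists>p. cvec.independent (fst p) \<and> cvec.span (fst p) = W \<nu> \<and> finite (fst p) \<and>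
        (\<forall>b\<in>fst p. snd p b \<in> F \<nu>) \<and> Poly_Mapping.lookup t \<nu> = (\<Sum>b\<in>fst p. b \<otimes> snd p b)" by blast
    then obtain p where p: "\<forall>\<nu>\<in>?K. cvec.independent (fst (p \<nu>)) \<and> cvec.span (fst (p \<nu>)) = W \<nu> \<and>
        finite (fst (p \<nu>)) \<and> (\<forall>b\<in>fst (p \<nu>). snd (p \<nu>) b \<in> F \<nu>) \<and>
        Poly_Mapping.lookup t \<nu> = (\<Sum>b\<in>fst (p \<nu>). b \<otimes> snd (p \<nu>) b)"
      by (rule bchoice[THEN exE])
    define B f where "B \<nu> = fst (p \<nu>)" and "f \<nu> = snd (p \<nu>)" for \<nu>
    have B: "cvec.independent (B \<nu>)" "cvec.span (B \<nu>) = W \<nu>" "finite (B \<nu>)"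
      and f: "\<And>b. b \<in> B \<nu> \<Longrightarrow> f \<nu> b \<in> F \<nu>"
      and tf: "Poly_Mapping.lookup t \<nu> = (\<Sum>b\<in>B \<nu>. b \<otimes> f \<nu> b)" if "\<nu> \<in> ?K" for \<nu>
      using p[rule_format, OF that] by (auto simp: B_def f_def)
    have BW: "b \<in> W \<nu>" if "\<nu> \<in> ?K" "b \<in> B \<nu>" for \<nu> b
      using B(2)[OF that(1)] cvec.span_base[OF that(2)] by simp
    have "\<Phi> t = (\<Sum>\<nu>\<in>?K. \<Sum>b\<in>B \<nu>. f \<nu> b b)"
      unfolding \<Phi>_def sum_components_def using tf L K\<Lambda> BW f by (simp add: clinear_sum[OF linL])
    then have zero: "(\<Sum>\<nu>\<in>?K. \<Sum>b\<in>B \<nu>. f \<nu> b b) = 0" using t(2) by simp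
    have "f \<mu> b e = 0" if be: "b \<in> B \<mu>" "e \<in> B \<mu>" for b e
    proof -
      define T where "T x = cvec.representation (B \<mu>) x b *\<^sub>C e" for x
      have "\<exists>h. (\<forall>x\<in>W \<mu>. \<rho> \<mu> h x = T x) \<and> (\<forall>\<nu>\<in>?K - {\<mu>}. \<forall>x\<in>W \<nu>. \<rho> \<nu> h x = 0)"
      proof (rule separating_family)
        show "irreducible_alg_module (W \<nu>) (\<rho> \<nu>) \<and> finite_dim (W \<nu>)" if "\<nu> \<in> insert \<mu> (?K - {\<mu>})" for \<nu>
          using that W[OF K\<Lambda>] \<mu> by auto
        show "\<not> alg_module_iso (W \<nu>) (\<rho> \<nu>) (W \<mu>) (\<rho> \<mu>) \<theta>" if "\<nu> \<in> ?K - {\<mu>}" for \<nu> \<theta>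
          using that character_iso[of "W \<nu>" "\<rho> \<nu>" "W \<mu>" "\<rho> \<mu>" \<theta>] W[OF K\<Lambda>] \<mu> by (metis DiffE singletonI)
        show "linear_on (W \<mu>) T"
          using B(1,2)[OF \<mu>] by (simp add: T_def linear_on_def cvec.representation_add
              cvec.representation_scale cvec.scale_left_distrib)
        show "T x \<in> W \<mu>" for x
          unfolding T_def using BW[OF \<mu> be(2)] alg_module.subspace[OF Wmod[OF K\<Lambda>[OF \<mu>]]]
          by (rule cvec.subspace_scale[rotated])
      qed auto
      then obtain h where h: "\<And>x. x \<in> W \<mu> \<Longrightarrow> \<rho> \<mu> h x = T x"
        "\<And>\<nu> x. \<nu> \<in> ?K - {\<mu>} \<Longrightarrow> x \<in> W \<nu> \<Longrightarrow> \<rho> \<nu> h x = 0" by auto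
      have f0: "f \<nu> c 0 = 0" if "\<nu> \<in> ?K" "c \<in> B \<nu>" for \<nu> c
        using linear_on_zero[OF FD(1)[OF f[OF that]] alg_module.subspace[OF Wmod[OF K\<Lambda>[OF that(1)]]]] .
      have "0 = actM h (\<Sum>\<nu>\<in>?K. \<Sum>c\<in>B \<nu>. f \<nu> c c)" by (simp add: zero)
      also have "\<dots> = (\<Sum>\<nu>\<in>?K. \<Sum>c\<in>B \<nu>. f \<nu> c (\<rho> \<nu> h c))"
        using FD(2)[OF f] BW by (simp add: HM.act_sum)
      also have "\<dots> = (\<Sum>c\<in>B \<mu>. f \<mu> c (\<rho> \<mu> h c))
          + (\<Sum>\<nu>\<in>?K - {\<mu>}. \<Sum>c\<in>B \<nu>. f \<nu> c (\<rho> \<nu> h c))"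
        using \<mu> by (simp add: sum.remove)
      also have "(\<Sum>\<nu>\<in>?K - {\<mu>}. \<Sum>c\<in>B \<nu>. f \<nu> c (\<rho> \<nu> h c)) = 0"
        using h(2) BW f0 by (intro sum.neutral ballI) auto
      also have "(\<Sum>c\<in>B \<mu>. f \<mu> c (\<rho> \<mu> h c)) = (\<Sum>c\<in>B \<mu>. if c = b then f \<mu> b e else 0)"
      proof (rule sum.cong[OF refl])
        fix c assume c: "c \<in> B \<mu>"
        then have "\<rho> \<mu> h c = (if c = b then e else 0)"
          using h(1)[OF BW[OF \<mu> c]] B(1)[OF \<mu>] by (simp add: T_def cvec.representation_basis)
        then show "f \<mu> c (\<rho> \<mu> h c) = (if c = b then f \<mu> b e else 0)" using f0[OF \<mu> c] by simp
      qed
      also have "\<dots> = f \<mu> b e" using be(1) B(3)[OF \<mu>] by simp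
      finally show ?thesis by simp
    qed
    then have "f \<mu> b x = 0" if "b \<in> B \<mu>" for b x
    proof (cases "x \<in> W \<mu>")
      case True
      show ?thesis
        by (rule linear_on_eq_span[of "W \<mu>" "f \<mu> b" "\<lambda>_. 0" "B \<mu>" x])
          (use True that \<open>\<And>e b. b \<in> B \<mu> \<Longrightarrow> e \<in> B \<mu> \<Longrightarrow> f \<mu> b e = 0\<close> FD(1)[OF f[OF \<mu>]] B(2)[OF \<mu>] BW[OF \<mu>]
              alg_module.subspace[OF Wmod[OF K\<Lambda>[OF \<mu>]]] in \<open>auto simp: linear_on_def\<close>)
    next
      case False
      then show ?thesis using FD(3)[OF f[OF \<mu> that]] by blast
    qed
    then have "f \<mu> b = 0" if "b \<in> B \<mu>" for b using that by (auto simp: fun_eq_iff)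
    then have "Poly_Mapping.lookup t \<mu> = 0" using tf[OF \<mu>] by (simp add: tensor_prod_zero)
    then show False using \<mu> by (simp add: in_keys_iff)
  qed
  have inj: "inj_on \<Phi> D"
  proof (rule inj_onI)
    fix s t assume st: "s \<in> D" "t \<in> D" "\<Phi> s = \<Phi> t"
    then have "s - t = 0" by (intro ker cvec.subspace_diff[OF Dsub]) (simp_all add: clinear_diff[OF lin\<Phi>])
    then show "s = t" by simp
  qed
  have "m \<in> \<Phi> ` D" for m
  proof -
    have sub: "cvec.subspace (\<Phi> ` D)" by (rule cpair.linear_subspace_image[OF lin\<Phi> Dsub])
    obtain \<U> where \<U>: "internal_direct_sum UNIV \<U>"
      "\<And>S. S \<in> \<U> \<Longrightarrow> finite_dim S \<and> irreducible_alg_module S actM"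
      using ss unfolding sum_of_fd_irreducibles_def by blast
    obtain g where g: "\<And>S. S \<in> Poly_Mapping.keys g \<Longrightarrow> S \<in> \<U>"
      "\<And>S. S \<in> Poly_Mapping.keys g \<Longrightarrow> Poly_Mapping.lookup g S \<in> S"
      "m = (\<Sum>S\<in>Poly_Mapping.keys g. Poly_Mapping.lookup g S)"
      using internal_direct_sum_decompose[OF \<U>(1) UNIV_I] by blast
    have "x \<in> \<Phi> ` D" if S: "S \<in> \<U>" and x: "x \<in> S" for S x
    proof -
      define \<mu> where "\<mu> = character S actM"
      have \<mu>: "\<mu> \<in> ?\<Lambda>"
        unfolding \<mu>_def using \<U>(2)[OF S] by (intro character_in_irreducible_characters) auto
      obtain \<theta> where "alg_module_iso (W \<mu>) (\<rho> \<mu>) S actM \<theta>"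
        using same_character_iso[of "W \<mu>" "\<rho> \<mu>" S actM] W[OF \<mu>] \<U>(2)[OF S] \<mu>_def by metis
      then have \<theta>: "linear_on (W \<mu>) \<theta>" "\<theta> ` W \<mu> = S" "\<And>h x. x \<in> W \<mu> \<Longrightarrow> \<theta> (\<rho> \<mu> h x) = actM h (\<theta> x)"
        by (auto simp: alg_module_iso_def bij_betw_def)
      interpret W: alg_module "W \<mu>" "\<rho> \<mu>" by (rule Wmod[OF \<mu>])
      \<comment> \<open>Extended by 0 outside the carrier, as \<open>hom_space\<close>
        demands.\<close>
      let ?f = "\<lambda>x. if x \<in> W \<mu> then \<theta> x else 0"
      have f: "?f \<in> F \<mu>"
        unfolding F_def hom_space_def linear_on_def
        using \<theta> W.closed cvec.subspace_add[OF W.subspace] cvec.subspace_scale[OF W.subspace]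
        by (auto simp: linear_on_add[OF \<theta>(1)] linear_on_scale[OF \<theta>(1)])
      obtain w where w: "w \<in> W \<mu>" "x = \<theta> w" using \<theta>(2) x by blast
      show ?thesis
        using single[OF \<mu> w(1) f] w by (intro image_eqI[of _ _ "Poly_Mapping.single \<mu> (w \<otimes> ?f)"]) auto
    qed
    then show ?thesis unfolding g(3) using g(1,2) by (intro cvec.subspace_sum[OF sub]) blast
  qed
  then have bij: "bij_betw \<Phi> D UNIV" using inj by (auto simp: bij_betw_def)
  define \<Psi> where "\<Psi> = inv_into D \<Phi>"
  have \<Psi>\<Phi>: "\<Psi> (\<Phi> t) = t" if "t \<in> D" for t unfolding \<Psi>_def using inj that by simp
  have \<Phi>\<Psi>: "\<Phi> (\<Psi> m) = m" and \<Psi>D: "\<Psi> m \<in> D" for m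
    unfolding \<Psi>_def using bij by (auto simp: bij_betw_def f_inv_into_f inv_into_into)
  have lin\<Psi>: "clinear \<Psi>"
  proof (rule clinearI)
    show "\<Psi> (x + y) = \<Psi> x + \<Psi> y" for x y
      using \<Psi>\<Phi>[of "\<Psi> x + \<Psi> y"] \<Psi>D by (simp add: cvec.subspace_add[OF Dsub] clinear_add[OF lin\<Phi>] \<Phi>\<Psi>)
    show "\<Psi> (c *\<^sub>C x) = c *\<^sub>C \<Psi> x" for c x
      using \<Psi>\<Phi>[of "c *\<^sub>C \<Psi> x"] \<Psi>D by (simp add: cvec.subspace_scale[OF Dsub] clinear_scale[OF lin\<Phi>] \<Phi>\<Psi>)
  qed
  have inj\<Psi>: "inj \<Psi>" using \<Phi>\<Psi> by (metis injI)
  have range\<Psi>: "\<Psi> ` UNIV = D" using \<Psi>D \<Psi>\<Phi> by (metis image_subset_iff rangeI subsetI subset_antisym)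
  have inv\<Psi>: "inv \<Psi> t = \<Phi> t" if "t \<in> D" for t using inj\<Psi> \<Psi>\<Phi>[OF that] by (metis inv_f_f)
  \<comment> \<open>\<open>inv \<Psi>\<close> is the form produced by transport along \<Psi>; on
    \<open>D\<close> it coincides with \<Phi>.\<close>
  define actD where "actD h t = \<Psi> (actM h (inv \<Psi> t))" for h t
  define YD where "YD v n t = \<Psi> (YM v n (inv \<Psi> t))" for v n t
  have "alg_module D actD"
    using alg_module_transport[OF HM.alg_module_axioms clinear_linear_on[OF lin\<Psi>] inj\<Psi>]
    unfolding actD_def alg_module_iso_def range\<Psi> by blast
  moreover have linD: "linear_on D \<Phi>" by (rule clinear_linear_on[OF lin\<Phi>])
  ultimately have iso1: "alg_module_iso D actD UNIV actM \<Phi>"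
    unfolding alg_module_iso_def using HM.alg_module_axioms bij by (auto simp: actD_def \<Phi>\<Psi> inv\<Psi>)
  have inv_mod: "va_module (invariants \<epsilon> act) vac Y UNIV YM"
    by (rule va_module_restrict[OF va_module_axioms invariants_vertex_algebra])
  have "va_module (invariants \<epsilon> act) vac Y D YD"
    using va_module_transport[OF inv_mod clinear_linear_on[OF lin\<Psi>] inj\<Psi>] unfolding YD_def range\<Psi> .
  then have iso2: "va_module_iso (invariants \<epsilon> act) vac Y D YD UNIV YM \<Phi>"
    unfolding va_module_iso_def using inv_mod bij linD by (auto simp: YD_def \<Phi>\<Psi> inv\<Psi>)
  have elements: "\<Phi> (Poly_Mapping.single \<mu> (w \<otimes> f)) = f w \<and>
      (\<forall>h. actD h (Poly_Mapping.single \<mu> (w \<otimes> f)) = Poly_Mapping.single \<mu> (\<rho> \<mu> h w \<otimes> f)) \<and>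
      (\<forall>v\<in>invariants \<epsilon> act. \<forall>n. YD v n (Poly_Mapping.single \<mu> (w \<otimes> f)) =
        Poly_Mapping.single \<mu> (w \<otimes> hom_modes YM v n f))"
    if \<mu>: "\<mu> \<in> ?\<Lambda>" and w: "w \<in> W \<mu>" and f: "f \<in> F \<mu>" for \<mu> w f
  proof (intro conjI allI ballI)
    interpret W: alg_module "W \<mu>" "\<rho> \<mu>" by (rule Wmod[OF \<mu>])
    interpret F: va_module "invariants \<epsilon> act" vac Y "F \<mu>" "hom_modes YM"
      unfolding F_def using multiplicity_space_module[OF Wmod[OF \<mu>]] W[OF \<mu>] by blast
    note s = single[OF \<mu>]
    show "\<Phi> (Poly_Mapping.single \<mu> (w \<otimes> f)) = f w" by (rule s(2)[OF w f])
    show "actD h (Poly_Mapping.single \<mu> (w \<otimes> f)) = Poly_Mapping.single \<mu> (\<rho> \<mu> h w \<otimes> f)" for h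
      using \<Psi>\<Phi>[OF s(1)[OF W.closed[OF w] f]]
      by (simp add: actD_def inv\<Psi> s[OF w f] s(2)[OF W.closed[OF w] f] FD(2)[OF f w])
    show "YD v n (Poly_Mapping.single \<mu> (w \<otimes> f)) = Poly_Mapping.single \<mu> (w \<otimes> hom_modes YM v n f)"
      if "v \<in> invariants \<epsilon> act" for v n
      using \<Psi>\<Phi>[OF s(1)[OF w F.YM_closed[OF that f]]] s(2)[OF w F.YM_closed[OF that f]]
      by (simp add: YD_def inv\<Psi> s[OF w f] hom_modes_def)
  qed
  show ?thesis
    unfolding decomposes_by_evaluation_def Let_def F_def[symmetric] D_def[symmetric]
    using iso1 iso2 elements by blast
qed

end

theorem theorem6p1:
  fixes \<Delta> :: "'h::complex_algebra_1 \<Rightarrow> ('h, 'h) tensor"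
    and \<epsilon> :: "'h \<Rightarrow> complex"
    and antipode :: "'h \<Rightarrow> 'h"
    and vac :: "'v::complex_vector"
    and Y :: "'v \<Rightarrow> int \<Rightarrow> 'v \<Rightarrow> 'v"
    and act :: "'h \<Rightarrow> 'v \<Rightarrow> 'v"
    and YM :: "'v \<Rightarrow> int \<Rightarrow> 'm::complex_vector \<Rightarrow> 'm"
    and actM :: "'h \<Rightarrow> 'm \<Rightarrow> 'm"
    and \<Lambda> :: "('h \<Rightarrow> complex) set"
    and W :: "('h \<Rightarrow> complex) \<Rightarrow> 'w::complex_vector set"
    and \<rho> :: "('h \<Rightarrow> complex) \<Rightarrow> 'h \<Rightarrow> 'w \<Rightarrow> 'w"
    and VH :: "'v set"
    and M :: "('h \<Rightarrow> complex) \<Rightarrow> ('w \<Rightarrow> 'm) set"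
  assumes "hopf_algebra \<Delta> \<epsilon> antipode"
    and "irreducible_vertex_algebra UNIV vac Y"
    and "countable_dim (UNIV :: 'v set)"
    and "module_vertex_algebra \<Delta> \<epsilon> antipode vac Y act"
    and "hopf_va_module \<Delta> \<epsilon> antipode vac Y act YM actM"
    and "irreducible_va_module UNIV vac Y UNIV YM"
    and "sum_of_fd_irreducibles UNIV act"
    and "sum_of_fd_irreducibles UNIV actM"
    and "\<Lambda> = irreducible_characters"
    and "\<And>\<mu>. \<mu> \<in> \<Lambda> \<Longrightarrow> finite_dim (W \<mu>) \<and> irreducible_alg_module (W \<mu>) (\<rho> \<mu>)
      \<and> character (W \<mu>) (\<rho> \<mu>) = \<mu>"
    and "VH = invariants \<epsilon> act"
    and "\<And>\<mu>. M \<mu> = hom_space (W \<mu>) (\<rho> \<mu>) UNIV actM"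
  shows "decomposes_by_evaluation VH vac Y UNIV YM actM \<Lambda> W \<rho> M \<and>
    (\<forall>\<mu>\<in>\<Lambda>. M \<mu> \<noteq> {0} \<longrightarrow> irreducible_va_module VH vac Y (M \<mu>) (hom_modes YM)) \<and>
    (\<forall>\<mu>\<in>\<Lambda>. \<forall>\<nu>\<in>\<Lambda>. M \<mu> \<noteq> {0} \<longrightarrow> M \<nu> \<noteq> {0} \<longrightarrow>
      ((\<exists>\<phi>. va_module_iso VH vac Y (M \<mu>) (hom_modes YM) (M \<nu>) (hom_modes YM) \<phi>)
       \<longleftrightarrow> \<mu> = \<nu>))"
proof -
  interpret hopf_va_module \<Delta> \<epsilon> antipode vac Y act YM actM by (rule assms(5))
  note irr = assms(6) and V = assms(3) and ss = assms(7)
  have W: "irreducible_alg_module (W \<mu>) (\<rho> \<mu>)" "finite_dim (W \<mu>)" "character (W \<mu>) (\<rho> \<mu>) = \<mu>"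
    if "\<mu> \<in> \<Lambda>" for \<mu> using assms(10)[OF that] by auto
  have M: "M = (\<lambda>\<mu>. hom_space (W \<mu>) (\<rho> \<mu>) UNIV actM)" using assms(12) by blast
  show ?thesis
  proof (intro conjI ballI impI iffI)
    show "decomposes_by_evaluation VH vac Y UNIV YM actM \<Lambda> W \<rho> M"
      unfolding M assms(9,11) by (rule decomposition[OF assms(8)]) (use assms(9,10) in simp)
    show "irreducible_va_module VH vac Y (M \<mu>) (hom_modes YM)" if "\<mu> \<in> \<Lambda>" "M \<mu> \<noteq> {0}" for \<mu>
      using that unfolding M assms(11)
      by (intro multiplicity_space_irreducible[OF irr V ss W(1,2)[OF that(1)]])
    fix \<mu> \<nu> assume \<mu>: "\<mu> \<in> \<Lambda>" "M \<mu> \<noteq> {0}" and \<nu>: "\<nu> \<in> \<Lambda>"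
    show "\<mu> = \<nu>" if "\<exists>\<phi>. va_module_iso VH vac Y (M \<mu>) (hom_modes YM) (M \<nu>) (hom_modes YM) \<phi>"
    proof (rule ccontr)
      assume ne: "\<mu> \<noteq> \<nu>"
      \<comment> \<open>Isomorphic modules have equal characters, and the characters here are the
        distinct indices \<nu> and \<mu>.\<close>
      have "\<nexists>\<theta>. alg_module_iso (W \<nu>) (\<rho> \<nu>) (W \<mu>) (\<rho> \<mu>) \<theta>"
        using character_iso W(2,3)[OF \<mu>(1)] W(2,3)[OF \<nu>] ne by metis
      then show False
        using that multiplicity_spaces_not_iso[OF irr V ss W(1,2)[OF \<mu>(1)] W(1,2)[OF \<nu>]] \<mu>(2)
        unfolding M assms(11) by blast
    qed
    show "\<exists>\<phi>. va_module_iso VH vac Y (M \<mu>) (hom_modes YM) (M \<nu>) (hom_modes YM) \<phi>" if "\<mu> = \<nu>"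
    proof -
      have "va_module VH vac Y (M \<mu>) (hom_modes YM)"
        unfolding M assms(11)
        by (rule multiplicity_space_module[OF irreducible_alg_module_module[OF W(1)[OF \<mu>(1)]] W(2)[OF \<mu>(1)]])
      then show ?thesis
        using that by (intro exI[of _ "\<lambda>x. x"]) (simp add: va_module_iso_def linear_on_def bij_betw_def)
    qed
  qed
qed

end
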